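(* Let $\Omega\subset\mathbb{R}^d$ be a bounded Lipschitz domain, let $\gamma\in\mathcal{M}(\Omega)$ be a finite positive measure, let $f\in L^2(\Omega)$, and let $$u=\operatorname*{arg\,min}_{v\in \mathrm{BV}(\Omega)\cap L^2(\Omega)}\ \frac12\|v-f\|_{L^2(\Omega)}^2+\mathrm{TV}_{\mathrm{pwL}}^{\gamma}(v).$$ Then $$\operatorname*{ess\,sup}_{x\in\Omega} u(x)\le \operatorname*{ess\,sup}_{x\in\Omega} f(x)\qquad\text{and}\qquad \operatorname*{ess\,inf}_{x\in\Omega} u(x)\ge \operatorname*{ess\,inf}_{x\in\Omega} f(x).$$
   Context: $\mathcal{M}(\Omega)$ is the space of finite signed (scalar) Radon measures on $\Omega$. $\mathfrak{M}(\Omega;\mathbb{R}^d)$ is the space of finite $\mathbb{R}^d$-valued Radon measures; for $g$ in it, $|g|\in\mathcal{M}(\Omega)$ is its variation measure (with respect to the Euclidean norm on $\mathbb{R}^d$) and $\|g\|_{\mathfrak{M}}=|g|(\Omega)$. A measure $\mu\in\mathcal{M}(\Omega)$ is positive if $\mu(E)\ge 0$ for every Borel $E\subseteq\Omega$; $\mu_1\le\mu_2$ means that $\mu_2-\mu_1$ is positive. $Du$ is the distributional gradient of $u$. For a finite positive measure $\gamma$ and $u\in L^1(\Omega)$, $$\mathrm{TV}_{\mathrm{pwL}}^{\gamma}(u):=\min_{g\in\mathfrak{M}(\Omega;\mathbb{R}^d),\ |g|\le\gamma}\|Du-g\|_{\mathfrak{M}},$$ with value $+\infty$ if $Du$ is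 not a finite Radon measure. *)

theory Defs
  imports "HOL-Analysis.Analysis" "HOL-Probability.Essential_Supremum"
begin

text \<open>The space \<open>\<real>\<^sup>d\<close> is an arbitrary type \<open>'a\<close> of class \<open>euclidean_space\<close>, with \<open>d = DIM('a) \<ge> 1\<close>.
  Functions on \<open>\<Omega>\<close> are total functions on \<open>'a\<close>, of which only the values on \<open>\<Omega>\<close> matter.\<close>

subsection \<open>Bounded Lipschitz domains\<close>

text \<open>Near each boundary point, \<open>\<Omega>\<close> is the strict epigraph, in some unit direction \<open>n\<close>, of a
  Lipschitz function \<open>\<psi>\<close> on the hyperplane orthogonal to \<open>n\<close>.\<close>

definition lipschitz_boundary :: "'a::euclidean_space set \<Rightarrow> bool" where
  "lipschitz_boundary \<Omega> \<longleftrightarrow>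
    (\<forall>p\<in>frontier \<Omega>. \<exists>r>0. \<exists>n \<psi> L. norm n = 1 \<and> L-lipschitz_on {y. y \<bullet> n = 0} \<psi> \<and>
      \<Omega> \<inter> ball p r = {x \<in> ball p r. x \<bullet> n > (\<psi> (x - (x \<bullet> n) *\<^sub>R n) :: real)})"

definition bounded_lipschitz_domain :: "'a::euclidean_space set \<Rightarrow> bool" where
  "bounded_lipschitz_domain \<Omega> \<longleftrightarrow>
    open \<Omega> \<and> connected \<Omega> \<and> \<Omega> \<noteq> {} \<and> bounded \<Omega> \<and> lipschitz_boundary \<Omega>"

subsection \<open>Finite vector-valued measures\<close>

abbreviation borel_on :: "'a::topological_space set \<Rightarrow> 'a measure" where
  "borel_on \<Omega> \<equiv> restrict_space borel \<Omega>"

text \<open>A finite vector-valued measure is a countably additive set function, considered on \<open>sets M\<close>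
  only. On the Borel sets of an open subset of \<open>\<real>\<^sup>d\<close>, these are exactly the finite vector-valued
  Radon measures.\<close>

definition vector_measures :: "'a measure \<Rightarrow> ('a set \<Rightarrow> 'b::real_normed_vector) set" where
  "vector_measures M = {\<mu>. \<forall>A :: nat \<Rightarrow> 'a set. range A \<subseteq> sets M \<longrightarrow> disjoint_family A \<longrightarrow>
     (\<lambda>n. \<mu> (A n)) sums \<mu> (\<Union>n. A n)}"

definition variation :: "'a measure \<Rightarrow> ('a set \<Rightarrow> 'b::real_normed_vector) \<Rightarrow> 'a set \<Rightarrow> ennreal" where
  "variation M \<mu> E =
    (SUP A\<in>{A :: nat \<Rightarrow> 'a set. range A \<subseteq> sets M \<and> disjoint_family A \<and> (\<Union>n. A n) = E}.
       \<Sum>n. ennreal (norm (\<mu> (A n))))"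

definition total_variation_norm :: "'a measure \<Rightarrow> ('a set \<Rightarrow> 'b::real_normed_vector) \<Rightarrow> ennreal" where
  "total_variation_norm M \<mu> = variation M \<mu> (space M)"

text \<open>The upper variation \<open>\<nu>\<^sup>+ E = sup {\<nu> F | F \<subseteq> E measurable}\<close> of a finite signed measure \<open>\<nu>\<close>, which
  is a finite measure. Negative values are truncated by \<open>ennreal\<close>, harmlessly as \<open>\<nu> {} = 0\<close>.\<close>

definition upper_variation :: "'a measure \<Rightarrow> ('a set \<Rightarrow> real) \<Rightarrow> 'a measure" where
  "upper_variation M \<nu> =
    measure_of (space M) (sets M) (\<lambda>E. SUP F\<in>{F \<in> sets M. F \<subseteq> E}. ennreal (\<nu> F))"

text \<open>The integral against a finite signed measure, by its Jordan decomposition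
  \<open>\<nu> = \<nu>\<^sup>+ - (-\<nu>)\<^sup>+\<close>.\<close>

definition signed_integral :: "'a measure \<Rightarrow> ('a set \<Rightarrow> real) \<Rightarrow> ('a \<Rightarrow> real) \<Rightarrow> real" where
  "signed_integral M \<nu> \<phi> =
    (LINT x|upper_variation M \<nu>. \<phi> x) - (LINT x|upper_variation M (\<lambda>E. - \<nu> E). \<phi> x)"

subsection \<open>Test functions, distributional gradient, BV\<close>

primrec Ck_function :: "nat \<Rightarrow> ('a::euclidean_space \<Rightarrow> real) \<Rightarrow> bool" where
  "Ck_function 0 \<phi> = continuous_on UNIV \<phi>"
| "Ck_function (Suc k) \<phi> = ((\<forall>x. \<phi> differentiable (at x)) \<and>
     (\<forall>i\<in>Basis. Ck_function k (\<lambda>x. frechet_derivative \<phi> (at x) i)))"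

definition test_functions :: "'a::euclidean_space set \<Rightarrow> ('a \<Rightarrow> real) set" where
  "test_functions \<Omega> =
    {\<phi>. (\<forall>k. Ck_function k \<phi>) \<and> (\<exists>K. compact K \<and> K \<subseteq> \<Omega> \<and> (\<forall>x. x \<notin> K \<longrightarrow> \<phi> x = 0))}"

definition has_distr_gradient ::
    "'a::euclidean_space set \<Rightarrow> ('a \<Rightarrow> real) \<Rightarrow> ('a set \<Rightarrow> 'a) \<Rightarrow> bool" where
  "has_distr_gradient \<Omega> u \<mu> \<longleftrightarrow> \<mu> \<in> vector_measures (borel_on \<Omega>) \<and>
    (\<forall>\<phi>\<in>test_functions \<Omega>. \<forall>i\<in>Basis.
       (LINT x|lebesgue_on \<Omega>. u x * frechet_derivative \<phi> (at x) i) =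
         - signed_integral (borel_on \<Omega>) (\<lambda>E. \<mu> E \<bullet> i) \<phi>)"

definition distr_gradient_is_measure :: "'a::euclidean_space set \<Rightarrow> ('a \<Rightarrow> real) \<Rightarrow> bool" where
  "distr_gradient_is_measure \<Omega> u \<longleftrightarrow> (\<exists>\<mu>. has_distr_gradient \<Omega> u \<mu>)"

text \<open>For open \<open>\<Omega>\<close>, the gradient measure is unique on the Borel subsets of \<open>\<Omega>\<close>; the choice below
  only concerns its irrelevant values on other sets.\<close>

definition distr_gradient :: "'a::euclidean_space set \<Rightarrow> ('a \<Rightarrow> real) \<Rightarrow> 'a set \<Rightarrow> 'a" where
  "distr_gradient \<Omega> u = (SOME \<mu>. has_distr_gradient \<Omega> u \<mu>)"

definition BV :: "'a::euclidean_space set \<Rightarrow> ('a \<Rightarrow> real) set" where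
  "BV \<Omega> = {u. integrable (lebesgue_on \<Omega>) u \<and> distr_gradient_is_measure \<Omega> u}"

definition L2 :: "'a::euclidean_space set \<Rightarrow> ('a \<Rightarrow> real) set" where
  "L2 \<Omega> = {u \<in> borel_measurable (lebesgue_on \<Omega>). integrable (lebesgue_on \<Omega>) (\<lambda>x. (u x)\<^sup>2)}"

definition L2_norm :: "'a::euclidean_space set \<Rightarrow> ('a \<Rightarrow> real) \<Rightarrow> real" where
  "L2_norm \<Omega> u = sqrt (LINT x|lebesgue_on \<Omega>. (u x)\<^sup>2)"

subsection \<open>Piecewise Lipschitz total variation and the denoising energy\<close>

text \<open>The infimum over \<open>g\<close> is attained (by weak-* compactness), so it is the minimum.\<close>

definition TV_pwL :: "'a::euclidean_space set \<Rightarrow> 'a measure \<Rightarrow> ('a \<Rightarrow> real) \<Rightarrow> ennreal" where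
  "TV_pwL \<Omega> \<gamma> u =
    (if distr_gradient_is_measure \<Omega> u then
       INF g\<in>{g \<in> vector_measures (borel_on \<Omega>).
               \<forall>E\<in>sets (borel_on \<Omega>). variation (borel_on \<Omega>) g E \<le> emeasure \<gamma> E}.
         total_variation_norm (borel_on \<Omega>) (\<lambda>E. distr_gradient \<Omega> u E - g E)
     else \<infinity>)"

definition TV_pwL_energy ::
    "'a::euclidean_space set \<Rightarrow> 'a measure \<Rightarrow> ('a \<Rightarrow> real) \<Rightarrow> ('a \<Rightarrow> real) \<Rightarrow> ennreal" where
  "TV_pwL_energy \<Omega> \<gamma> f v = ennreal (1/2 * (L2_norm \<Omega> (\<lambda>x. v x - f x))\<^sup>2) + TV_pwL \<Omega> \<gamma> v"

subsection \<open>Essential infimum\<close>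

text \<open>Dual to \<^const>\<open>esssup\<close>.\<close>

definition essinf :: "'a measure \<Rightarrow> ('a \<Rightarrow> ereal) \<Rightarrow> ereal" where
  "essinf M f = (if f \<in> borel_measurable M then Liminf (ae_filter M) f else bot)"

end

theory Submission
  imports Defs
begin

text \<open>Let \<open>p\<close> be \<open>1\<close>-Lipschitz on \<open>\<real>\<close>, applied to a minimizer \<open>u\<close> as the truncation \<open>min u c\<close> or
  \<open>max u c\<close>. Pointwise \<open>p \<circ> u\<close> is at least as close to \<open>f\<close> as \<open>u\<close>, so everything rests on
  \<open>TV(p \<circ> u) \<le> TV(u)\<close>.

  Suppose \<open>Du\<close> is dominated by a finite measure \<open>M\<close>. Since the difference quotients of \<open>p \<circ> u\<close> are
  bounded by those of \<open>u\<close>, the functional \<open>\<phi> \<mapsto> - \<integral> (p \<circ> u) \<nabla>\<phi>\<close> is bounded by \<open>\<integral> \<bar>\<phi>\<bar> dM\<close> as well.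
  Test functions are dense in \<open>L\<^sup>1(M)\<close>, so it extends to a contraction \<open>T\<close> from \<open>L\<^sup>1(M)\<close> to \<open>\<real>\<^sup>d\<close>, and
  \<open>E \<mapsto> T 1\<^sub>E\<close> is the gradient of \<open>p \<circ> u\<close>.

  Given \<open>\<bar>g\<bar> \<le> \<gamma>\<close>, this applies with \<open>M = \<gamma> + \<bar>Du - g\<bar>\<close>. With the density \<open>r = d\<gamma>/dM\<close>, the measure
  \<open>g' E = T (r 1\<^sub>E)\<close> satisfies \<open>\<bar>g'\<bar> \<le> \<gamma>\<close> and \<open>\<bar>D(p \<circ> u) - g'\<bar> \<le> (1 - r) M = \<bar>Du - g\<bar>\<close>.\<close>
subsection \<open>Smooth functions\<close>

text \<open>The splitting is what reduces the claim to domination: \<open>M\<close> is the sum of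
  \<open>r M\<close> and \<open>(1 - r) M\<close>, so anything dominated by \<open>M\<close> splits
  along the same density, and of the gradient of \<open>p \<circ> u\<close> one only has to know
  that it is dominated by \<open>M\<close>. No chain rule and no formula for that gradient enters.
  Two obstacles shape the details. Every bound must carry the constant 1: adding coordinate bounds
  would lose a factor depending on the dimension, hence the use of all unit directions and of
  contractions whose constant is read off from indicators. Moreover, the bound on the gradient
  functional concerns signed integrals, while a Lipschitz function controls only absolute values of
  differences. The sign of a difference is therefore approximated by a smooth multiplier. Its
  derivative is beyond control, but differentiating in the length of the shift leaves a bound in
  which only the size of the multiplier appears.\<close>

abbreviation pderiv_at :: "('a::euclidean_space \<Rightarrow> real) \<Rightarrow> 'a \<Rightarrow> 'a \<Rightarrow> real" where
  "pderiv_at \<phi> i x \<equiv> frechet_derivative \<phi> (at x) i"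

text \<open>Derivatives at a point of the whole space are unique, so the chosen
  \<open>frechet_derivative\<close> may be replaced by any explicit formula. All closure properties
  below go through this rule.\<close>

lemma Ck_function_SucI:
  assumes "\<And>x. (f has_derivative f' x) (at x)" "\<And>i. i \<in> Basis \<Longrightarrow> Ck_function k (\<lambda>x. f' x i)"
  shows "Ck_function (Suc k) f"
proof -
  have "frechet_derivative f (at x) = f' x" for x
    using frechet_derivative_at[OF assms(1)] by simp
  with assms show ?thesis
    by (auto simp: differentiable_def)
qed

lemma Ck_function_SucD:
  assumes "Ck_function (Suc k) f"
  shows "(f has_derivative frechet_derivative f (at x)) (at x)"
  using assms frechet_derivative_works by auto

lemma Ck_function_continuous: "Ck_function k f \<Longrightarrow> continuous_on UNIV f"
  by (cases k) (auto simp: continuous_on_eq_continuous_at differentiable_imp_continuous_within)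

lemma Ck_function_less: "Ck_function (Suc k) f \<Longrightarrow> Ck_function k f"
proof (induction k arbitrary: f)
  case 0
  then show ?case using Ck_function_continuous[OF 0] by simp
qed auto

lemma Ck_function_const: "Ck_function k (\<lambda>x. c)"
proof (induction k arbitrary: c)
  case (Suc k)
  show ?case by (rule Ck_function_SucI[where f' = "\<lambda>x h. 0"]) (auto intro: Suc)
qed auto

lemma Ck_function_add: "Ck_function k f \<Longrightarrow> Ck_function k g \<Longrightarrow> Ck_function k (\<lambda>x. f x + g x)"
proof (induction k arbitrary: f g)
  case (Suc k)
  show ?case
    by (rule Ck_function_SucI, rule has_derivative_add[OF Ck_function_SucD Ck_function_SucD])
       (use Suc in auto)
qed (auto intro!: continuous_intros)

lemma Ck_function_mult: "Ck_function k f \<Longrightarrow> Ck_function k g \<Longrightarrow> Ck_function k (\<lambda>x. f x * g x)"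
proof (induction k arbitrary: f g)
  case (Suc k)
  note D = has_derivative_mult[OF Ck_function_SucD[OF Suc.prems(1)] Ck_function_SucD[OF Suc.prems(2)]]
  show ?case
    by (rule Ck_function_SucI, rule D, rule Ck_function_add; rule Suc.IH)
       (use Suc.prems Ck_function_less in auto)
qed (auto intro!: continuous_intros)

lemma Ck_function_diff: "Ck_function k f \<Longrightarrow> Ck_function k g \<Longrightarrow> Ck_function k (\<lambda>x. f x - g x)"
  using Ck_function_add[of k f "\<lambda>x. (-1) * g x"] Ck_function_mult[OF Ck_function_const[of k "-1"], of g]
  by simp

lemma Ck_function_power: "Ck_function k f \<Longrightarrow> Ck_function k (\<lambda>x. f x ^ n)"
  by (induction n) (auto intro: Ck_function_const Ck_function_mult)

lemma Ck_function_prod: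
  "(\<And>i. i \<in> I \<Longrightarrow> Ck_function k (f i)) \<Longrightarrow> Ck_function k (\<lambda>x. \<Prod>i\<in>I. f i x)"
  by (induction I rule: infinite_finite_induct) (auto intro: Ck_function_const Ck_function_mult)

lemma Ck_function_compose:
  fixes h :: "real \<Rightarrow> real"
  shows "Ck_function k h \<Longrightarrow> Ck_function k f \<Longrightarrow> Ck_function k (\<lambda>x. h (f x))"
proof (induction k arbitrary: h f)
  case 0
  then show ?case
    using continuous_on_compose2[of UNIV h UNIV f] by simp
next
  case (Suc k)
  let ?h = "\<lambda>t. frechet_derivative h (at t) 1" and ?f = "\<lambda>x. frechet_derivative f (at x)"
  \<comment> \<open>A linear map on the reals is multiplication by its value at 1; the chain rule
    then yields a product, to which \<open>Ck_function_mult\<close> applies.\<close>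
  have "(h has_derivative (\<lambda>s. s * ?h t)) (at t)" for t
  proof -
    have "linear (frechet_derivative h (at t))"
      using Ck_function_SucD[OF Suc.prems(1)] has_derivative_linear by blast
    then have "frechet_derivative h (at t) = (\<lambda>s. s * ?h t)"
      by (metis linear_scale mult.right_neutral real_scaleR_def)
    then show ?thesis
      using Ck_function_SucD[OF Suc.prems(1), of t] by simp
  qed
  from has_derivative_compose[OF Ck_function_SucD[OF Suc.prems(2)] this]
  have D: "((\<lambda>x. h (f x)) has_derivative (\<lambda>s. ?f x s * ?h (f x))) (at x)" for x .
  show ?case
    by (rule Ck_function_SucI, rule D, rule Ck_function_mult)
       (use Suc Ck_function_less[OF Suc.prems(2)] in auto)
qed

lemma Ck_function_translate: "Ck_function k f \<Longrightarrow> Ck_function k (\<lambda>x. f (x + a))"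
proof (induction k arbitrary: f)
  case 0
  then have "continuous_on UNIV f" by simp
  then have "continuous_on UNIV (\<lambda>x. f (x + a))"
    by (rule continuous_on_compose2) (auto intro: continuous_on_add continuous_on_id continuous_on_const)
  then show ?case by simp
next
  case (Suc k)
  have "((\<lambda>x. x + a) has_derivative (\<lambda>h. h)) (at x)" for x
    by (auto intro!: derivative_eq_intros)
  from has_derivative_compose[OF this Ck_function_SucD[OF Suc.prems]]
  have D: "((\<lambda>x. f (x + a)) has_derivative (\<lambda>h. frechet_derivative f (at (x + a)) h)) (at x)" for x .
  show ?case
    by (rule Ck_function_SucI, rule D, rule Suc.IH) (use Suc.prems in auto)
qed

lemma Ck_function_inner_left: "Ck_function k (\<lambda>x. x \<bullet> a)"
proof (cases k)
  case (Suc k)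
  show ?thesis unfolding Suc
    by (rule Ck_function_SucI[where f' = "\<lambda>x h. h \<bullet> a"])
       (auto intro!: derivative_eq_intros Ck_function_const)
qed (auto intro!: continuous_intros)

lemma Ck_function_inner_self: "Ck_function k (\<lambda>x. x \<bullet> x)"
proof (cases k)
  case (Suc k)
  have "Ck_function k (\<lambda>x. 2 * (x \<bullet> i))" for i :: 'a
    by (intro Ck_function_mult Ck_function_const Ck_function_inner_left)
  then show ?thesis unfolding Suc
    by (intro Ck_function_SucI[where f' = "\<lambda>x h. 2 * (x \<bullet> h)"])
       (auto intro!: derivative_eq_intros simp: inner_commute)
qed (auto intro!: continuous_intros)

section \<open>The flat exponential and its smoothness\<close>

definition flat_exp :: "nat \<Rightarrow> real \<Rightarrow> real" where
  "flat_exp k t = (if t > 0 then (1 / t) ^ k * exp (- (1 / t)) else 0)"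

text \<open>With \<open>s = 1 / t\<close> this is the decay of \<open>s ^ k / exp s\<close> at
  infinity; from the left the function is constantly 0.\<close>

lemma tendsto_flat_exp_0: "(flat_exp k \<longlongrightarrow> 0) (at 0)"
proof -
  have "((\<lambda>t::real. (1 / t) ^ k / exp (1 / t)) \<longlongrightarrow> 0) (at_right 0)"
    using filterlim_compose[OF tendsto_power_div_exp_0 filterlim_inverse_at_top_right, of k]
    by (simp add: inverse_eq_divide)
  then have "(flat_exp k \<longlongrightarrow> 0) (at_right 0)"
  proof (rule Lim_transform_eventually)
    show "\<forall>\<^sub>F t in at_right 0. (1 / t) ^ k / exp (1 / t) = flat_exp k t"
      by (simp add: eventually_at_filter flat_exp_def exp_minus field_simps)
  qed
  moreover have "(flat_exp k \<longlongrightarrow> 0) (at_left 0)"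
  proof (rule Lim_transform_eventually[OF tendsto_const])
    show "\<forall>\<^sub>F t in at_left 0. 0 = flat_exp k t"
      by (simp add: eventually_at_filter flat_exp_def)
  qed
  ultimately show ?thesis
    by (simp add: filterlim_at_split)
qed

text \<open>The exponent \<open>k\<close> is there for this formula: it makes the family closed
  under differentiation up to linear combinations, so that one induction proves all members
  smooth.\<close>

lemma has_field_derivative_flat_exp:
  "(flat_exp k has_real_derivative flat_exp (k + 2) t - real k * flat_exp (k + 1) t) (at t)"
proof -
  consider "t > 0" | "t < 0" | "t = 0" by linarith
  then show ?thesis
  proof cases
    case 1
    have inv: "((\<lambda>t. 1 / t) has_real_derivative - ((1 / t)\<^sup>2)) (at t)"
      using 1 by (auto intro!: derivative_eq_intros simp: power2_eq_square)
    have "((\<lambda>t. (1 / t) ^ k) has_real_derivative real k * (- ((1 / t)\<^sup>2) * (1 / t) ^ (k - 1))) (at t)"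
      using DERIV_power[OF inv, of k] by simp
    \<comment> \<open>For \<open>k = 0\<close> the truncated \<open>k - 1\<close> does no harm, as
      the factor \<open>real k\<close> vanishes.\<close>
    moreover have "real k * (- ((1 / t)\<^sup>2) * (1 / t) ^ (k - 1)) = - (real k * (1 / t) ^ (k + 1))"
      by (cases k) (simp_all add: power2_eq_square)
    moreover have "((\<lambda>t. exp (- (1 / t))) has_real_derivative exp (- (1 / t)) * (1 / t)\<^sup>2) (at t)"
      using DERIV_chain2[OF DERIV_exp DERIV_minus[OF inv]] by simp
    ultimately have "((\<lambda>t. (1 / t) ^ k * exp (- (1 / t))) has_real_derivative
        - (real k * (1 / t) ^ (k + 1)) * exp (- (1 / t)) + exp (- (1 / t)) * (1 / t)\<^sup>2 * (1 / t) ^ k) (at t)"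
      using DERIV_mult by fastforce
    then have "((\<lambda>t. (1 / t) ^ k * exp (- (1 / t))) has_real_derivative
        flat_exp (k + 2) t - real k * flat_exp (k + 1) t) (at t)"
      using 1 by (simp add: flat_exp_def power2_eq_square algebra_simps)
    then show ?thesis
      by (rule has_field_derivative_transform_within_open[of _ _ _ "{0<..}"])
         (use 1 in \<open>auto simp: flat_exp_def\<close>)
  next
    case 2
    have "((\<lambda>t. 0) has_real_derivative 0) (at t)" by simp
    then have "(flat_exp k has_real_derivative 0) (at t)"
      by (rule has_field_derivative_transform_within_open[of _ _ _ "{..<0}"])
         (use 2 in \<open>auto simp: flat_exp_def\<close>)
    then show ?thesis using 2 by (simp add: flat_exp_def)
  next
    case 3
    \<comment> \<open>Dividing by \<open>h\<close> raises the exponent by one, so differentiability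
      at 0 is again the limit at 0, for the next member of the family.\<close>
    have "(flat_exp k (0 + h) - flat_exp k 0) / h = flat_exp (k + 1) h" for h
      by (auto simp: flat_exp_def field_simps)
    then have "(flat_exp k has_real_derivative 0) (at 0)"
      unfolding DERIV_def using tendsto_flat_exp_0[of "k + 1"] by simp
    then show ?thesis using 3 by (simp add: flat_exp_def)
  qed
qed

lemma Ck_function_flat_exp: "Ck_function n (flat_exp k)"
proof (induction n arbitrary: k)
  case 0
  have "isCont (flat_exp k) t" for t
    by (rule DERIV_isCont[OF has_field_derivative_flat_exp])
  then show ?case by (simp add: continuous_at_imp_continuous_on)
next
  case (Suc n)
  show ?case
  proof (rule Ck_function_SucI)
    show "(flat_exp k has_derivative (\<lambda>h. (flat_exp (k + 2) t - real k * flat_exp (k + 1) t) * h)) (at t)" for t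
      using has_field_derivative_flat_exp[of k t] by (simp add: has_field_derivative_def)
    show "Ck_function n (\<lambda>t. (flat_exp (k + 2) t - real k * flat_exp (k + 1) t) * i)" for i
      by (intro Ck_function_mult Ck_function_diff Ck_function_const Suc)
  qed
qed

subsection \<open>Test functions\<close>

lemma test_functionsD:
  assumes "\<phi> \<in> test_functions \<Omega>"
  shows test_function_Ck: "Ck_function k \<phi>"
    and test_function_has_derivative: "(\<phi> has_derivative frechet_derivative \<phi> (at x)) (at x)"
    and test_function_continuous: "continuous_on UNIV \<phi>"
proof -
  show Ck: "Ck_function k \<phi>" for k
    using assms by (simp add: test_functions_def)
  show "continuous_on UNIV \<phi>" "(\<phi> has_derivative frechet_derivative \<phi> (at x)) (at x)"
    using Ck_function_continuous[OF Ck] Ck_function_SucD[OF Ck] by auto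
qed

lemma test_function_support:
  assumes "\<phi> \<in> test_functions \<Omega>"
  obtains K where "compact K" "K \<subseteq> \<Omega>" "\<And>x. x \<notin> K \<Longrightarrow> \<phi> x = 0"
    "\<And>x e. x \<notin> K \<Longrightarrow> pderiv_at \<phi> e x = 0"
proof -
  obtain K where K: "compact K" "K \<subseteq> \<Omega>" "\<And>x. x \<notin> K \<Longrightarrow> \<phi> x = 0"
    using assms by (auto simp: test_functions_def)
  have "pderiv_at \<phi> e x = 0" if "x \<notin> K" for x e
  proof -
    \<comment> \<open>The complement of \<open>K\<close> is open and \<open>\<phi>\<close> vanishes
      on it, so the same \<open>K\<close> also confines all derivatives.\<close>
    have "((\<lambda>x. 0) has_derivative (\<lambda>h. 0)) (at x)" by simp
    then have "(\<phi> has_derivative (\<lambda>h. 0)) (at x)"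
      by (rule has_derivative_transform_within_open[of _ _ _ _ "- K"])
         (use K that in \<open>auto simp: compact_imp_closed open_Compl\<close>)
    from frechet_derivative_at[OF this] show ?thesis
      by (metis (no_types))
  qed
  with K that show thesis by blast
qed

lemma test_functionsI:
  assumes "\<And>k. Ck_function k \<phi>" "compact K" "K \<subseteq> \<Omega>" "\<And>x. x \<notin> K \<Longrightarrow> \<phi> x = 0"
  shows "\<phi> \<in> test_functions \<Omega>"
  unfolding test_functions_def using assms by (intro CollectI conjI allI exI[of _ K] impI) auto

lemma test_function_zero: "(\<lambda>x. 0) \<in> test_functions \<Omega>"
  by (rule test_functionsI[of _ "{}"]) (auto intro: Ck_function_const)

text \<open>Compact support of one factor is enough. The other factor will be the smooth multiplier
  that imitates a sign.\<close>

lemma test_function_mult: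
  assumes "\<phi> \<in> test_functions \<Omega>" "\<And>k. Ck_function k \<psi>"
  shows "(\<lambda>x. \<psi> x * \<phi> x) \<in> test_functions \<Omega>"
proof -
  obtain K where "compact K" "K \<subseteq> \<Omega>" "\<And>x. x \<notin> K \<Longrightarrow> \<phi> x = 0"
    by (rule test_function_support[OF assms(1)]) blast
  then show ?thesis
    by (intro test_functionsI[of _ K] Ck_function_mult assms test_function_Ck[OF assms(1)]) auto
qed

lemma test_function_cmult: "\<phi> \<in> test_functions \<Omega> \<Longrightarrow> (\<lambda>x. c * \<phi> x) \<in> test_functions \<Omega>"
  by (rule test_function_mult) (auto intro: Ck_function_const)

lemma test_function_add:
  assumes "\<phi> \<in> test_functions \<Omega>" "\<psi> \<in> test_functions \<Omega>"
  shows "(\<lambda>x. \<phi> x + \<psi> x) \<in> test_functions \<Omega>"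
proof -
  obtain K where "compact K" "K \<subseteq> \<Omega>" "\<And>x. x \<notin> K \<Longrightarrow> \<phi> x = 0"
    by (rule test_function_support[OF assms(1)]) blast
  moreover obtain L where "compact L" "L \<subseteq> \<Omega>" "\<And>x. x \<notin> L \<Longrightarrow> \<psi> x = 0"
    by (rule test_function_support[OF assms(2)]) blast
  ultimately show ?thesis
    by (intro test_functionsI[of _ "K \<union> L"] Ck_function_add test_function_Ck[OF assms(1)]
        test_function_Ck[OF assms(2)]) auto
qed

lemma test_function_diff:
  "\<phi> \<in> test_functions \<Omega> \<Longrightarrow> \<psi> \<in> test_functions \<Omega> \<Longrightarrow> (\<lambda>x. \<phi> x - \<psi> x) \<in> test_functions \<Omega>"
  using test_function_add[of \<phi> \<Omega> "\<lambda>x. -1 * \<psi> x"] test_function_cmult[of \<psi> \<Omega> "-1"] by simp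

lemma pderiv_test_add:
  assumes "\<phi> \<in> test_functions \<Omega>" "\<psi> \<in> test_functions \<Omega>"
  shows "pderiv_at (\<lambda>x. \<phi> x + \<psi> x) e x = pderiv_at \<phi> e x + pderiv_at \<psi> e x"
  by (rule fun_cong[OF frechet_derivative_at[OF has_derivative_add[OF
      test_function_has_derivative[OF assms(1)] test_function_has_derivative[OF assms(2)]]], symmetric])

lemma pderiv_test_cmult:
  assumes "\<phi> \<in> test_functions \<Omega>"
  shows "pderiv_at (\<lambda>x. c * \<phi> x) e x = c * pderiv_at \<phi> e x"
  by (rule fun_cong[OF frechet_derivative_at[OF has_derivative_mult_right[OF
      test_function_has_derivative[OF assms]]], symmetric])

text \<open>\<open>Ck_function\<close> and \<open>has_distr_gradient\<close> speak of basis
  directions only; linearity of the derivative carries them over to an arbitrary direction.\<close>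

lemma pderiv_test_sum:
  assumes "\<phi> \<in> test_functions \<Omega>"
  shows "pderiv_at \<phi> e x = (\<Sum>i\<in>Basis. (e \<bullet> i) * pderiv_at \<phi> i x)"
proof -
  have "linear (frechet_derivative \<phi> (at x))"
    using test_function_has_derivative[OF assms] has_derivative_linear by blast
  from linear_sum[OF this, of "\<lambda>i. (e \<bullet> i) *\<^sub>R i" Basis] linear_scale[OF this]
  show ?thesis by (simp add: euclidean_representation)
qed

lemma continuous_on_pderiv_test:
  assumes "\<phi> \<in> test_functions \<Omega>"
  shows "continuous_on UNIV (pderiv_at \<phi> e)"
proof -
  have "continuous_on UNIV (pderiv_at \<phi> i)" if "i \<in> Basis" for i
    using Ck_function_continuous[of 0] test_function_Ck[OF assms, of 1] that by auto
  then have "continuous_on UNIV (\<lambda>x. \<Sum>i\<in>Basis. (e \<bullet> i) * pderiv_at \<phi> i x)"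
    by (intro continuous_intros) auto
  then show ?thesis
    by (subst continuous_on_cong[OF refl pderiv_test_sum[OF assms]])
qed

lemma bounded_if_zero_outside_compact:
  fixes f :: "'a::euclidean_space \<Rightarrow> real"
  assumes "continuous_on UNIV f" "compact K" "\<And>x. x \<notin> K \<Longrightarrow> f x = 0"
  obtains B where "B > 0" "\<And>x. \<bar>f x\<bar> \<le> B"
proof -
  have "bounded (f ` K)"
    by (meson assms compact_continuous_image compact_imp_bounded continuous_on_subset subset_UNIV)
  then obtain B where "B > 0" "\<And>x. x \<in> K \<Longrightarrow> \<bar>f x\<bar> \<le> B"
    by (auto simp: bounded_pos)
  then show thesis
    using that[of B] assms(3) by (metis abs_zero less_eq_real_def)
qed

lemma test_function_bounded:
  assumes "\<phi> \<in> test_functions \<Omega>"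
  obtains B where "B > 0" "\<And>x. \<bar>\<phi> x\<bar> \<le> B"
proof -
  obtain K where "compact K" "\<And>x. x \<notin> K \<Longrightarrow> \<phi> x = 0"
    by (rule test_function_support[OF assms]) blast
  then show thesis
    using bounded_if_zero_outside_compact[OF test_function_continuous[OF assms]] that by blast
qed

lemma pderiv_test_bounded:
  assumes "\<phi> \<in> test_functions \<Omega>"
  obtains B where "B > 0" "\<And>x. \<bar>pderiv_at \<phi> e x\<bar> \<le> B"
proof -
  obtain K where "compact K" "\<And>x. x \<notin> K \<Longrightarrow> pderiv_at \<phi> e x = 0"
    by (rule test_function_support[OF assms]) blast
  then show thesis
    using bounded_if_zero_outside_compact[OF continuous_on_pderiv_test[OF assms]] that by blast
qed

lemma test_function_has_directional_derivative:
  assumes "\<phi> \<in> test_functions \<Omega>"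
  shows "((\<lambda>t. \<phi> (x + t *\<^sub>R e)) has_real_derivative pderiv_at \<phi> e (x + t *\<^sub>R e)) (at t)"
proof -
  have "((\<lambda>t. x + t *\<^sub>R e) has_derivative (\<lambda>s. s *\<^sub>R e)) (at t)"
    by (auto intro!: derivative_eq_intros)
  note D = has_derivative_compose[OF this test_function_has_derivative[OF assms]]
  have "linear (frechet_derivative \<phi> (at (x + t *\<^sub>R e)))"
    using test_function_has_derivative[OF assms] has_derivative_linear by blast
  then have "(\<lambda>s. pderiv_at \<phi> (s *\<^sub>R e) (x + t *\<^sub>R e)) = (*) (pderiv_at \<phi> e (x + t *\<^sub>R e))"
    by (auto simp: linear_scale)
  with D show ?thesis
    by (simp add: has_field_derivative_def)
qed

lemma test_function_diff_bound:
  assumes "\<phi> \<in> test_functions \<Omega>" "\<And>x. \<bar>pderiv_at \<phi> e x\<bar> \<le> B"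
  shows "\<bar>\<phi> (x + t *\<^sub>R e) - \<phi> x\<bar> \<le> B * \<bar>t\<bar>"
  using field_differentiable_bound[of UNIV "\<lambda>t. \<phi> (x + t *\<^sub>R e)" "\<lambda>t. pderiv_at \<phi> e (x + t *\<^sub>R e)" B 0 t]
    test_function_has_directional_derivative[OF assms(1)] assms(2)
  by (auto simp: abs_minus_commute)

subsection \<open>Density of test functions\<close>

text \<open>The standard bump \<open>exp (- 1 / (r\<^sup>2 - \<bar>x - a\<bar>\<^sup>2))\<close>;
  the squared distance keeps it smooth at the centre.\<close>

definition ball_bump :: "'a::euclidean_space \<Rightarrow> real \<Rightarrow> 'a \<Rightarrow> real" where
  "ball_bump a r x = flat_exp 0 (r\<^sup>2 - (x - a) \<bullet> (x - a))"

lemma Ck_function_ball_bump: "Ck_function k (ball_bump a r)"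
proof -
  have "Ck_function k (\<lambda>x. (x + (- a)) \<bullet> (x + (- a)))"
    by (rule Ck_function_translate[OF Ck_function_inner_self])
  then have "Ck_function k (\<lambda>x. (x - a) \<bullet> (x - a))"
    by simp
  then have "Ck_function k (\<lambda>x. flat_exp 0 (r\<^sup>2 - (x - a) \<bullet> (x - a)))"
    by (intro Ck_function_compose[OF Ck_function_flat_exp] Ck_function_diff Ck_function_const)
  then show ?thesis
    unfolding ball_bump_def[abs_def] .
qed

lemma ball_bump_nonneg: "0 \<le> ball_bump a r x"
  and ball_bump_less_1: "ball_bump a r x < 1"
  by (auto simp: ball_bump_def flat_exp_def)

lemma ball_bump_pos_iff: "r > 0 \<Longrightarrow> 0 < ball_bump a r x \<longleftrightarrow> x \<in> ball a r"
proof -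
  assume "r > 0"
  have "r\<^sup>2 - (x - a) \<bullet> (x - a) > 0 \<longleftrightarrow> (dist a x)\<^sup>2 < r\<^sup>2"
    by (simp add: dist_norm norm_minus_commute power2_norm_eq_inner[symmetric])
  also have "\<dots> \<longleftrightarrow> dist a x < r"
    using \<open>r > 0\<close> by (metis less_imp_le power2_less_imp_less power_strict_mono zero_le_dist zero_less_numeral)
  finally show ?thesis
    by (simp add: ball_bump_def flat_exp_def)
qed

text \<open>Lindelof's theorem applied to the balls whose closures stay inside \<open>U\<close>. The
  closures matter: finite unions of them are the compact supports in the next lemma.\<close>

lemma open_countable_Union_balls:
  fixes U :: "'a::euclidean_space set"
  assumes "open U" "U \<noteq> {}"
  obtains a r where "\<And>k::nat. r k > 0" "\<And>k. cball (a k) (r k) \<subseteq> U" "U = (\<Union>k. ball (a k) (r k))"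
proof -
  define F where "F = {ball x e |x e. 0 < e \<and> cball x e \<subseteq> U}"
  obtain F' where F': "F' \<subseteq> F" "countable F'" "\<Union>F' = \<Union>F"
    by (rule Lindelof[of F]) (auto simp: F_def)
  have "\<Union>F = U"
  proof
    show "\<Union>F \<subseteq> U" unfolding F_def using ball_subset_cball by fastforce
    show "U \<subseteq> \<Union>F"
    proof
      fix x assume "x \<in> U"
      then obtain e where "e > 0" "cball x e \<subseteq> U"
        using assms(1) open_contains_cball by blast
      then show "x \<in> \<Union>F" unfolding F_def by (intro UnionI[of "ball x e"]) auto
    qed
  qed
  with F' assms have ne: "F' \<noteq> {}" by auto
  have "\<exists>x e. from_nat_into F' k = ball x e \<and> 0 < e \<and> cball x e \<subseteq> U" for k
    using from_nat_into[OF ne, of k] F'(1) unfolding F_def by blast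
  then obtain a r where *: "\<And>k. from_nat_into F' k = ball (a k) (r k) \<and> 0 < r k \<and> cball (a k) (r k) \<subseteq> U"
    by metis
  have "U = (\<Union>k. from_nat_into F' k)"
    using range_from_nat_into[OF ne F'(2)] F'(3) \<open>\<Union>F = U\<close> by auto
  also have "\<dots> = (\<Union>k. ball (a k) (r k))"
    using * by simp
  finally show thesis
    by (rule that[of r a, rotated 2]) (use * in blast)+
qed

lemma test_functions_tendsto_indicator:
  fixes U :: "'a::euclidean_space set"
  assumes "open U" "U \<subseteq> \<Omega>"
  obtains \<theta> :: "nat \<Rightarrow> 'a \<Rightarrow> real" where "\<And>n. \<theta> n \<in> test_functions \<Omega>"
    "\<And>n x. 0 \<le> \<theta> n x" "\<And>n x. \<theta> n x \<le> 1" "\<And>x. (\<lambda>n. \<theta> n x) \<longlonglongrightarrow> indicator U x"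
proof (cases "U = {}")
  case True
  then show thesis using that[of "\<lambda>n x. 0"] by (simp add: test_function_zero)
next
  case False
  obtain a r where r: "\<And>k::nat. r k > 0" and ball: "\<And>k. cball (a k) (r k) \<subseteq> U"
    and U: "U = (\<Union>k. ball (a k) (r k))"
    using open_countable_Union_balls[OF assms(1) False] by metis
  \<comment> \<open>The test functions will be \<open>1 - p n\<close>. Taking finitely many factors
    keeps the support compact, letting their number grow reaches every ball of the cover, and the
    exponent \<open>n\<close> drives a factor to 0 wherever its bump is positive.\<close>
  define p where "p n x = (\<Prod>k<n. (1 - ball_bump (a k) (r k) x) ^ n)" for n and x :: 'a
  have factor: "0 \<le> (1 - ball_bump (a k) (r k) x) ^ n" "(1 - ball_bump (a k) (r k) x) ^ n \<le> 1" for k n x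
    using ball_bump_nonneg[of "a k" "r k" x] ball_bump_less_1[of "a k" "r k" x]
    by (auto intro!: power_le_one)
  have p: "0 \<le> p n x" "p n x \<le> 1" for n x
    unfolding p_def using factor by (auto intro!: prod_nonneg prod_le_1)
  have p_eq_1: "p n x = 1" if outside: "\<And>k. k < n \<Longrightarrow> x \<notin> ball (a k) (r k)" for n x
  proof -
    have "ball_bump (a k) (r k) x = 0" if "k < n" for k
    proof -
      have "\<not> 0 < ball_bump (a k) (r k) x"
        using outside[OF \<open>k < n\<close>] ball_bump_pos_iff[OF r[of k], of "a k" x] by simp
      then show ?thesis
        using ball_bump_nonneg[of "a k" "r k" x] by linarith
    qed
    then show ?thesis by (simp add: p_def)
  qed
  have lim: "(\<lambda>n. p n x) \<longlonglongrightarrow> 1 - indicator U x" for x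
  proof (cases "x \<in> U")
    case True
    then obtain k where "x \<in> ball (a k) (r k)" using U by auto
    then have b: "0 < ball_bump (a k) (r k) x"
      by (simp add: ball_bump_pos_iff r)
    let ?b = "1 - ball_bump (a k) (r k) x"
    have "p n x \<le> ?b ^ n" if "k < n" for n
    proof -
      have "p n x = ?b ^ n * (\<Prod>j\<in>{..<n} - {k}. (1 - ball_bump (a j) (r j) x) ^ n)"
        unfolding p_def using that by (subst prod.remove[of _ k]) auto
      also have "\<dots> \<le> ?b ^ n * 1"
        using factor by (intro mult_left_mono prod_le_1) auto
      finally show ?thesis by simp
    qed
    then have upper: "\<forall>\<^sub>F n in sequentially. p n x \<le> ?b ^ n"
      using eventually_gt_at_top[of k] by (rule eventually_mono[rotated])
    have "(\<lambda>n. ?b ^ n) \<longlonglongrightarrow> 0"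
      using b ball_bump_less_1[of "a k" "r k" x] by (intro LIMSEQ_realpow_zero) auto
    from tendsto_sandwich[OF _ upper tendsto_const this] have "(\<lambda>n. p n x) \<longlonglongrightarrow> 0"
      by (simp add: p)
    then show ?thesis using True by simp
  next
    case False
    then show ?thesis using p_eq_1 U by (auto simp: indicator_def)
  qed
  show thesis
  proof (rule that[of "\<lambda>n x. 1 - p n x"])
    fix n x
    show "(\<lambda>x. 1 - p n x) \<in> test_functions \<Omega>"
    proof (rule test_functionsI[of _ "\<Union>k<n. cball (a k) (r k)"])
      show "Ck_function k (\<lambda>x. 1 - p n x)" for k
        unfolding p_def
        by (intro Ck_function_diff Ck_function_const Ck_function_prod Ck_function_power Ck_function_ball_bump)
      show "1 - p n x = 0" if "x \<notin> (\<Union>k<n. cball (a k) (r k))" for x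
      proof -
        have "p n x = 1"
          by (rule p_eq_1) (use that in fastforce)
        then show ?thesis by simp
      qed
    qed (use ball assms(2) in auto)
    show "(\<lambda>n. 1 - p n x) \<longlonglongrightarrow> indicator U x"
      using tendsto_diff[OF tendsto_const lim[of x], of 1] by simp
  qed (use p in auto)
qed

section \<open>Density in L1 of a finite Borel measure on an open set\<close>

locale finite_measure_on = finite_measure M for M :: "'a::euclidean_space measure" +
  fixes \<Omega> :: "'a set"
  assumes open_domain: "open \<Omega>" and sets_eq: "sets M = sets (borel_on \<Omega>)"
begin

lemma space_eq: "space M = \<Omega>"
  using sets_eq_imp_space_eq[OF sets_eq] by (simp add: space_restrict_space)

lemma sets_iff: "A \<in> sets M \<longleftrightarrow> A \<in> sets borel \<and> A \<subseteq> \<Omega>"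
  using open_domain unfolding sets_eq by (subst sets_restrict_space_iff) auto

lemma measurable_if_borel: "f \<in> borel_measurable borel \<Longrightarrow> f \<in> borel_measurable M"
  by (subst measurable_cong_sets[OF sets_eq refl]) (rule measurable_restrict_space1)

lemma integrable_bounded:
  fixes f :: "'a \<Rightarrow> real"
  assumes "f \<in> borel_measurable borel" "\<And>x. \<bar>f x\<bar> \<le> B"
  shows "integrable M f"
  by (rule integrable_const_bound[of _ B]) (use assms measurable_if_borel in auto)

lemma test_function_integrable:
  assumes "\<phi> \<in> test_functions \<Omega>"
  shows "integrable M \<phi>"
proof -
  obtain B where "\<And>x. \<bar>\<phi> x\<bar> \<le> B"
    using test_function_bounded[OF assms] by blast
  then show ?thesis
    by (rule integrable_bounded[OF borel_measurable_continuous_onI[OF test_function_continuous[OF assms]]])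
qed

lemma outer_regular_on:
  assumes "E \<in> sets M" "e > 0"
  obtains U where "open U" "U \<subseteq> \<Omega>" "E \<subseteq> U" "measure M U < measure M E + e"
proof -
  have id: "(\<lambda>x. x) \<in> measurable M borel"
    by (rule measurable_if_borel) auto
  \<comment> \<open>The push-forward under the inclusion is a finite Borel measure on the whole
    space, where regularity applies; the open set obtained there is cut down to the open
    \<open>\<Omega>\<close>.\<close>
  let ?N = "distr M borel (\<lambda>x. x)"
  have N: "emeasure ?N A = emeasure M (A \<inter> \<Omega>)" if "A \<in> sets borel" for A
    using emeasure_distr[OF id that] by (simp add: space_eq)
  have "E \<in> sets borel" "E \<subseteq> \<Omega>" using assms sets_iff by auto
  have "emeasure ?N (space ?N) \<noteq> \<infinity>"
    using emeasure_finite by (simp add: N)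
  then have "emeasure ?N E = (INF U \<in> {U. E \<subseteq> U \<and> open U}. emeasure ?N U)"
    using \<open>E \<in> sets borel\<close> by (intro outer_regular) auto
  moreover have "emeasure ?N E < emeasure ?N E + ennreal e"
    using emeasure_finite[of E] assms N[OF \<open>E \<in> sets borel\<close>] \<open>E \<subseteq> \<Omega>\<close>
    by (simp add: inf.absorb1 ennreal_less_top less_top)
  ultimately obtain U where U: "E \<subseteq> U" "open U" "emeasure ?N U < emeasure ?N E + ennreal e"
    by (auto simp: INF_less_iff)
  then have "emeasure M (U \<inter> \<Omega>) < emeasure M E + ennreal e"
    using N \<open>E \<in> sets borel\<close> \<open>E \<subseteq> \<Omega>\<close> by (auto simp: inf.absorb1)
  then have "measure M (U \<inter> \<Omega>) < measure M E + e"
    using assms(2) by (simp add: emeasure_eq_measure ennreal_plus[symmetric] ennreal_less_iff del: ennreal_plus)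
  then show thesis
    using that[of "U \<inter> \<Omega>"] U open_domain \<open>E \<subseteq> \<Omega>\<close> by auto
qed

text \<open>Two errors of at most \<open>e / 2\<close>: from \<open>E\<close> to an open superset
  \<open>U\<close> by outer regularity, and from \<open>U\<close> to a test function by dominated
  convergence.\<close>

lemma test_function_approx_indicator:
  assumes "E \<in> sets M" "e > 0"
  obtains \<theta> where "\<theta> \<in> test_functions \<Omega>" "\<And>x. 0 \<le> \<theta> x" "\<And>x. \<theta> x \<le> 1"
    "(LINT x|M. \<bar>\<theta> x - indicator E x\<bar>) < e"
proof -
  have "e / 2 > 0" using assms(2) by simp
  obtain U where U: "open U" "U \<subseteq> \<Omega>" "E \<subseteq> U" and mU: "measure M U < measure M E + e / 2"
    by (rule outer_regular_on[OF assms(1) \<open>e / 2 > 0\<close>])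
  obtain \<theta> :: "nat \<Rightarrow> 'a \<Rightarrow> real" where \<theta>: "\<And>n. \<theta> n \<in> test_functions \<Omega>"
    "\<And>n x. 0 \<le> \<theta> n x" "\<And>n x. \<theta> n x \<le> 1" "\<And>x. (\<lambda>n. \<theta> n x) \<longlonglongrightarrow> indicator U x"
    using test_functions_tendsto_indicator[OF U(1,2)] by metis
  have [measurable]: "U \<in> sets M" "E \<in> sets M"
    using U assms sets_iff by auto
  have [measurable]: "\<theta> n \<in> borel_measurable M" for n
    using test_function_integrable[OF \<theta>(1)] by auto
  have "(\<lambda>n. LINT x|M. \<bar>\<theta> n x - indicator U x\<bar>) \<longlonglongrightarrow> (LINT x|M. 0)"
  proof (rule integral_dominated_convergence[where w = "\<lambda>x. 1"])
    show "AE x in M. (\<lambda>n. \<bar>\<theta> n x - indicator U x\<bar>) \<longlonglongrightarrow> 0"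
      using \<theta>(4) by (auto intro!: tendsto_rabs_zero LIM_zero)
    show "AE x in M. norm \<bar>\<theta> n x - indicator U x\<bar> \<le> 1" for n
      using \<theta>(2,3) by (auto simp: indicator_def)
  qed auto
  then have "\<forall>\<^sub>F n in sequentially. (LINT x|M. \<bar>\<theta> n x - indicator U x\<bar>) < e / 2"
    using \<open>e / 2 > 0\<close> by (intro order_tendstoD) auto
  then obtain n where n: "(LINT x|M. \<bar>\<theta> n x - indicator U x\<bar>) < e / 2"
    by (auto simp: eventually_sequentially)
  have indI: "integrable M (indicator A :: 'a \<Rightarrow> real)" if "A \<in> sets M" for A
    using that by (intro integrable_real_indicator) (auto simp: less_top[symmetric])
  have UE: "(LINT x|M. \<bar>indicator U x - indicator E x\<bar>) = measure M U - measure M E"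
  proof -
    have "(LINT x|M. \<bar>indicator U x - indicator E x :: real\<bar>) = (LINT x|M. indicator U x - indicator E x)"
      using U(3) by (intro Bochner_Integration.integral_cong) (auto simp: indicator_def)
    also have "\<dots> = (LINT x|M. indicator U x) - (LINT x|M. indicator E x)"
      by (intro Bochner_Integration.integral_diff indI) auto
    finally show ?thesis
      using U(2) assms(1)[unfolded sets_iff] by (simp add: Int_absorb2 space_eq)
  qed
  have int: "integrable M (\<lambda>x. \<bar>\<theta> n x - indicator A x\<bar>)"
    "integrable M (\<lambda>x. \<bar>indicator U x - indicator A x :: real\<bar>)" if "A \<in> sets M" for A
    using that test_function_integrable[OF \<theta>(1)[of n]] \<open>U \<in> sets M\<close>
    by (auto intro!: integrable_abs Bochner_Integration.integrable_diff indI)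
  have "(LINT x|M. \<bar>\<theta> n x - indicator E x\<bar>)
      \<le> (LINT x|M. \<bar>\<theta> n x - indicator U x\<bar> + \<bar>indicator U x - indicator E x\<bar>)"
    using int[OF \<open>E \<in> sets M\<close>] int[OF \<open>U \<in> sets M\<close>] by (intro integral_mono) auto
  also have "\<dots> < e"
    using n mU int[OF \<open>E \<in> sets M\<close>] int[OF \<open>U \<in> sets M\<close>] by (simp add: UE)
  finally show thesis
    using that[of "\<theta> n"] \<theta> by auto
qed

lemma test_function_approx:
  fixes f :: "'a \<Rightarrow> real"
  assumes "integrable M f" "e > 0"
  shows "\<exists>\<phi>\<in>test_functions \<Omega>. (LINT x|M. \<bar>\<phi> x - f x\<bar>) < e"
  using assms
proof (induction arbitrary: e rule: integrable_induct)
  case (base A c)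
  \<comment> \<open>The added 1 covers the case \<open>c = 0\<close>.\<close>
  have "e / (\<bar>c\<bar> + 1) > 0" using base by (simp add: add_nonneg_pos)
  then obtain \<theta> where \<theta>: "\<theta> \<in> test_functions \<Omega>" "(LINT x|M. \<bar>\<theta> x - indicator A x\<bar>) < e / (\<bar>c\<bar> + 1)"
    using test_function_approx_indicator[OF base(1)] by metis
  have "(LINT x|M. \<bar>c * \<theta> x - indicator A x *\<^sub>R c\<bar>) = (LINT x|M. \<bar>c\<bar> * \<bar>\<theta> x - indicator A x\<bar>)"
    by (intro Bochner_Integration.integral_cong) (auto simp: abs_mult[symmetric] algebra_simps)
  also have "\<dots> = \<bar>c\<bar> * (LINT x|M. \<bar>\<theta> x - indicator A x\<bar>)"
    by simp
  also have "\<dots> \<le> (\<bar>c\<bar> + 1) * (LINT x|M. \<bar>\<theta> x - indicator A x\<bar>)"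
    by (intro mult_right_mono) auto
  also have "\<dots> < e"
    using \<theta>(2) by (simp add: pos_less_divide_eq mult.commute add_nonneg_pos)
  finally show ?case
    using test_function_cmult[OF \<theta>(1), of c] by (intro bexI[of _ "\<lambda>x. c * \<theta> x"])
next
  case (add f g)
  have "e / 2 > 0" using add by simp
  then obtain \<phi> \<psi> where \<phi>: "\<phi> \<in> test_functions \<Omega>" "(LINT x|M. \<bar>\<phi> x - f x\<bar>) < e / 2"
    and \<psi>: "\<psi> \<in> test_functions \<Omega>" "(LINT x|M. \<bar>\<psi> x - g x\<bar>) < e / 2"
    using add.IH by metis
  note [simp] = add.hyps test_function_integrable[OF \<phi>(1)] test_function_integrable[OF \<psi>(1)]
  have "(LINT x|M. \<bar>(\<phi> x + \<psi> x) - (f x + g x)\<bar>) \<le> (LINT x|M. \<bar>\<phi> x - f x\<bar> + \<bar>\<psi> x - g x\<bar>)"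
    by (intro integral_mono) auto
  also have "\<dots> < e"
    using \<phi> \<psi> by simp
  finally show ?case
    using test_function_add[OF \<phi>(1) \<psi>(1)] by (intro bexI[of _ "\<lambda>x. \<phi> x + \<psi> x"])
next
  case (lim f s)
  have "(\<lambda>i. LINT x|M. \<bar>s i x - f x\<bar>) \<longlonglongrightarrow> (LINT x|M. 0)"
  \<comment> \<open>The approximants satisfy
    \<open>\<bar>s i x\<bar> \<le> 2 * \<bar>f x\<bar>\<close>, hence the factor 3 for the
    difference.\<close>
  proof (rule integral_dominated_convergence[where w = "\<lambda>x. 3 * \<bar>f x\<bar>"])
    show "AE x in M. (\<lambda>i. \<bar>s i x - f x\<bar>) \<longlonglongrightarrow> 0"
      using lim(2) by (auto intro!: tendsto_rabs_zero LIM_zero)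
    show "AE x in M. norm \<bar>s i x - f x\<bar> \<le> 3 * \<bar>f x\<bar>" for i
    proof (rule AE_I2)
      fix x assume "x \<in> space M"
      from lim(3)[OF this, of i] show "norm \<bar>s i x - f x\<bar> \<le> 3 * \<bar>f x\<bar>" by auto
    qed
  qed (use lim(1,4) in auto)
  then have "\<forall>\<^sub>F i in sequentially. (LINT x|M. \<bar>s i x - f x\<bar>) < e / 2"
    using lim by (intro order_tendstoD) auto
  then obtain i where i: "(LINT x|M. \<bar>s i x - f x\<bar>) < e / 2"
    by (auto simp: eventually_sequentially)
  obtain \<phi> where \<phi>: "\<phi> \<in> test_functions \<Omega>" "(LINT x|M. \<bar>\<phi> x - s i x\<bar>) < e / 2"
    using lim.IH[of "e / 2"] lim.prems by auto
  note [simp] = lim(1,4) test_function_integrable[OF \<phi>(1)]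
  have "(LINT x|M. \<bar>\<phi> x - f x\<bar>) \<le> (LINT x|M. \<bar>\<phi> x - s i x\<bar> + \<bar>s i x - f x\<bar>)"
    by (intro integral_mono) auto
  also have "\<dots> < e"
    using i \<phi> by simp
  finally show ?case
    using \<phi>(1) by blast
qed

end

subsection \<open>Vector measures and their variations\<close>

lemma vector_measuresD:
  assumes "\<mu> \<in> vector_measures M" "range A \<subseteq> sets M" "disjoint_family A"
  shows "(\<lambda>n. \<mu> (A n)) sums \<mu> (\<Union>n. A n)"
  using assms unfolding vector_measures_def by simp

text \<open>The constant sequence of empty sets is a disjoint family, and a convergent series with
  constant terms has zero terms.\<close>

lemma vector_measure_empty:
  assumes "\<mu> \<in> vector_measures M"
  shows "\<mu> {} = 0"
proof -
  have "(\<lambda>n::nat. \<mu> {}) sums \<mu> {}"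
    using vector_measuresD[OF assms, of "\<lambda>n. {}"] by (simp add: disjoint_family_on_def)
  then have "(\<lambda>n::nat. \<mu> {}) \<longlonglongrightarrow> 0"
    using sums_summable summable_LIMSEQ_zero by blast
  then show ?thesis
    by (simp add: LIMSEQ_const_iff)
qed

lemma vector_measure_Un:
  assumes "\<mu> \<in> vector_measures M" "A \<in> sets M" "B \<in> sets M" "A \<inter> B = {}"
  shows "\<mu> (A \<union> B) = \<mu> A + \<mu> B"
proof -
  have "(\<lambda>n. \<mu> (binaryset A B n)) sums \<mu> (\<Union>n. binaryset A B n)"
    using assms by (intro vector_measuresD) (auto simp: disjoint_family_on_def binaryset_def)
  moreover have "(\<lambda>n. \<mu> (binaryset A B n)) sums (\<mu> A + \<mu> B)"
    using binaryset_sums[where f = \<mu>] vector_measure_empty[OF assms(1)] by simp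
  ultimately show ?thesis
    by (auto simp: UN_binaryset_eq dest: sums_unique2)
qed

lemma vector_measure_Diff:
  assumes "\<mu> \<in> vector_measures M" "A \<in> sets M" "B \<in> sets M" "B \<subseteq> A"
  shows "\<mu> (A - B) = \<mu> A - \<mu> B"
proof -
  have "\<mu> (B \<union> (A - B)) = \<mu> B + \<mu> (A - B)"
    using assms by (intro vector_measure_Un[OF assms(1)]) auto
  moreover have "B \<union> (A - B) = A" using assms by auto
  ultimately show ?thesis by simp
qed

lemma vector_measure_bounded_linear:
  assumes "bounded_linear h" "\<mu> \<in> vector_measures M"
  shows "(\<lambda>E. h (\<mu> E)) \<in> vector_measures M"
  unfolding vector_measures_def
  by (intro CollectI allI impI bounded_linear.sums[OF assms(1)] vector_measuresD[OF assms(2)])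

lemma vector_measure_inner: "\<mu> \<in> vector_measures M \<Longrightarrow> (\<lambda>E. \<mu> E \<bullet> i) \<in> vector_measures M"
  by (rule vector_measure_bounded_linear[OF bounded_linear_inner_left])

lemma vector_measure_uminus:
  "\<mu> \<in> vector_measures M \<Longrightarrow> (\<lambda>E. - \<mu> E) \<in> vector_measures M"
  using vector_measure_bounded_linear[OF bounded_linear_minus[OF bounded_linear_ident]] .

lemma vector_measure_diff:
  "\<mu> \<in> vector_measures M \<Longrightarrow> \<nu> \<in> vector_measures M \<Longrightarrow> (\<lambda>E. \<mu> E - \<nu> E) \<in> vector_measures M"
  unfolding vector_measures_def by (intro CollectI allI impI sums_diff) auto

lemma vector_measure_zero: "(\<lambda>E. 0) \<in> vector_measures M"
  by (simp add: vector_measures_def)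

text \<open>Both \<^const>\<open>variation\<close> and \<^const>\<open>upper_variation\<close> are suprema over countable partitions of
  a countably subadditive set function, the latter of the positive part of the measure.\<close>

definition partition_sup :: "'a measure \<Rightarrow> ('a set \<Rightarrow> ennreal) \<Rightarrow> 'a set \<Rightarrow> ennreal" where
  "partition_sup M q E =
    (SUP A\<in>{A :: nat \<Rightarrow> 'a set. range A \<subseteq> sets M \<and> disjoint_family A \<and> (\<Union>n. A n) = E}. \<Sum>n. q (A n))"

lemma partition_sup_upper:
  "range A \<subseteq> sets M \<Longrightarrow> disjoint_family A \<Longrightarrow> (\<Union>n. A n) = E \<Longrightarrow> (\<Sum>n. q (A n)) \<le> partition_sup M q E"
  unfolding partition_sup_def by (rule SUP_upper) auto

lemma suminf_ennreal_swap:
  fixes f :: "nat \<Rightarrow> nat \<Rightarrow> ennreal"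
  shows "(\<Sum>i. \<Sum>j. f i j) = (\<Sum>j. \<Sum>i. f i j)"
  using nn_integral_suminf[of "\<lambda>j i. f i j" "count_space UNIV"] by (simp add: nn_integral_count_space_nat)

text \<open>One inequality refines a partition of the union by the sets \<open>A k\<close>, and this
  is where subadditivity enters. The other glues nearly optimal partitions of the \<open>A k\<close>
  into one of the union.\<close>

lemma countably_additive_partition_sup:
  assumes empty: "q {} = 0"
    and subadd: "\<And>A :: nat \<Rightarrow> 'a set. range A \<subseteq> sets M \<Longrightarrow> disjoint_family A \<Longrightarrow> q (\<Union>n. A n) \<le> (\<Sum>n. q (A n))"
  shows "countably_additive (sets M) (partition_sup M q)"
proof (rule countably_additiveI)
  fix A :: "nat \<Rightarrow> 'a set"
  assume A: "range A \<subseteq> sets M" "disjoint_family A" "(\<Union>i. A i) \<in> sets M"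
  let ?E = "\<Union>i. A i"
  show "(\<Sum>i. partition_sup M q (A i)) = partition_sup M q ?E"
  proof (rule antisym)
    show "partition_sup M q ?E \<le> (\<Sum>i. partition_sup M q (A i))"
      unfolding partition_sup_def[of M q ?E]
    proof (rule SUP_least, clarsimp)
      fix B :: "nat \<Rightarrow> 'a set"
      assume B: "range B \<subseteq> sets M" "disjoint_family B" "(\<Union>n. B n) = ?E"
      have "q (B n) \<le> (\<Sum>k. q (B n \<inter> A k))" for n
      proof -
        have "(\<Union>k. B n \<inter> A k) = B n" using B(3) by blast
        moreover have "range (\<lambda>k. B n \<inter> A k) \<subseteq> sets M" using A(1) B(1) by auto
        moreover have "disjoint_family (\<lambda>k. B n \<inter> A k)"
          using A(2) unfolding disjoint_family_on_def by blast
        ultimately show ?thesis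
          using subadd[of "\<lambda>k. B n \<inter> A k"] by simp
      qed
      then have "(\<Sum>n. q (B n)) \<le> (\<Sum>n. \<Sum>k. q (B n \<inter> A k))"
        by (intro suminf_le) auto
      also have "\<dots> = (\<Sum>k. \<Sum>n. q (B n \<inter> A k))"
        by (rule suminf_ennreal_swap)
      also have "\<dots> \<le> (\<Sum>k. partition_sup M q (A k))"
      proof (intro suminf_le)
        show "(\<Sum>n. q (B n \<inter> A k)) \<le> partition_sup M q (A k)" for k
        proof (rule partition_sup_upper)
          show "(\<Union>n. B n \<inter> A k) = A k" using B(3) by blast
          show "range (\<lambda>n. B n \<inter> A k) \<subseteq> sets M" using A(1) B(1) by auto
          show "disjoint_family (\<lambda>n. B n \<inter> A k)"
            using B(2) unfolding disjoint_family_on_def by blast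
        qed
      qed auto
      finally show "(\<Sum>n. q (B n)) \<le> (\<Sum>k. partition_sup M q (A k))" .
    qed
    \<comment> \<open>The pairing function enumerates the pieces of all the partitions
      \<open>B k\<close> as one sequence, so their double sum is a competitor in the supremum for
      the union.\<close>
    have combine: "(\<Sum>k. \<Sum>n. q (B k n)) \<le> partition_sup M q ?E"
      if B: "\<And>k. range (B k) \<subseteq> sets M" "\<And>k. disjoint_family (B k)" "\<And>k. (\<Union>n. B k n) = A k"
      for B :: "nat \<Rightarrow> nat \<Rightarrow> 'a set"
    proof -
      let ?C = "\<lambda>m. B (fst (prod_decode m)) (snd (prod_decode m))"
      have "(\<Sum>m. q (?C m)) = (\<Sum>k. \<Sum>n. q (B k n))"
        by (rule suminf_ennreal_2dimen[of _ "\<lambda>(k, n). q (B k n)", simplified split_def fst_conv snd_conv]) simp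
      moreover have "(\<Sum>m. q (?C m)) \<le> partition_sup M q ?E"
      proof (rule partition_sup_upper)
        show "disjoint_family ?C"
        proof (unfold disjoint_family_on_def, intro ballI impI)
          fix m m' :: nat assume "m \<noteq> m'"
          then have "prod_decode m \<noteq> prod_decode m'"
            by (metis prod_decode_inverse)
          then consider "fst (prod_decode m) \<noteq> fst (prod_decode m')"
            | "fst (prod_decode m) = fst (prod_decode m')" "snd (prod_decode m) \<noteq> snd (prod_decode m')"
            by (metis prod.expand)
          then show "?C m \<inter> ?C m' = {}"
          proof cases
            case 1
            moreover have "?C m \<subseteq> A (fst (prod_decode m))" "?C m' \<subseteq> A (fst (prod_decode m'))"
              using B(3) by blast+
            ultimately show ?thesis
              using A(2) by (fastforce simp: disjoint_family_on_def)
          next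
            case 2
            then show ?thesis
              using B(2) by (simp add: disjoint_family_on_def)
          qed
        qed
        show "(\<Union>m. ?C m) = ?E"
        proof (intro equalityI subsetI)
          fix x assume "x \<in> (\<Union>m. ?C m)"
          then show "x \<in> ?E" using B(3) by blast
        next
          fix x assume "x \<in> ?E"
          then obtain k n where "x \<in> B k n" using B(3) by blast
          then show "x \<in> (\<Union>m. ?C m)"
            by (intro UN_I[of "prod_encode (k, n)"]) auto
        qed
      qed (use B in auto)
      ultimately show ?thesis by simp
    qed
    \<comment> \<open>The trivial partition of \<open>A k\<close>. It fills the remaining slots when
      only one \<open>A k\<close> is partitioned in earnest, and it shows that the suprema are over
      nonempty families.\<close>
    define D where "D k n = (if n = 0 then A k else {})" for k n :: nat
    have D: "range (D k) \<subseteq> sets M" "disjoint_family (D k)" "(\<Union>n. D k n) = A k" for k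
      using A by (auto simp: D_def disjoint_family_on_def split: if_splits)
    show "(\<Sum>i. partition_sup M q (A i)) \<le> partition_sup M q ?E"
    proof (cases "partition_sup M q ?E = \<infinity>")
      case False
      have fin: "partition_sup M q (A k) \<le> partition_sup M q ?E" for k
        unfolding partition_sup_def[of M q "A k"]
      proof (rule SUP_least, clarsimp)
        fix B :: "nat \<Rightarrow> 'a set"
        assume B: "range B \<subseteq> sets M" "disjoint_family B" "(\<Union>n. B n) = A k"
        let ?B = "D(k := B)"
        have "(\<Sum>n. q (B n)) \<le> (\<Sum>j. \<Sum>n. q (?B j n))"
          using sum_le_suminf[of "\<lambda>j. \<Sum>n. q (?B j n)" "{k}"] by auto
        also have "\<dots> \<le> partition_sup M q ?E"
          using B D by (intro combine) auto
        finally show "(\<Sum>n. q (B n)) \<le> partition_sup M q ?E" .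
      qed
      show ?thesis
      proof (rule ennreal_le_epsilon)
        fix e :: real assume "e > 0"
        \<comment> \<open>The errors \<open>e * (1/2) ^ Suc k\<close> sum to exactly
          \<open>e\<close>.\<close>
        have ex: "\<exists>B. range B \<subseteq> sets M \<and> disjoint_family B \<and> (\<Union>n::nat. B n) = A k \<and>
            partition_sup M q (A k) \<le> (\<Sum>n. q (B n)) + ennreal (e * (1/2) ^ Suc k)" for k
        proof -
          have "\<exists>B\<in>{B :: nat \<Rightarrow> 'a set. range B \<subseteq> sets M \<and> disjoint_family B \<and> (\<Union>n. B n) = A k}.
              partition_sup M q (A k) < (\<Sum>n. q (B n)) + ennreal (e * (1/2) ^ Suc k)"
          proof (rule SUP_approx_ennreal[OF _ _ partition_sup_def])
            show "partition_sup M q (A k) \<noteq> \<infinity>"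
              using fin[of k] False by (metis infinity_ennreal_def top_unique)
          qed (use \<open>e > 0\<close> D[of k] in auto)
          then show ?thesis
            by (auto intro: less_imp_le)
        qed
        from choice[OF allI[OF ex]] obtain B where "\<forall>k. range (B k) \<subseteq> sets M \<and> disjoint_family (B k) \<and>
            (\<Union>n::nat. B k n) = A k \<and>
            partition_sup M q (A k) \<le> (\<Sum>n. q (B k n)) + ennreal (e * (1/2) ^ Suc k)" ..
        then have B: "\<And>k. range (B k) \<subseteq> sets M" "\<And>k. disjoint_family (B k)" "\<And>k. (\<Union>n. B k n) = A k"
          "\<And>k. partition_sup M q (A k) \<le> (\<Sum>n. q (B k n)) + ennreal (e * (1/2) ^ Suc k)"
          by simp_all
        have "(\<Sum>k. partition_sup M q (A k)) \<le> (\<Sum>k. (\<Sum>n. q (B k n)) + ennreal (e * (1/2) ^ Suc k))"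
          using B(4) by (intro suminf_le) auto
        also have "\<dots> = (\<Sum>k. \<Sum>n. q (B k n)) + (\<Sum>k. ennreal (e * (1/2) ^ Suc k))"
          by (intro suminf_add[symmetric]) auto
        also have "(\<Sum>k. ennreal (e * (1/2) ^ Suc k)) = ennreal e"
          using \<open>e > 0\<close> sums_mult[OF power_half_series, of e]
          by (intro suminf_ennreal_eq) auto
        finally show "(\<Sum>i. partition_sup M q (A i)) \<le> partition_sup M q ?E + ennreal e"
          using combine[OF B(1-3)] by (meson add_right_mono order_trans)
      qed
    qed simp
  qed
qed

lemma partition_sup_empty: "q {} = 0 \<Longrightarrow> partition_sup M q {} = 0"
  by (auto simp: partition_sup_def intro!: antisym SUP_least)

text \<open>Finite subadditivity bounds the partial sums and continuity of \<open>h\<close> passes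
  to the limit. The general \<open>h\<close> serves two instances: the norm for
  \<open>variation\<close> and the positive part \<open>ennreal\<close> for
  \<open>upper_variation\<close>.\<close>

lemma vector_measure_countably_subadditive:
  fixes h :: "'b::real_normed_vector \<Rightarrow> ennreal"
  assumes "\<mu> \<in> vector_measures M" "range A \<subseteq> sets M" "disjoint_family A"
    and h: "continuous_on UNIV h" "h 0 = 0" "\<And>x y. h (x + y) \<le> h x + h y"
  shows "h (\<mu> (\<Union>n. A n)) \<le> (\<Sum>n. h (\<mu> (A n)))"
proof (rule LIMSEQ_le_const2)
  have "(\<lambda>n. \<Sum>i<n. \<mu> (A i)) \<longlonglongrightarrow> \<mu> (\<Union>n. A n)"
    using vector_measuresD[OF assms(1-3)] by (simp add: sums_def)
  then show "(\<lambda>n. h (\<Sum>i<n. \<mu> (A i))) \<longlonglongrightarrow> h (\<mu> (\<Union>n. A n))"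
    by (rule continuous_on_tendsto_compose[OF h(1)]) auto
  have "h (\<Sum>i<n. \<mu> (A i)) \<le> (\<Sum>i<n. h (\<mu> (A i)))" for n
    by (induction n) (auto simp: h(2) intro: order_trans[OF h(3)] add_right_mono)
  then show "\<exists>N. \<forall>n\<ge>N. h (\<Sum>i<n. \<mu> (A i)) \<le> (\<Sum>n. h (\<mu> (A n)))"
    by (meson order_trans sum_le_suminf summableI finite_lessThan zero_le)
qed

lemma ennreal_add_le: "ennreal (x + y) \<le> ennreal x + ennreal y"
proof -
  have "ennreal (x + y) \<le> ennreal (max x 0 + max y 0)" by (intro ennreal_leI) auto
  also have "\<dots> = ennreal x + ennreal y" by (simp add: max_def ennreal_neg)
  finally show ?thesis .
qed

text \<open>Packages the set function \<open>variation M \<mu>\<close> as a measure, so that it can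
  later be added to \<gamma> and integrated against. It may be infinite here.\<close>

lemma variation_measure:
  fixes \<mu> :: "'a set \<Rightarrow> 'b::real_normed_vector"
  assumes "\<mu> \<in> vector_measures M"
  obtains \<beta> where "sets \<beta> = sets M" "\<And>E. E \<in> sets M \<Longrightarrow> emeasure \<beta> E = variation M \<mu> E"
proof -
  let ?q = "\<lambda>A. ennreal (norm (\<mu> A))"
  have v: "variation M \<mu> = partition_sup M ?q"
    by (auto simp: variation_def partition_sup_def)
  have "countably_additive (sets M) (partition_sup M ?q)"
  proof (rule countably_additive_partition_sup)
    show "?q {} = 0" by (simp add: vector_measure_empty[OF assms])
    fix A :: "nat \<Rightarrow> 'a set" assume A: "range A \<subseteq> sets M" "disjoint_family A"
    have "continuous_on UNIV (\<lambda>x::'b. ennreal (norm x))"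
      by (intro continuous_intros continuous_on_ennreal)
    then show "?q (\<Union>n. A n) \<le> (\<Sum>n. ?q (A n))"
      by (rule vector_measure_countably_subadditive[OF assms A])
         (auto simp: ennreal_plus[symmetric] norm_triangle_ineq simp del: ennreal_plus intro: ennreal_leI)
  qed
  moreover have "positive (sets M) (partition_sup M ?q)"
    by (simp add: positive_def partition_sup_empty vector_measure_empty[OF assms])
  ultimately show thesis
    using that[of "measure_of (space M) (sets M) (partition_sup M ?q)"]
      emeasure_measure_of_sigma[OF sets.sigma_algebra_axioms] v by auto
qed

lemma norm_le_variation:
  assumes "\<mu> \<in> vector_measures M" "E \<in> sets M"
  shows "ennreal (norm (\<mu> E)) \<le> variation M \<mu> E"
proof -
  define A where "A n = (if n = 0 then E else {})" for n :: nat
  have "(\<Sum>n\<in>{0}. ennreal (norm (\<mu> (A n)))) \<le> (\<Sum>n. ennreal (norm (\<mu> (A n))))"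
    by (intro sum_le_suminf) auto
  also have "\<dots> \<le> variation M \<mu> E"
    unfolding variation_def
  proof (rule SUP_upper, intro CollectI conjI)
    show "range A \<subseteq> sets M" using assms(2) by (auto simp: A_def)
    show "disjoint_family A" by (simp add: disjoint_family_on_def A_def)
    show "(\<Union>n. A n) = E" by (auto simp: A_def split: if_splits)
  qed
  finally show ?thesis by (simp add: A_def)
qed

text \<open>The variation is the least measure above \<open>norm (\<mu> E)\<close>; this half of
  that fact reduces a bound on a variation to a bound on single sets.\<close>

lemma variation_le_emeasure:
  assumes "sets N = sets M" "\<And>E. E \<in> sets M \<Longrightarrow> ennreal (norm (\<mu> E)) \<le> emeasure N E"
  shows "variation M \<mu> E \<le> emeasure N E"
  unfolding variation_def
proof (rule SUP_least, clarsimp)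
  fix A :: "nat \<Rightarrow> 'a set" assume A: "range A \<subseteq> sets M" "disjoint_family A" and "E = (\<Union>n. A n)"
  have "(\<Sum>n. ennreal (norm (\<mu> (A n)))) \<le> (\<Sum>n. emeasure N (A n))"
    using A assms by (intro suminf_le) auto
  also have "\<dots> = emeasure N (\<Union>n. A n)"
    using A assms by (intro suminf_emeasure) auto
  finally show "(\<Sum>n. ennreal (norm (\<mu> (A n)))) \<le> emeasure N (\<Union>n. A n)" .
qed

section \<open>The upper variation as a measure and the Jordan decomposition\<close>

lemma upper_variation_eq_partition_sup:
  fixes \<nu> :: "'a set \<Rightarrow> real"
  assumes "\<nu> \<in> vector_measures M" "E \<in> sets M"
  shows "(SUP F\<in>{F \<in> sets M. F \<subseteq> E}. ennreal (\<nu> F)) = partition_sup M (\<lambda>A. ennreal (\<nu> A)) E"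
proof (rule antisym)
  show "(SUP F\<in>{F \<in> sets M. F \<subseteq> E}. ennreal (\<nu> F)) \<le> partition_sup M (\<lambda>A. ennreal (\<nu> A)) E"
  proof (rule SUP_least, clarsimp)
    fix F assume F: "F \<in> sets M" "F \<subseteq> E"
    let ?A = "binaryset F (E - F)"
    have "ennreal (\<nu> F) \<le> (\<Sum>n. ennreal (\<nu> (?A n)))"
      using sum_le_suminf[of "\<lambda>n. ennreal (\<nu> (?A n))" "{0}"] by (auto simp: binaryset_def)
    also have "\<dots> \<le> partition_sup M (\<lambda>A. ennreal (\<nu> A)) E"
      using F assms(2)
      by (intro partition_sup_upper) (auto simp: disjoint_family_on_def binaryset_def split: if_splits)
    finally show "ennreal (\<nu> F) \<le> partition_sup M (\<lambda>A. ennreal (\<nu> A)) E" .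
  qed
  show "partition_sup M (\<lambda>A. ennreal (\<nu> A)) E \<le> (SUP F\<in>{F \<in> sets M. F \<subseteq> E}. ennreal (\<nu> F))"
    unfolding partition_sup_def
  proof (rule SUP_least, clarsimp)
    fix A :: "nat \<Rightarrow> 'a set" assume A: "range A \<subseteq> sets M" "disjoint_family A" "E = (\<Union>n. A n)"
    \<comment> \<open>Pieces of nonpositive measure contribute nothing to the sum. Discarding them
      leaves a union \<open>F\<close> for which the sum is \<open>\<nu> F\<close>.\<close>
    let ?B = "\<lambda>n. if \<nu> (A n) > 0 then A n else {}"
    have B: "range ?B \<subseteq> sets M" "disjoint_family ?B"
      using A by (auto simp: disjoint_family_on_def)
    have pos: "0 \<le> \<nu> (?B n)" "ennreal (\<nu> (A n)) = ennreal (\<nu> (?B n))" for n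
      by (auto simp: vector_measure_empty[OF assms(1)] ennreal_neg)
    have "(\<Sum>n. ennreal (\<nu> (A n))) = (\<Sum>n. ennreal (\<nu> (?B n)))"
      using pos(2) by simp
    also have "\<dots> = ennreal (\<nu> (\<Union>n. ?B n))"
      using vector_measuresD[OF assms(1) B] pos(1) by (intro suminf_ennreal_eq) auto
    also have "\<dots> \<le> (SUP F\<in>{F \<in> sets M. F \<subseteq> (\<Union>n. A n)}. ennreal (\<nu> F))"
      using B by (intro SUP_upper) (auto split: if_splits)
    finally show "(\<Sum>n. ennreal (\<nu> (A n))) \<le> (SUP F\<in>{F \<in> sets M. F \<subseteq> (\<Union>n. A n)}. ennreal (\<nu> F))" .
  qed
qed

lemma sets_upper_variation [simp]: "sets (upper_variation M \<nu>) = sets M"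
  and space_upper_variation [simp]: "space (upper_variation M \<nu>) = space M"
  by (auto simp: upper_variation_def)

lemma emeasure_upper_variation:
  fixes \<nu> :: "'a set \<Rightarrow> real"
  assumes "\<nu> \<in> vector_measures M" "E \<in> sets M"
  shows "emeasure (upper_variation M \<nu>) E = (SUP F\<in>{F \<in> sets M. F \<subseteq> E}. ennreal (\<nu> F))"
proof -
  let ?q = "\<lambda>A. ennreal (\<nu> A)" and ?S = "\<lambda>E. SUP F\<in>{F \<in> sets M. F \<subseteq> E}. ennreal (\<nu> F)"
  have "countably_additive (sets M) (partition_sup M ?q)"
  proof (rule countably_additive_partition_sup)
    show "?q {} = 0" by (simp add: vector_measure_empty[OF assms(1)])
    fix A :: "nat \<Rightarrow> 'a set" assume A: "range A \<subseteq> sets M" "disjoint_family A"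
    have "continuous_on UNIV (\<lambda>x::real. ennreal x)"
      by (intro continuous_intros continuous_on_ennreal)
    then show "?q (\<Union>n. A n) \<le> (\<Sum>n. ?q (A n))"
      by (rule vector_measure_countably_subadditive[OF assms(1) A]) (auto simp: ennreal_add_le)
  qed
  then have "countably_additive (sets M) ?S"
    by (auto simp: countably_additive_def upper_variation_eq_partition_sup[OF assms(1)] image_subset_iff)
  moreover have "positive (sets M) ?S"
    by (auto simp: positive_def vector_measure_empty[OF assms(1)] intro!: antisym SUP_least)
  ultimately show ?thesis
    unfolding upper_variation_def
    by (intro emeasure_measure_of_sigma[OF sets.sigma_algebra_axioms]) (use assms in auto)
qed

lemma emeasure_upper_variation_le:
  fixes \<nu> :: "'a set \<Rightarrow> real"
  assumes "\<nu> \<in> vector_measures M" "sets N = sets M" "E \<in> sets M"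
    and "\<And>E. E \<in> sets M \<Longrightarrow> ennreal (\<nu> E) \<le> emeasure N E"
  shows "emeasure (upper_variation M \<nu>) E \<le> emeasure N E"
  unfolding emeasure_upper_variation[OF assms(1,3)]
proof (rule SUP_least, clarsimp)
  fix F assume F: "F \<in> sets M" "F \<subseteq> E"
  have "ennreal (\<nu> F) \<le> emeasure N F" by (rule assms(4)[OF F(1)])
  also have "\<dots> \<le> emeasure N E" using F assms(2,3) by (intro emeasure_mono) auto
  finally show "ennreal (\<nu> F) \<le> emeasure N E" .
qed

text \<open>If the upper variation were infinite, one could split off infinitely many disjoint sets on
  each of which \<open>\<bar>\<nu>\<bar> \<ge> 1\<close>.\<close>

lemma finite_upper_variation:
  fixes \<nu> :: "'a set \<Rightarrow> real"
  assumes \<nu>: "\<nu> \<in> vector_measures M"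
  shows "emeasure (upper_variation M \<nu>) (space M) \<noteq> \<infinity>"
proof
  let ?P = "emeasure (upper_variation M \<nu>)"
  define bad where "bad E \<longleftrightarrow> E \<in> sets M \<and> ?P E = \<infinity>" for E
  have split: "\<exists>F. bad F \<and> F \<subseteq> E \<and> 1 \<le> \<bar>\<nu> (E - F)\<bar>" if "bad E" for E
  proof -
    have E: "E \<in> sets M" "?P E = \<infinity>" using that by (auto simp: bad_def)
    \<comment> \<open>The threshold serves both outcomes: from
      \<open>\<nu> F > \<bar>\<nu> E\<bar> + 1\<close> follow \<open>\<bar>\<nu> F\<bar> > 1\<close>
      and \<open>\<bar>\<nu> (E - F)\<bar> > 1\<close>. Whichever half inherits the infinite upper
      variation, the half split off is large.\<close>
    then have "ennreal (\<bar>\<nu> E\<bar> + 1) < ?P E"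
      by (metis ennreal_less_top infinity_ennreal_def)
    then have "ennreal (\<bar>\<nu> E\<bar> + 1) < (SUP F\<in>{F \<in> sets M. F \<subseteq> E}. ennreal (\<nu> F))"
      unfolding emeasure_upper_variation[OF \<nu> E(1)] .
    then obtain F where F: "F \<in> sets M" "F \<subseteq> E" "ennreal (\<bar>\<nu> E\<bar> + 1) < ennreal (\<nu> F)"
      by (auto simp: less_SUP_iff)
    then have F1: "\<bar>\<nu> E\<bar> + 1 < \<nu> F" by (simp add: ennreal_less_iff del: ennreal_plus)
    have D: "\<nu> (E - F) = \<nu> E - \<nu> F" "E - (E - F) = F"
      using vector_measure_Diff[OF \<nu> E(1) F(1,2)] F(2) by auto
    have "?P E = ?P F + ?P (E - F)"
      using F E by (subst plus_emeasure) (auto simp: Un_absorb1)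
    then consider "?P F = \<infinity>" | "?P (E - F) = \<infinity>"
      using E(2) by (metis ennreal_add_eq_top infinity_ennreal_def)
    then show ?thesis
    proof cases
      case 1
      then show ?thesis using F F1 D by (intro exI[of _ F]) (auto simp: bad_def)
    next
      case 2
      then show ?thesis using F F1 D E by (intro exI[of _ "E - F"]) (auto simp: bad_def)
    qed
  qed
  assume "?P (space M) = \<infinity>"
  then have "bad (space M)" by (simp add: bad_def)
  then have "\<exists>B. \<forall>n::nat. bad (B n) \<and> B (Suc n) \<subseteq> B n \<and> 1 \<le> \<bar>\<nu> (B n - B (Suc n))\<bar>"
    using split by (intro dependent_nat_choice) auto
  then obtain B where B: "\<And>n::nat. bad (B n)" "\<And>n. B (Suc n) \<subseteq> B n \<and> 1 \<le> \<bar>\<nu> (B n - B (Suc n))\<bar>"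
    by blast
  have dec: "decseq B" using B(2) by (intro decseq_SucI) auto
  let ?D = "\<lambda>n. B n - B (Suc n)"
  have "disjoint_family ?D"
  proof (unfold disjoint_family_on_def, intro ballI impI)
    fix m n :: nat assume "m \<noteq> n"
    then consider "Suc m \<le> n" | "Suc n \<le> m" by linarith
    then show "?D m \<inter> ?D n = {}"
      by cases (use decseqD[OF dec] in blast)+
  qed
  then have "summable (\<lambda>n. \<nu> (?D n))"
    using B(1) by (intro sums_summable[OF vector_measuresD[OF \<nu>]]) (auto simp: bad_def)
  then have "(\<lambda>n. \<bar>\<nu> (?D n)\<bar>) \<longlonglongrightarrow> 0"
    by (intro tendsto_rabs_zero summable_LIMSEQ_zero)
  then have "\<forall>\<^sub>F n in sequentially. \<bar>\<nu> (?D n)\<bar> < 1"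
    by (rule order_tendstoD) simp
  then show False
    using B(2) by (auto simp: eventually_sequentially) (meson leD order_refl)
qed

text \<open>For \<open>F\<close> inside \<open>E\<close> one has
  \<open>\<nu> F = \<nu> E + (- \<nu> (E - F))\<close>, where the last term is at most the upper
  variation of \<open>- \<nu>\<close> on \<open>E\<close>. The supremum over \<open>F\<close> gives
  one inequality, exchanging \<open>\<nu>\<close> and \<open>- \<nu>\<close> the other; finiteness
  allows the subtraction.\<close>

lemma Jordan_decomposition:
  fixes \<nu> :: "'a set \<Rightarrow> real"
  assumes \<nu>: "\<nu> \<in> vector_measures M" and E: "E \<in> sets M"
  shows "\<nu> E = measure (upper_variation M \<nu>) E - measure (upper_variation M (\<lambda>E. - \<nu> E)) E"
proof -
  note \<nu>' = vector_measure_uminus[OF \<nu>]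
  define P where "P = upper_variation M \<nu>"
  define N where "N = upper_variation M (\<lambda>E. - \<nu> E)"
  have [simp]: "sets P = sets M" "sets N = sets M" by (auto simp: P_def N_def)
  interpret P: finite_measure P
    using finite_upper_variation[OF \<nu>] by (intro finite_measureI) (simp add: P_def)
  interpret N: finite_measure N
    using finite_upper_variation[OF \<nu>'] by (intro finite_measureI) (simp add: N_def)
  have P_upper: "\<nu> F \<le> measure P E" if "F \<in> sets M" "F \<subseteq> E" for F
  proof -
    have "ennreal (\<nu> F) \<le> emeasure P E"
      using that unfolding P_def emeasure_upper_variation[OF \<nu> E] by (intro SUP_upper) auto
    then show ?thesis by (simp add: P.emeasure_eq_measure)
  qed
  have N_upper: "- \<nu> F \<le> measure N E" if "F \<in> sets M" "F \<subseteq> E" for F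
  proof -
    have "ennreal (- \<nu> F) \<le> emeasure N E"
      using that unfolding N_def emeasure_upper_variation[OF \<nu>' E] by (intro SUP_upper) auto
    then show ?thesis by (simp add: N.emeasure_eq_measure)
  qed
  have "emeasure P E \<le> ennreal (\<nu> E + measure N E)"
    unfolding P_def emeasure_upper_variation[OF \<nu> E]
  proof (rule SUP_least, clarsimp)
    fix F assume F: "F \<in> sets M" "F \<subseteq> E"
    then show "ennreal (\<nu> F) \<le> ennreal (\<nu> E + measure N E)"
      using N_upper[of "E - F"] vector_measure_Diff[OF \<nu> E F] E by (intro ennreal_leI) auto
  qed
  \<comment> \<open>\<open>ennreal\<close> truncates negative numbers, so the sign is needed to
    return to real inequalities.\<close>
  moreover have "0 \<le> \<nu> E + measure N E" using N_upper[OF E] by simp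
  ultimately have 1: "measure P E \<le> \<nu> E + measure N E"
    by (simp add: P.emeasure_eq_measure)
  have "emeasure N E \<le> ennreal (measure P E - \<nu> E)"
    unfolding N_def emeasure_upper_variation[OF \<nu>' E]
  proof (rule SUP_least, clarsimp)
    fix F assume F: "F \<in> sets M" "F \<subseteq> E"
    then show "ennreal (- \<nu> F) \<le> ennreal (measure P E - \<nu> E)"
      using P_upper[of "E - F"] vector_measure_Diff[OF \<nu> E F] E by (intro ennreal_leI) auto
  qed
  moreover have "0 \<le> measure P E - \<nu> E" using P_upper[OF E] by simp
  ultimately have "measure N E \<le> measure P E - \<nu> E"
    by (simp add: N.emeasure_eq_measure)
  with 1 show ?thesis by (simp add: P_def N_def)
qed

subsection \<open>Bounded linear maps on the integrable functions\<close>

text \<open>A bounded linear operator on L1, kept on functions instead of classes and constrained on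
  integrable functions only. The constant is left open here and determined later from the values on
  indicators.\<close>

definition L1_bounded :: "'a measure \<Rightarrow> (('a \<Rightarrow> real) \<Rightarrow> 'b::real_normed_vector) \<Rightarrow> bool" where
  "L1_bounded M T \<longleftrightarrow>
    (\<forall>f g. integrable M f \<longrightarrow> integrable M g \<longrightarrow> T (\<lambda>x. f x + g x) = T f + T g) \<and>
    (\<forall>c f. integrable M f \<longrightarrow> T (\<lambda>x. c * f x) = c *\<^sub>R T f) \<and>
    (\<exists>C. \<forall>f. integrable M f \<longrightarrow> norm (T f) \<le> C * (LINT x|M. \<bar>f x\<bar>))"

lemma L1_boundedI:
  assumes "\<And>f g. integrable M f \<Longrightarrow> integrable M g \<Longrightarrow> T (\<lambda>x. f x + g x) = T f + T g"
    and "\<And>c f. integrable M f \<Longrightarrow> T (\<lambda>x. c * f x) = c *\<^sub>R T f"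
    and "\<And>f. integrable M f \<Longrightarrow> norm (T f) \<le> C * (LINT x|M. \<bar>f x\<bar>)"
  shows "L1_bounded M T"
  unfolding L1_bounded_def using assms by (intro conjI allI impI exI[of _ C]) simp_all

lemma L1_bounded_add:
  "L1_bounded M T \<Longrightarrow> integrable M f \<Longrightarrow> integrable M g \<Longrightarrow> T (\<lambda>x. f x + g x) = T f + T g"
  unfolding L1_bounded_def by simp

lemma L1_bounded_cmult:
  "L1_bounded M T \<Longrightarrow> integrable M f \<Longrightarrow> T (\<lambda>x. c * f x) = c *\<^sub>R T f"
  unfolding L1_bounded_def by simp

lemma L1_bounded_diff:
  assumes "L1_bounded M T" "integrable M f" "integrable M g"
  shows "T (\<lambda>x. f x - g x) = T f - T g"
  using L1_bounded_add[OF assms(1,2), of "\<lambda>x. (-1) * g x"] L1_bounded_cmult[OF assms(1,3), of "-1"] assms(3)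
  by simp

lemma L1_bounded_bound:
  assumes "L1_bounded M T"
  obtains C where "C \<ge> 0" "\<And>f. integrable M f \<Longrightarrow> norm (T f) \<le> C * (LINT x|M. \<bar>f x\<bar>)"
proof -
  obtain C where C: "\<And>f. integrable M f \<Longrightarrow> norm (T f) \<le> C * (LINT x|M. \<bar>f x\<bar>)"
    using assms unfolding L1_bounded_def by blast
  have "norm (T f) \<le> \<bar>C\<bar> * (LINT x|M. \<bar>f x\<bar>)" if "integrable M f" for f
    using C[OF that] by (rule order_trans) (intro mult_right_mono, auto)
  then show thesis using that[of "\<bar>C\<bar>"] by simp
qed

text \<open>The L1 distance of \<open>f\<close> and \<open>g\<close> is 0, so the norm bound makes
  \<open>T\<close> well defined on classes.\<close>

lemma L1_bounded_cong_AE: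
  assumes "L1_bounded M T" "integrable M f" "integrable M g" "AE x in M. f x = g x"
  shows "T f = T g"
proof -
  obtain C where C: "\<And>f. integrable M f \<Longrightarrow> norm (T f) \<le> C * (LINT x|M. \<bar>f x\<bar>)"
    using L1_bounded_bound[OF assms(1)] by blast
  have "(LINT x|M. \<bar>f x - g x\<bar>) = (LINT x|M. 0)"
    by (rule integral_cong_AE) (use assms in auto)
  then show ?thesis
    using C[of "\<lambda>x. f x - g x"] assms L1_bounded_diff[OF assms(1-3)] by simp
qed

lemma L1_bounded_cong:
  assumes "L1_bounded M T" "integrable M g" "\<And>x. x \<in> space M \<Longrightarrow> f x = g x"
  shows "T f = T g"
proof -
  have "integrable M f"
    using assms(2,3) by (subst Bochner_Integration.integrable_cong[OF refl, of _ _ g]) auto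
  then show ?thesis
    using assms by (intro L1_bounded_cong_AE[OF assms(1)]) auto
qed

lemma L1_bounded_sum:
  assumes "L1_bounded M T" "finite I" "\<And>i. i \<in> I \<Longrightarrow> integrable M (f i)"
  shows "T (\<lambda>x. \<Sum>i\<in>I. f i x) = (\<Sum>i\<in>I. T (f i))"
  using assms(2,3)
proof (induction I rule: finite_induct)
  case empty
  show ?case using L1_bounded_cmult[OF assms(1), of "\<lambda>x. 0" 0] by simp
next
  case (insert i I)
  then show ?case
    using L1_bounded_add[OF assms(1), of "f i" "\<lambda>x. \<Sum>i\<in>I. f i x"] by simp
qed

lemma (in finite_measure) integrable_indicator_finite:
  "A \<in> sets M \<Longrightarrow> integrable M (indicator A :: 'a \<Rightarrow> real)"
  by (intro integrable_real_indicator) (auto simp: less_top[symmetric])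

text \<open>The level sets of \<open>s\<close> are disjoint, so after the triangle inequality the
  sum over the levels is exactly \<open>K\<close> times the L1 norm.\<close>

lemma (in finite_measure) L1_bounded_norm_le_simple:
  fixes s :: "'a \<Rightarrow> real"
  assumes T: "L1_bounded M T" and "\<And>A. A \<in> sets M \<Longrightarrow> norm (T (indicator A)) \<le> K * measure M A"
    and s: "simple_function M s"
  shows "norm (T s) \<le> K * (LINT x|M. \<bar>s x\<bar>)"
proof -
  let ?Y = "s ` space M" and ?A = "\<lambda>y. s -` {y} \<inter> space M"
  have fin: "finite ?Y" by (rule simple_functionD(1)[OF s])
  have A: "?A y \<in> sets M" for y by (rule simple_functionD(2)[OF s])
  have rep: "g (s x) = (\<Sum>y\<in>?Y. g y * indicator (?A y) x)" if "x \<in> space M" for g :: "real \<Rightarrow> real" and x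
  proof -
    have "(\<Sum>y\<in>?Y. g y * indicator (?A y) x) = (\<Sum>y\<in>{s x}. g y * indicator (?A y) x)"
      using fin that by (intro sum.mono_neutral_right) (auto simp: indicator_def)
    then show ?thesis using that by simp
  qed
  have int: "integrable M (\<lambda>x. g y * indicator (?A y) x)" for g :: "real \<Rightarrow> real" and y
    using integrable_indicator_finite[OF A] by simp
  have "T s = T (\<lambda>x. \<Sum>y\<in>?Y. y * indicator (?A y) x)"
    by (rule L1_bounded_cong[OF T _ rep[of _ "\<lambda>y. y"]])
       (rule Bochner_Integration.integrable_sum, rule int[of "\<lambda>y. y"])
  also have "\<dots> = (\<Sum>y\<in>?Y. T (\<lambda>x. y * indicator (?A y) x))"
    by (rule L1_bounded_sum[OF T fin int[of "\<lambda>y. y"]])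
  also have "\<dots> = (\<Sum>y\<in>?Y. y *\<^sub>R T (indicator (?A y)))"
    by (intro sum.cong refl L1_bounded_cmult[OF T integrable_indicator_finite[OF A]])
  also have "norm \<dots> \<le> (\<Sum>y\<in>?Y. \<bar>y\<bar> * (K * measure M (?A y)))"
    using assms(2)[OF A] by (intro order_trans[OF norm_sum] sum_mono) (auto intro: mult_left_mono)
  also have "\<dots> = K * (\<Sum>y\<in>?Y. (LINT x|M. \<bar>y\<bar> * indicator (?A y) x))"
    by (simp add: sum_distrib_left mult.left_commute)
  also have "(\<Sum>y\<in>?Y. (LINT x|M. \<bar>y\<bar> * indicator (?A y) x)) = (LINT x|M. (\<Sum>y\<in>?Y. \<bar>y\<bar> * indicator (?A y) x))"
    by (rule Bochner_Integration.integral_sum[symmetric]) (rule int[of abs])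
  also have "\<dots> = (LINT x|M. \<bar>s x\<bar>)"
    by (rule Bochner_Integration.integral_cong[OF refl rep[of _ abs, symmetric]])
  finally show ?thesis .
qed

text \<open>Simple functions obey the bound with \<open>K\<close> itself, while the unspecified
  constant \<open>C\<close> of \<open>T\<close> multiplies only an approximation error that tends to
  0. No sign of \<open>K\<close> is assumed, whence \<open>\<bar>K\<bar>\<close> in front of the
  other error term.\<close>

lemma (in finite_measure) L1_bounded_norm_le:
  assumes T: "L1_bounded M T" and ind: "\<And>A. A \<in> sets M \<Longrightarrow> norm (T (indicator A)) \<le> K * measure M A"
    and f: "integrable M f"
  shows "norm (T f) \<le> K * (LINT x|M. \<bar>f x\<bar>)"
proof -
  obtain s where "\<forall>i. simple_function M (s i)" "\<forall>x\<in>space M. (\<lambda>i. s i x) \<longlonglongrightarrow> f x"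
    "\<forall>i. \<forall>x\<in>space M. dist (s i x) 0 \<le> 2 * dist (f x) 0"
    using borel_measurable_implies_sequence_metric[OF borel_measurable_integrable[OF f], of 0] by blast
  then have s: "\<And>i. simple_function M (s i)" "\<And>x. x \<in> space M \<Longrightarrow> (\<lambda>i. s i x) \<longlonglongrightarrow> f x"
    and bound: "\<And>i x. x \<in> space M \<Longrightarrow> \<bar>s i x\<bar> \<le> 2 * \<bar>f x\<bar>"
    by (simp_all add: dist_real_def)
  have [measurable]: "s i \<in> borel_measurable M" for i
    using s(1) borel_measurable_simple_function by blast
  have int: "integrable M (s i)" for i
    by (rule Bochner_Integration.integrable_bound[of _ "\<lambda>x. 2 * f x"]) (use f bound in \<open>auto simp: abs_mult\<close>)
  have "(\<lambda>i. LINT x|M. \<bar>s i x - f x\<bar>) \<longlonglongrightarrow> (LINT x|M. 0)"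
  proof (rule integral_dominated_convergence[where w = "\<lambda>x. 3 * \<bar>f x\<bar>"])
    show "AE x in M. (\<lambda>i. \<bar>s i x - f x\<bar>) \<longlonglongrightarrow> 0"
      using s(2) by (auto intro!: tendsto_rabs_zero LIM_zero)
    show "AE x in M. norm \<bar>s i x - f x\<bar> \<le> 3 * \<bar>f x\<bar>" for i
    proof (rule AE_I2)
      fix x assume "x \<in> space M"
      from bound[OF this, of i] show "norm \<bar>s i x - f x\<bar> \<le> 3 * \<bar>f x\<bar>" by auto
    qed
  qed (use f in auto)
  then have lim: "(\<lambda>i. LINT x|M. \<bar>s i x - f x\<bar>) \<longlonglongrightarrow> 0" by simp
  obtain C where C: "\<And>f. integrable M f \<Longrightarrow> norm (T f) \<le> C * (LINT x|M. \<bar>f x\<bar>)"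
    using L1_bounded_bound[OF T] by blast
  have bound2: "norm (T f) \<le> \<bar>K\<bar> * (LINT x|M. \<bar>s i x - f x\<bar>) + K * (LINT x|M. \<bar>f x\<bar>)
      + C * (LINT x|M. \<bar>s i x - f x\<bar>)" for i
  proof -
    have "T (\<lambda>x. s i x - f x) = T (s i) - T f"
      by (rule L1_bounded_diff[OF T int f])
    then have "norm (T f) \<le> norm (T (s i)) + norm (T (\<lambda>x. s i x - f x))"
      by (metis norm_minus_commute norm_triangle_sub)
    also have "norm (T (\<lambda>x. s i x - f x)) \<le> C * (LINT x|M. \<bar>s i x - f x\<bar>)"
      using int f by (intro C) auto
    also have "norm (T (s i)) \<le> K * (LINT x|M. \<bar>s i x\<bar>)"
      by (rule L1_bounded_norm_le_simple[OF T ind s(1)])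
    also have "\<dots> \<le> \<bar>K\<bar> * (LINT x|M. \<bar>s i x - f x\<bar>) + K * (LINT x|M. \<bar>f x\<bar>)"
    proof -
      have "\<bar>(LINT x|M. \<bar>s i x\<bar>) - (LINT x|M. \<bar>f x\<bar>)\<bar> = \<bar>LINT x|M. \<bar>s i x\<bar> - \<bar>f x\<bar>\<bar>"
        using int f by simp
      also have "\<dots> \<le> (LINT x|M. \<bar>\<bar>s i x\<bar> - \<bar>f x\<bar>\<bar>)"
        by (rule integral_abs_bound)
      also have "\<dots> \<le> (LINT x|M. \<bar>s i x - f x\<bar>)"
        using int f by (intro integral_mono) auto
      finally have "\<bar>K\<bar> * \<bar>(LINT x|M. \<bar>s i x\<bar>) - (LINT x|M. \<bar>f x\<bar>)\<bar> \<le> \<bar>K\<bar> * (LINT x|M. \<bar>s i x - f x\<bar>)"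
        by (intro mult_left_mono) auto
      moreover have "K * ((LINT x|M. \<bar>s i x\<bar>) - (LINT x|M. \<bar>f x\<bar>))
          \<le> \<bar>K\<bar> * \<bar>(LINT x|M. \<bar>s i x\<bar>) - (LINT x|M. \<bar>f x\<bar>)\<bar>"
        by (simp add: abs_mult[symmetric])
      ultimately show ?thesis by (simp add: algebra_simps)
    qed
    finally show ?thesis by simp
  qed
  have "(\<lambda>i. \<bar>K\<bar> * (LINT x|M. \<bar>s i x - f x\<bar>) + K * (LINT x|M. \<bar>f x\<bar>) + C * (LINT x|M. \<bar>s i x - f x\<bar>))
      \<longlonglongrightarrow> \<bar>K\<bar> * 0 + K * (LINT x|M. \<bar>f x\<bar>) + C * 0"
    by (intro tendsto_intros lim)
  then show ?thesis
    using LIMSEQ_le_const[of _ _ "norm (T f)"] bound2 by simp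
qed

text \<open>The preceding bound with \<open>K = 0\<close>, applied to the difference of the two
  operators.\<close>

lemma (in finite_measure) L1_bounded_eqI:
  assumes "L1_bounded M T" "L1_bounded M S" "\<And>A. A \<in> sets M \<Longrightarrow> T (indicator A) = S (indicator A)"
    and "integrable M f"
  shows "T f = S f"
proof -
  obtain C D where C: "\<And>f. integrable M f \<Longrightarrow> norm (T f) \<le> C * (LINT x|M. \<bar>f x\<bar>)"
    and D: "\<And>f. integrable M f \<Longrightarrow> norm (S f) \<le> D * (LINT x|M. \<bar>f x\<bar>)"
    using L1_bounded_bound assms(1,2) by metis
  have "L1_bounded M (\<lambda>f. T f - S f)"
  proof (rule L1_boundedI[where C = "C + D"])
    fix f :: "'a \<Rightarrow> real" assume "integrable M f"
    then show "norm (T f - S f) \<le> (C + D) * (LINT x|M. \<bar>f x\<bar>)"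
      using C[of f] D[of f] norm_triangle_ineq4[of "T f" "S f"] by (simp add: algebra_simps)
  qed (simp_all add: L1_bounded_add[OF assms(1)] L1_bounded_add[OF assms(2)] L1_bounded_cmult[OF assms(1)]
        L1_bounded_cmult[OF assms(2)] algebra_simps)
  from L1_bounded_norm_le[OF this, of 0 f] show ?thesis
    using assms(3,4) by simp
qed

subsection \<open>Integration against a vector measure\<close>

lemma integral_mono_measure_finite:
  fixes f :: "'a \<Rightarrow> real"
  assumes "sets P = sets M" "\<And>E. E \<in> sets M \<Longrightarrow> emeasure P E \<le> emeasure M E" "integrable M f"
  shows "integrable P f"
    and "(LINT x|P. \<bar>f x\<bar>) \<le> (LINT x|M. \<bar>f x\<bar>)"
proof -
  have f: "f \<in> borel_measurable P"
    using assms(1,3) measurable_cong_sets by blast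
  have "P \<le> M"
    using assms(1,2) by (simp add: le_measure)
  then have le: "(\<integral>\<^sup>+x. ennreal \<bar>f x\<bar> \<partial>P) \<le> (\<integral>\<^sup>+x. ennreal \<bar>f x\<bar> \<partial>M)"
    using assms(1) by (intro nn_integral_mono_measure) auto
  have fin: "(\<integral>\<^sup>+x. ennreal \<bar>f x\<bar> \<partial>M) < \<infinity>"
    using assms(3) by (simp add: integrable_iff_bounded)
  then show int: "integrable P f"
    using f le by (simp add: integrable_iff_bounded)
  have "ennreal (LINT x|P. \<bar>f x\<bar>) \<le> ennreal (LINT x|M. \<bar>f x\<bar>)"
    using le int assms(3) by (simp add: nn_integral_eq_integral)
  then show "(LINT x|P. \<bar>f x\<bar>) \<le> (LINT x|M. \<bar>f x\<bar>)"
    by simp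
qed

lemma L1_bounded_signed_integral:
  fixes \<nu> :: "'a set \<Rightarrow> real"
  assumes \<nu>: "\<nu> \<in> vector_measures N" and sets: "sets M = sets N"
    and le: "\<And>E. E \<in> sets N \<Longrightarrow> ennreal \<bar>\<nu> E\<bar> \<le> emeasure M E"
  shows "L1_bounded M (signed_integral N \<nu>)"
proof -
  let ?P = "upper_variation N \<nu>" and ?N = "upper_variation N (\<lambda>E. - \<nu> E)"
  have bP: "ennreal (\<nu> E) \<le> emeasure M E" and bN: "ennreal (- \<nu> E) \<le> emeasure M E" if "E \<in> sets N" for E
    by (rule order_trans[OF ennreal_leI le[OF that]]; simp)+
  have P: "emeasure ?P E \<le> emeasure M E" if "E \<in> sets M" for E
    by (rule emeasure_upper_variation_le[OF \<nu> sets _ bP]) (use that sets in auto)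
  have N: "emeasure ?N E \<le> emeasure M E" if "E \<in> sets M" for E
    by (rule emeasure_upper_variation_le[OF vector_measure_uminus[OF \<nu>] sets _ bN]) (use that sets in auto)
  have intP: "integrable ?P f" "(LINT x|?P. \<bar>f x\<bar>) \<le> (LINT x|M. \<bar>f x\<bar>)"
    and intN: "integrable ?N f" "(LINT x|?N. \<bar>f x\<bar>) \<le> (LINT x|M. \<bar>f x\<bar>)" if "integrable M f" for f :: "'a \<Rightarrow> real"
    by (rule integral_mono_measure_finite[OF _ P that] integral_mono_measure_finite[OF _ N that];
        simp add: sets)+
  show ?thesis
  \<comment> \<open>One unit for each of the two Jordan parts. This crude constant suffices, as the
    sharp one is recovered from indicators.\<close>
  proof (rule L1_boundedI[where C = 2])
    fix f :: "'a \<Rightarrow> real" assume f: "integrable M f"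
    have "\<bar>LINT x|?P. f x\<bar> \<le> (LINT x|M. \<bar>f x\<bar>)" "\<bar>LINT x|?N. f x\<bar> \<le> (LINT x|M. \<bar>f x\<bar>)"
      using intP(2)[OF f] intN(2)[OF f] integral_abs_bound[of ?P f] integral_abs_bound[of ?N f]
      by linarith+
    then show "norm (signed_integral N \<nu> f) \<le> 2 * (LINT x|M. \<bar>f x\<bar>)"
      by (simp add: signed_integral_def)
    show "signed_integral N \<nu> (\<lambda>x. c * f x) = c *\<^sub>R signed_integral N \<nu> f" for c
      by (simp add: signed_integral_def right_diff_distrib)
    fix g :: "'a \<Rightarrow> real" assume g: "integrable M g"
    show "signed_integral N \<nu> (\<lambda>x. f x + g x) = signed_integral N \<nu> f + signed_integral N \<nu> g"
      using intP(1)[OF f] intP(1)[OF g] intN(1)[OF f] intN(1)[OF g]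
      by (simp add: signed_integral_def)
  qed
qed

lemma signed_integral_indicator:
  fixes \<nu> :: "'a set \<Rightarrow> real"
  assumes "\<nu> \<in> vector_measures N" "E \<in> sets N"
  shows "signed_integral N \<nu> (indicator E) = \<nu> E"
proof -
  have "E \<inter> space N = E" using sets.sets_into_space[OF assms(2)] by auto
  then show ?thesis
    using Jordan_decomposition[OF assms] by (simp add: signed_integral_def)
qed

text \<open>Built from coordinates so as to match \<open>has_distr_gradient\<close>, which tests one
  basis vector at a time.\<close>

definition vector_integral :: "'a measure \<Rightarrow> ('a set \<Rightarrow> 'b::euclidean_space) \<Rightarrow> ('a \<Rightarrow> real) \<Rightarrow> 'b" where
  "vector_integral N \<mu> f = (\<Sum>i\<in>Basis. signed_integral N (\<lambda>E. \<mu> E \<bullet> i) f *\<^sub>R i)"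

lemma vector_integral_inner:
  "i \<in> Basis \<Longrightarrow> vector_integral N \<mu> f \<bullet> i = signed_integral N (\<lambda>E. \<mu> E \<bullet> i) f"
  by (simp add: vector_integral_def inner_sum_left_Basis)

lemma L1_bounded_vector_integral:
  fixes \<mu> :: "'a set \<Rightarrow> 'b::euclidean_space"
  assumes \<mu>: "\<mu> \<in> vector_measures N" and sets: "sets M = sets N"
    and le: "\<And>E. E \<in> sets N \<Longrightarrow> ennreal (norm (\<mu> E)) \<le> emeasure M E"
  shows "L1_bounded M (vector_integral N \<mu>)"
proof -
  have S: "L1_bounded M (signed_integral N (\<lambda>E. \<mu> E \<bullet> i))" if "i \<in> Basis" for i
  proof (rule L1_bounded_signed_integral[OF vector_measure_inner[OF \<mu>] sets])
    fix E assume "E \<in> sets N"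
    have "ennreal \<bar>\<mu> E \<bullet> i\<bar> \<le> ennreal (norm (\<mu> E))"
      using Basis_le_norm[OF that] by (intro ennreal_leI)
    then show "ennreal \<bar>\<mu> E \<bullet> i\<bar> \<le> emeasure M E"
      using le[OF \<open>E \<in> sets N\<close>] by (rule order_trans)
  qed
  have "\<exists>C. \<forall>f. integrable M f \<longrightarrow> norm (signed_integral N (\<lambda>E. \<mu> E \<bullet> i) f) \<le> C * (LINT x|M. \<bar>f x\<bar>)"
    if "i \<in> Basis" for i
    using S[OF that] unfolding L1_bounded_def by blast
  then obtain C where C: "\<And>i f. i \<in> Basis \<Longrightarrow> integrable M f \<Longrightarrow>
      norm (signed_integral N (\<lambda>E. \<mu> E \<bullet> i) f) \<le> C i * (LINT x|M. \<bar>f x\<bar>)"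
    by metis
  show ?thesis
  proof (rule L1_boundedI[where C = "\<Sum>i\<in>Basis. C i"])
    fix f :: "'a \<Rightarrow> real" assume f: "integrable M f"
    have "norm (vector_integral N \<mu> f) \<le> (\<Sum>i\<in>Basis. norm (signed_integral N (\<lambda>E. \<mu> E \<bullet> i) f *\<^sub>R i))"
      unfolding vector_integral_def by (rule norm_sum)
    also have "\<dots> \<le> (\<Sum>i\<in>Basis. C i * (LINT x|M. \<bar>f x\<bar>))"
      using C[OF _ f] by (intro sum_mono) auto
    finally show "norm (vector_integral N \<mu> f) \<le> (\<Sum>i\<in>Basis. C i) * (LINT x|M. \<bar>f x\<bar>)"
      by (simp add: sum_distrib_right)
    show "vector_integral N \<mu> (\<lambda>x. c * f x) = c *\<^sub>R vector_integral N \<mu> f" for c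
      by (simp add: vector_integral_def L1_bounded_cmult[OF S f] scaleR_sum_right)
    fix g :: "'a \<Rightarrow> real" assume g: "integrable M g"
    show "vector_integral N \<mu> (\<lambda>x. f x + g x) = vector_integral N \<mu> f + vector_integral N \<mu> g"
      by (simp add: vector_integral_def L1_bounded_add[OF S f g] scaleR_add_left sum.distrib)
  qed
qed

lemma vector_integral_indicator:
  assumes "\<mu> \<in> vector_measures N" "E \<in> sets N"
  shows "vector_integral N \<mu> (indicator E) = \<mu> E"
  by (simp add: vector_integral_def signed_integral_indicator[OF vector_measure_inner[OF assms(1)] assms(2)]
      euclidean_representation)

text \<open>The coordinate bounds would add up to a constant depending on the dimension. The
  constant 1 holds because on an indicator the integral is \<open>\<mu> E\<close> itself, whose
  Euclidean norm is bounded by hypothesis.\<close>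

lemma norm_vector_integral_le:
  fixes \<mu> :: "'a set \<Rightarrow> 'b::euclidean_space"
  assumes "finite_measure M" "\<mu> \<in> vector_measures N" "sets M = sets N"
    and "\<And>E. E \<in> sets N \<Longrightarrow> ennreal (norm (\<mu> E)) \<le> emeasure M E" "integrable M f"
  shows "norm (vector_integral N \<mu> f) \<le> (LINT x|M. \<bar>f x\<bar>)"
proof -
  interpret finite_measure M by fact
  show ?thesis
    using L1_bounded_norm_le[OF L1_bounded_vector_integral[OF assms(2-4)], of 1 f] assms(3-5)
    by (simp add: vector_integral_indicator[OF assms(2)] emeasure_eq_measure)
qed

subsection \<open>Extension from the test functions\<close>

text \<open>Extension by density: \<open>L\<close> is 1-Lipschitz for the L1 distance on a dense
  subspace and has values in a complete space.\<close>

lemma (in finite_measure_on) L1_extension: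
  fixes L :: "('a \<Rightarrow> real) \<Rightarrow> 'b::banach"
  assumes add: "\<And>\<phi> \<psi>. \<phi> \<in> test_functions \<Omega> \<Longrightarrow> \<psi> \<in> test_functions \<Omega> \<Longrightarrow> L (\<lambda>x. \<phi> x + \<psi> x) = L \<phi> + L \<psi>"
    and cmult: "\<And>c \<phi>. \<phi> \<in> test_functions \<Omega> \<Longrightarrow> L (\<lambda>x. c * \<phi> x) = c *\<^sub>R L \<phi>"
    and bound: "\<And>\<phi>. \<phi> \<in> test_functions \<Omega> \<Longrightarrow> norm (L \<phi>) \<le> (LINT x|M. \<bar>\<phi> x\<bar>)"
  obtains T where "L1_bounded M T" "\<And>f. integrable M f \<Longrightarrow> norm (T f) \<le> (LINT x|M. \<bar>f x\<bar>)"
    "\<And>\<phi>. \<phi> \<in> test_functions \<Omega> \<Longrightarrow> T \<phi> = L \<phi>"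
proof -
  let ?d = "\<lambda>f g. LINT x|M. \<bar>f x - g x :: real\<bar>"
  note tint = test_function_integrable
  have triangle: "?d f h \<le> ?d f g + ?d g h" if "integrable M f" "integrable M g" "integrable M h" for f g h
  proof -
    have "?d f h \<le> (LINT x|M. \<bar>f x - g x\<bar> + \<bar>g x - h x\<bar>)"
      using that by (intro integral_mono) auto
    also have "\<dots> = ?d f g + ?d g h"
      using that by simp
    finally show ?thesis .
  qed
  have sym: "?d f g = ?d g f" for f g by (simp add: abs_minus_commute)
  have Ldiff: "norm (L \<phi> - L \<psi>) \<le> ?d \<phi> \<psi>" if "\<phi> \<in> test_functions \<Omega>" "\<psi> \<in> test_functions \<Omega>" for \<phi> \<psi>
    using bound[OF test_function_diff[OF that]] add[OF that(1) test_function_cmult[OF that(2), of "-1"]]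
      cmult[OF that(2), of "-1"] by simp
  define \<Phi> where "\<Phi> f n = (SOME \<phi>. \<phi> \<in> test_functions \<Omega> \<and> ?d \<phi> f < 1 / real (Suc n))" for f and n :: nat
  have \<Phi>: "\<Phi> f n \<in> test_functions \<Omega>" "?d (\<Phi> f n) f < 1 / real (Suc n)" if "integrable M f" for f n
  proof -
    have "\<exists>\<phi>. \<phi> \<in> test_functions \<Omega> \<and> ?d \<phi> f < 1 / real (Suc n)"
      using test_function_approx[OF that, of "1 / real (Suc n)"] by auto
    from someI_ex[OF this] show "\<Phi> f n \<in> test_functions \<Omega>" "?d (\<Phi> f n) f < 1 / real (Suc n)"
      unfolding \<Phi>_def by auto
  qed
  have \<Phi>_lim: "(\<lambda>n. ?d (\<Phi> f n) f) \<longlonglongrightarrow> 0" if "integrable M f" for f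
  proof (rule tendsto_sandwich[OF _ _ tendsto_const LIMSEQ_inverse_real_of_nat])
    show "\<forall>\<^sub>F n in sequentially. ?d (\<Phi> f n) f \<le> inverse (real (Suc n))"
      using \<Phi>(2)[OF that] by (intro always_eventually allI) (simp add: inverse_eq_divide less_imp_le)
  qed simp
  define T where "T f = lim (\<lambda>n. L (\<Phi> f n))" for f
  have T_lim: "(\<lambda>n. L (\<Phi> f n)) \<longlonglongrightarrow> T f" if f: "integrable M f" for f
  proof -
    have "Cauchy (\<lambda>n. L (\<Phi> f n))"
    proof (rule CauchyI)
      fix e :: real assume "e > 0"
      then have "\<forall>\<^sub>F n in sequentially. ?d (\<Phi> f n) f < e / 2"
        by (intro order_tendstoD[OF \<Phi>_lim[OF f]]) auto
      then obtain k where k: "\<And>n. n \<ge> k \<Longrightarrow> ?d (\<Phi> f n) f < e / 2"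
        by (auto simp: eventually_sequentially)
      have "norm (L (\<Phi> f m) - L (\<Phi> f n)) < e" if "m \<ge> k" "n \<ge> k" for m n
      proof -
        have "norm (L (\<Phi> f m) - L (\<Phi> f n)) \<le> ?d (\<Phi> f m) (\<Phi> f n)"
          by (intro Ldiff \<Phi> f)
        also have "\<dots> \<le> ?d (\<Phi> f m) f + ?d f (\<Phi> f n)"
          by (intro triangle tint \<Phi>(1) f)
        also have "\<dots> < e"
          using k[OF that(1)] k[OF that(2)] sym[of f "\<Phi> f n"] by simp
        finally show ?thesis .
      qed
      then show "\<exists>k. \<forall>m\<ge>k. \<forall>n\<ge>k. norm (L (\<Phi> f m) - L (\<Phi> f n)) < e" by blast
    qed
    then show ?thesis
      unfolding T_def by (simp add: Cauchy_convergent convergent_LIMSEQ_iff[symmetric])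
  qed
  \<comment> \<open>The limit does not depend on the approximating sequence. Linearity follows,
    because sums and multiples of approximants are approximants of sums and multiples.\<close>
  have T_unique: "T f = y" if f: "integrable M f" and \<phi>: "\<And>n. \<phi> n \<in> test_functions \<Omega>"
    "(\<lambda>n. ?d (\<phi> n) f) \<longlonglongrightarrow> 0" "(\<lambda>n. L (\<phi> n)) \<longlonglongrightarrow> y" for f \<phi> y
  proof -
    have "(\<lambda>n. L (\<phi> n) - L (\<Phi> f n)) \<longlonglongrightarrow> 0"
    proof (rule Lim_null_comparison)
      have "norm (L (\<phi> n) - L (\<Phi> f n)) \<le> ?d (\<phi> n) f + ?d (\<Phi> f n) f" for n
        using Ldiff[OF \<phi>(1) \<Phi>(1)[OF f], of n n] sym[of f "\<Phi> f n"]
          triangle[OF tint[OF \<phi>(1)[of n]] f tint[OF \<Phi>(1)[OF f, of n]]] by linarith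
      then show "\<forall>\<^sub>F n in sequentially. norm (L (\<phi> n) - L (\<Phi> f n)) \<le> ?d (\<phi> n) f + ?d (\<Phi> f n) f"
        by (intro always_eventually allI)
      show "(\<lambda>n. ?d (\<phi> n) f + ?d (\<Phi> f n) f) \<longlonglongrightarrow> 0"
        using tendsto_add[OF \<phi>(2) \<Phi>_lim[OF f]] by simp
    qed
    moreover have "(\<lambda>n. L (\<phi> n) - L (\<Phi> f n)) \<longlonglongrightarrow> y - T f"
      by (intro tendsto_diff \<phi>(3) T_lim f)
    ultimately show ?thesis
      using LIMSEQ_unique by fastforce
  qed
  have T_add: "T (\<lambda>x. f x + g x) = T f + T g" if f: "integrable M f" and g: "integrable M g" for f g
  proof (rule T_unique[where \<phi> = "\<lambda>n x. \<Phi> f n x + \<Phi> g n x"])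
    show "(\<lambda>n. ?d (\<lambda>x. \<Phi> f n x + \<Phi> g n x) (\<lambda>x. f x + g x)) \<longlonglongrightarrow> 0"
    proof (rule tendsto_sandwich[OF _ _ tendsto_const])
      show "(\<lambda>n. ?d (\<Phi> f n) f + ?d (\<Phi> g n) g) \<longlonglongrightarrow> 0"
        using tendsto_add[OF \<Phi>_lim[OF f] \<Phi>_lim[OF g]] by simp
      have "?d (\<lambda>x. \<Phi> f n x + \<Phi> g n x) (\<lambda>x. f x + g x) \<le> ?d (\<Phi> f n) f + ?d (\<Phi> g n) g" for n
      proof -
        note [simp] = f g tint[OF \<Phi>(1)[OF f]] tint[OF \<Phi>(1)[OF g]]
        have "?d (\<lambda>x. \<Phi> f n x + \<Phi> g n x) (\<lambda>x. f x + g x)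
            \<le> (LINT x|M. \<bar>\<Phi> f n x - f x\<bar> + \<bar>\<Phi> g n x - g x\<bar>)"
          by (intro integral_mono) auto
        then show ?thesis by simp
      qed
      then show "\<forall>\<^sub>F n in sequentially. ?d (\<lambda>x. \<Phi> f n x + \<Phi> g n x) (\<lambda>x. f x + g x)
          \<le> ?d (\<Phi> f n) f + ?d (\<Phi> g n) g"
        by (intro always_eventually allI)
    qed simp
    show "(\<lambda>n. L (\<lambda>x. \<Phi> f n x + \<Phi> g n x)) \<longlonglongrightarrow> T f + T g"
      using tendsto_add[OF T_lim[OF f] T_lim[OF g]] by (simp add: add \<Phi>(1) f g)
  qed (use f g \<Phi>(1) in \<open>auto intro: test_function_add\<close>)
  have T_cmult: "T (\<lambda>x. c * f x) = c *\<^sub>R T f" if f: "integrable M f" for c f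
  proof (rule T_unique[where \<phi> = "\<lambda>n x. c * \<Phi> f n x"])
    have "?d (\<lambda>x. c * \<Phi> f n x) (\<lambda>x. c * f x) = \<bar>c\<bar> * ?d (\<Phi> f n) f" for n
      by (simp add: right_diff_distrib[symmetric] abs_mult)
    then show "(\<lambda>n. ?d (\<lambda>x. c * \<Phi> f n x) (\<lambda>x. c * f x)) \<longlonglongrightarrow> 0"
      using tendsto_mult_left[OF \<Phi>_lim[OF f], of "\<bar>c\<bar>"] by simp
    show "(\<lambda>n. L (\<lambda>x. c * \<Phi> f n x)) \<longlonglongrightarrow> c *\<^sub>R T f"
      using tendsto_scaleR[OF tendsto_const T_lim[OF f], of c] by (simp add: cmult \<Phi>(1) f)
  qed (use f \<Phi>(1) in \<open>auto intro: test_function_cmult\<close>)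
  have T_norm: "norm (T f) \<le> (LINT x|M. \<bar>f x\<bar>)" if f: "integrable M f" for f
  proof (rule LIMSEQ_le)
    show "(\<lambda>n. norm (L (\<Phi> f n))) \<longlonglongrightarrow> norm (T f)"
      by (intro tendsto_norm T_lim f)
    show "(\<lambda>n. ?d (\<Phi> f n) f + (LINT x|M. \<bar>f x\<bar>)) \<longlonglongrightarrow> (LINT x|M. \<bar>f x\<bar>)"
      using tendsto_add[OF \<Phi>_lim[OF f] tendsto_const, of "LINT x|M. \<bar>f x\<bar>"] by simp
    have "norm (L (\<Phi> f n)) \<le> ?d (\<Phi> f n) f + (LINT x|M. \<bar>f x\<bar>)" for n
      using bound[OF \<Phi>(1)[OF f]] triangle[OF tint[OF \<Phi>(1)[OF f, of n]] f, of "\<lambda>x. 0"]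
      by (intro order_trans[OF bound[OF \<Phi>(1)[OF f]]]) simp
    then show "\<exists>N. \<forall>n\<ge>N. norm (L (\<Phi> f n)) \<le> ?d (\<Phi> f n) f + (LINT x|M. \<bar>f x\<bar>)" by blast
  qed
  show thesis
  proof (rule that[of T])
    show "L1_bounded M T"
      by (rule L1_boundedI[where C = 1]) (use T_add T_cmult T_norm in auto)
    show "T \<phi> = L \<phi>" if "\<phi> \<in> test_functions \<Omega>" for \<phi>
      by (rule T_unique[where \<phi> = "\<lambda>n. \<phi>"]) (use that tint in auto)
  qed (rule T_norm)
qed

subsection \<open>Lipschitz functions of functions of bounded variation\<close>

lemma lborel_translate:
  fixes f :: "'a::euclidean_space \<Rightarrow> real"
  assumes [measurable]: "f \<in> borel_measurable borel"
  shows integral_lborel_translate: "(LINT x|lborel. f (x + a)) = (LINT x|lborel. f x)"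
    and integrable_lborel_translate: "integrable lborel f \<Longrightarrow> integrable lborel (\<lambda>x. f (x + a))"
proof -
  have "distr lborel borel (\<lambda>x. x + a) = lborel"
    using lborel_distr_plus[of a] by (simp add: add.commute[of _ a])
  moreover have "(LINT x|distr lborel borel (\<lambda>x. x + a). f x) = (LINT x|lborel. f (x + a))"
    by (rule integral_distr) auto
  moreover have "integrable (distr lborel borel (\<lambda>x. x + a)) f \<longleftrightarrow> integrable lborel (\<lambda>x. f (x + a))"
    by (rule integrable_distr_eq) auto
  ultimately show "(LINT x|lborel. f (x + a)) = (LINT x|lborel. f x)"
    "integrable lborel f \<Longrightarrow> integrable lborel (\<lambda>x. f (x + a))"
    by simp_all
qed

lemma integrable_mult_bounded:
  fixes f g :: "'a \<Rightarrow> real"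
  assumes "integrable M f" "g \<in> borel_measurable M" "\<And>x. \<bar>g x\<bar> \<le> B"
  shows "integrable M (\<lambda>x. f x * g x)"
proof (rule Bochner_Integration.integrable_bound)
  show "integrable M (\<lambda>x. B * f x)" using assms(1) by simp
  have "\<bar>f x * g x\<bar> \<le> \<bar>B * f x\<bar>" for x
  proof -
    have "\<bar>g x\<bar> * \<bar>f x\<bar> \<le> B * \<bar>f x\<bar>" using assms(3) by (intro mult_right_mono) auto
    also have "\<dots> \<le> \<bar>B * f x\<bar>" by (simp add: abs_mult mult_right_mono)
    finally show ?thesis by (simp add: abs_mult mult.commute)
  qed
  then show "AE x in M. norm (f x * g x) \<le> norm (B * f x)" by simp
qed (use assms in auto)

lemma test_function_borel:
  assumes "\<phi> \<in> test_functions \<Omega>"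
  shows "\<phi> \<in> borel_measurable borel"
  using borel_measurable_continuous_onI[OF test_function_continuous[OF assms]] .

lemma pderiv_test_borel:
  assumes "\<phi> \<in> test_functions \<Omega>"
  shows "pderiv_at \<phi> e \<in> borel_measurable borel"
  using borel_measurable_continuous_onI[OF continuous_on_pderiv_test[OF assms]] .

lemma pderiv_test_translate:
  assumes "\<phi> \<in> test_functions \<Omega>"
  shows "pderiv_at (\<lambda>x. \<phi> (x + a)) e x = pderiv_at \<phi> e (x + a)"
proof -
  have "((\<lambda>x. x + a) has_derivative (\<lambda>h. h)) (at x)"
    by (auto intro!: derivative_eq_intros)
  from has_derivative_compose[OF this test_function_has_derivative[OF assms]]
  have "((\<lambda>x. \<phi> (x + a)) has_derivative frechet_derivative \<phi> (at (x + a))) (at x)" .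
  from fun_cong[OF frechet_derivative_at[OF this], symmetric] show ?thesis .
qed

text \<open>Differentiation under the integral sign. The shift sits on the smooth factor, whose
  difference quotients are uniformly bounded, so that \<open>\<bar>U\<bar>\<close> times a constant
  is an integrable majorant.\<close>

lemma has_derivative_integral_translate:
  fixes U :: "'a::euclidean_space \<Rightarrow> real"
  assumes U: "integrable lborel U" and \<eta>: "\<eta> \<in> test_functions \<Omega>"
  shows "((\<lambda>s. LINT x|lborel. U x * \<eta> (x + s *\<^sub>R e)) has_real_derivative
    (LINT x|lborel. U x * pderiv_at \<eta> e (x + s *\<^sub>R e))) (at s)"
proof -
  note [measurable] = test_function_borel[OF \<eta>] pderiv_test_borel[OF \<eta>, of e] borel_measurable_integrable[OF U]
  obtain B where B: "B > 0" "\<And>x. \<bar>pderiv_at \<eta> e x\<bar> \<le> B"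
    using pderiv_test_bounded[OF \<eta>] by blast
  obtain C where C: "\<And>x. \<bar>\<eta> x\<bar> \<le> C"
    using test_function_bounded[OF \<eta>] by blast
  have int: "integrable lborel (\<lambda>x. U x * \<eta> (x + s *\<^sub>R e))" for s
    by (rule integrable_mult_bounded[OF U _ C]) simp
  let ?F = "\<lambda>s. LINT x|lborel. U x * \<eta> (x + s *\<^sub>R e)"
  let ?q = "\<lambda>h x. (\<eta> (x + (s + h) *\<^sub>R e) - \<eta> (x + s *\<^sub>R e)) / h"
  have quot: "(?F (s + h) - ?F s) / h = (LINT x|lborel. U x * ?q h x)" for h
  proof -
    have "(?F (s + h) - ?F s) / h
        = (LINT x|lborel. (U x * \<eta> (x + (s + h) *\<^sub>R e) - U x * \<eta> (x + s *\<^sub>R e)) / h)"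
      using int by simp
    also have "\<dots> = (LINT x|lborel. U x * ?q h x)"
      by (intro Bochner_Integration.integral_cong) (auto simp: right_diff_distrib)
    finally show ?thesis .
  qed
  have q_bound: "\<bar>?q h x\<bar> \<le> B" for h x
  proof (cases "h = 0")
    case True
    then show ?thesis using B(1) by simp
  next
    case False
    have "\<bar>\<eta> ((x + s *\<^sub>R e) + h *\<^sub>R e) - \<eta> (x + s *\<^sub>R e)\<bar> \<le> B * \<bar>h\<bar>"
      by (rule test_function_diff_bound[OF \<eta> B(2)])
    then show ?thesis
      using False by (simp add: algebra_simps divide_le_eq)
  qed
  have q_lim: "((\<lambda>h. ?q h x) \<longlongrightarrow> pderiv_at \<eta> e (x + s *\<^sub>R e)) (at 0)" for x
    using test_function_has_directional_derivative[OF \<eta>, of x e s] by (simp add: DERIV_def)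
  have "((\<lambda>h. LINT x|lborel. U x * ?q h x) \<longlongrightarrow> (LINT x|lborel. U x * pderiv_at \<eta> e (x + s *\<^sub>R e))) (at 0)"
    unfolding tendsto_at_iff_sequentially
  proof (intro allI impI)
    fix X :: "nat \<Rightarrow> real" assume X: "\<forall>i. X i \<in> UNIV - {0}" "X \<longlonglongrightarrow> 0"
    show "((\<lambda>h. LINT x|lborel. U x * ?q h x) \<circ> X) \<longlonglongrightarrow> (LINT x|lborel. U x * pderiv_at \<eta> e (x + s *\<^sub>R e))"
      unfolding o_def
    proof (rule integral_dominated_convergence[where w = "\<lambda>x. B * \<bar>U x\<bar>"])
      have "(\<lambda>i. ?q (X i) x) \<longlonglongrightarrow> pderiv_at \<eta> e (x + s *\<^sub>R e)" for x
        using q_lim[of x] X unfolding tendsto_at_iff_sequentially o_def by blast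
      then show "AE x in lborel. (\<lambda>i. U x * ?q (X i) x) \<longlonglongrightarrow> U x * pderiv_at \<eta> e (x + s *\<^sub>R e)"
        by (intro AE_I2 tendsto_mult tendsto_const)
      have "\<bar>U x * ?q (X i) x\<bar> \<le> B * \<bar>U x\<bar>" for i x
        using mult_left_mono[OF q_bound[of x "X i"], of "\<bar>U x\<bar>"] by (simp only: abs_mult mult.commute abs_ge_zero)
      then show "AE x in lborel. norm (U x * ?q (X i) x) \<le> B * \<bar>U x\<bar>" for i
        by (intro AE_I2) (simp only: real_norm_def)
    qed (use U in auto)
  qed
  then show ?thesis
    unfolding DERIV_def quot .
qed

text \<open>The weak form of \<open>\<bar>DU\<bar> \<le> M\<close>. Testing all unit directions, not
  only the basis, captures the Euclidean norm. The integral runs over the whole space so that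
  \<open>U\<close> can be translated; the test function confines it to
  \<open>\<Omega>\<close>.\<close>

definition grad_dominated :: "'a::euclidean_space set \<Rightarrow> ('a \<Rightarrow> real) \<Rightarrow> 'a measure \<Rightarrow> bool" where
  "grad_dominated \<Omega> U M \<longleftrightarrow> (\<forall>\<phi>\<in>test_functions \<Omega>. \<forall>e. norm e = 1 \<longrightarrow>
    \<bar>LINT x|lborel. U x * pderiv_at \<phi> e x\<bar> \<le> (LINT x|M. \<bar>\<phi> x\<bar>))"

lemma grad_dominatedD:
  "grad_dominated \<Omega> U M \<Longrightarrow> \<phi> \<in> test_functions \<Omega> \<Longrightarrow> norm e = 1 \<Longrightarrow>
    \<bar>LINT x|lborel. U x * pderiv_at \<phi> e x\<bar> \<le> (LINT x|M. \<bar>\<phi> x\<bar>)"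
  unfolding grad_dominated_def by blast

text \<open>The sign of \<open>W \<phi>\<close> is approximated by \<open>2 \<theta> - 1\<close> in \<open>L\<^sup>1\<close> of the measure \<open>\<bar>W \<phi>\<bar> dx\<close>.\<close>

lemma test_function_almost_attains_L1_norm:
  fixes W :: "'a::euclidean_space \<Rightarrow> real"
  assumes \<Omega>: "open \<Omega>" and W: "integrable lborel W" and \<phi>: "\<phi> \<in> test_functions \<Omega>" and "\<epsilon> > 0"
  obtains \<theta> where "\<And>k. Ck_function k \<theta>" "\<And>x. \<bar>\<theta> x\<bar> \<le> 1"
    "(LINT x|lborel. \<bar>W x * \<phi> x\<bar>) \<le> (LINT x|lborel. W x * (\<theta> x * \<phi> x)) + \<epsilon>"
proof -
  note [measurable] = test_function_borel[OF \<phi>] borel_measurable_integrable[OF W]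
  obtain C where C: "\<And>x. \<bar>\<phi> x\<bar> \<le> C"
    using test_function_bounded[OF \<phi>] by blast
  obtain K where K: "K \<subseteq> \<Omega>" "\<And>x. x \<notin> K \<Longrightarrow> \<phi> x = 0"
    by (rule test_function_support[OF \<phi>]) blast
  have int: "integrable lborel (\<lambda>x. W x * \<phi> x)"
    by (rule integrable_mult_bounded[OF W _ C]) simp
  have [measurable]: "\<Omega> \<in> sets borel" using \<Omega> by simp
  let ?w = "\<lambda>x. \<bar>W x * \<phi> x\<bar>"
  define \<kappa> where "\<kappa> = density (restrict_space lborel \<Omega>) (\<lambda>x. ennreal (?w x))"
  have w_meas: "(\<lambda>x. ?w x) \<in> borel_measurable (restrict_space lborel \<Omega>)"
    by (intro measurable_restrict_space1) simp
  have integral_\<kappa>: "(LINT x|\<kappa>. g x) = (LINT x|lborel. ?w x * g x)"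
    if [measurable]: "g \<in> borel_measurable borel" for g :: "'a \<Rightarrow> real"
  proof -
    have "g \<in> borel_measurable (restrict_space lborel \<Omega>)"
      by (intro measurable_restrict_space1) simp
    then have "(LINT x|\<kappa>. g x) = (LINT x|restrict_space lborel \<Omega>. ?w x * g x)"
      unfolding \<kappa>_def using w_meas by (subst integral_density) auto
    also have "\<dots> = (LINT x|lborel. indicator \<Omega> x *\<^sub>R (?w x * g x))"
      by (rule integral_restrict_space) simp
    also have "\<dots> = (LINT x|lborel. ?w x * g x)"
      using K by (intro Bochner_Integration.integral_cong) (auto simp: indicator_def)
    finally show ?thesis .
  qed
  have "emeasure \<kappa> (space \<kappa>) \<noteq> \<infinity>"
  proof -
    have "emeasure \<kappa> (space \<kappa>) = (\<integral>\<^sup>+x. ennreal (?w x) \<partial>restrict_space lborel \<Omega>)"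
      unfolding \<kappa>_def using w_meas sets.top[of "restrict_space lborel \<Omega>"]
      by (subst emeasure_density) (auto simp: space_restrict_space intro!: nn_integral_cong)
    also have "\<dots> \<le> (\<integral>\<^sup>+x. ennreal (?w x) \<partial>lborel)"
      by (subst nn_integral_restrict_space) (auto intro!: nn_integral_mono simp: indicator_def)
    also have "\<dots> < \<infinity>"
      using int by (simp add: integrable_iff_bounded)
    finally show ?thesis by simp
  qed
  then have "finite_measure \<kappa>" by (rule finite_measureI)
  moreover have "sets \<kappa> = sets (borel_on \<Omega>)"
    by (simp add: \<kappa>_def sets_restrict_space)
  ultimately interpret \<kappa>: finite_measure_on \<kappa> \<Omega>
    using \<Omega> by (intro finite_measure_on.intro finite_measure_on_axioms.intro)
  define E where "E = {x \<in> \<Omega>. W x * \<phi> x > 0}"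
  have [measurable]: "E \<in> sets borel" unfolding E_def by measurable
  then have "E \<in> sets \<kappa>"
    unfolding \<kappa>.sets_iff by (auto simp: E_def)
  then obtain \<theta> where \<theta>: "\<theta> \<in> test_functions \<Omega>" "\<And>x. 0 \<le> \<theta> x" "\<And>x. \<theta> x \<le> 1"
    "(LINT x|\<kappa>. \<bar>\<theta> x - indicator E x\<bar>) < \<epsilon> / 2"
    using \<kappa>.test_function_approx_indicator[of E "\<epsilon> / 2"] \<open>\<epsilon> > 0\<close> by (metis half_gt_zero)
  note [measurable] = test_function_borel[OF \<theta>(1)]
  have small: "(LINT x|lborel. ?w x * \<bar>\<theta> x - indicator E x\<bar>) < \<epsilon> / 2"
    using \<theta>(4) by (subst (asm) integral_\<kappa>) auto
  \<comment> \<open>On \<open>\<Omega>\<close> the sign is \<open>2 * indicator E x - 1\<close>, up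
    to points where the product vanishes, and the last term is the cost of replacing the indicator
    by \<open>\<theta>\<close>. Its factor 2 is paid for by the error
    \<open>\<epsilon> / 2\<close>.\<close>
  have pointwise: "?w x = W x * ((2 * \<theta> x - 1) * \<phi> x) + 2 * ((W x * \<phi> x) * (indicator E x - \<theta> x))" for x
  proof (cases "x \<in> \<Omega>")
    case True
    then show ?thesis
      by (cases "W x * \<phi> x > 0") (auto simp: E_def indicator_def algebra_simps)
  next
    case False
    then have "\<phi> x = 0" using K by auto
    then show ?thesis by simp
  qed
  have diff_bound: "\<bar>indicator E x - \<theta> x\<bar> \<le> 1" for x
    using \<theta>(2)[of x] \<theta>(3)[of x] by (auto simp: indicator_def)
  have \<theta>1: "\<bar>2 * \<theta> x - 1\<bar> \<le> 1" for x
    using \<theta>(2)[of x] \<theta>(3)[of x] by auto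
  have "integrable lborel (\<lambda>x. (W x * \<phi> x) * (2 * \<theta> x - 1))"
    by (rule integrable_mult_bounded[OF int _ \<theta>1]) simp
  then have i1: "integrable lborel (\<lambda>x. W x * ((2 * \<theta> x - 1) * \<phi> x))"
    by (simp only: ac_simps)
  have i2: "integrable lborel (\<lambda>x. (W x * \<phi> x) * (indicator E x - \<theta> x))"
    by (rule integrable_mult_bounded[OF int _ diff_bound]) simp
  have "(LINT x|lborel. ?w x) = (LINT x|lborel. W x * ((2 * \<theta> x - 1) * \<phi> x)
      + 2 * ((W x * \<phi> x) * (indicator E x - \<theta> x)))"
    by (intro Bochner_Integration.integral_cong refl pointwise)
  also have "\<dots> = (LINT x|lborel. W x * ((2 * \<theta> x - 1) * \<phi> x))
      + 2 * (LINT x|lborel. (W x * \<phi> x) * (indicator E x - \<theta> x))"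
    using i1 i2 by simp
  also have "(LINT x|lborel. (W x * \<phi> x) * (indicator E x - \<theta> x))
      \<le> (LINT x|lborel. \<bar>(W x * \<phi> x) * (indicator E x - \<theta> x)\<bar>)"
    using integral_abs_bound[of lborel "\<lambda>x. (W x * \<phi> x) * (indicator E x - \<theta> x)"] by linarith
  also have "\<dots> = (LINT x|lborel. ?w x * \<bar>\<theta> x - indicator E x\<bar>)"
    by (simp add: abs_mult abs_minus_commute)
  also note small
  finally have "(LINT x|lborel. ?w x) \<le> (LINT x|lborel. W x * ((2 * \<theta> x - 1) * \<phi> x)) + \<epsilon>"
    by simp
  then show thesis
    using \<theta>1 by (intro that[of "\<lambda>x. 2 * \<theta> x - 1"])
      (auto intro!: Ck_function_diff Ck_function_mult Ck_function_const test_function_Ck[OF \<theta>(1)])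
qed

text \<open>From signed to absolute values: with the sign imitated by \<open>\<theta>\<close>, the
  left side becomes an increment of the integral of \<open>U\<close> against translates of
  \<open>\<theta> * \<phi>\<close>. The mean value theorem turns it into a derivative at an
  intermediate shift, where domination applies and asks only for the size of the translated product,
  never for the derivative of \<open>\<theta>\<close>.\<close>

lemma (in finite_measure_on) integral_translate_diff_le:
  fixes U :: "'a \<Rightarrow> real"
  assumes U: "integrable lborel U" and dom: "grad_dominated \<Omega> U M"
    and \<phi>: "\<phi> \<in> test_functions \<Omega>" and e: "norm e = 1"
    and B: "\<And>x. \<bar>pderiv_at \<phi> e x\<bar> \<le> B" and "t > 0"
    and K: "compact K" "\<And>x s. x \<in> K \<Longrightarrow> 0 \<le> s \<Longrightarrow> s \<le> t \<Longrightarrow> x - s *\<^sub>R e \<in> \<Omega>" "\<And>x. x \<notin> K \<Longrightarrow> \<phi> x = 0"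
  shows "(LINT x|lborel. \<bar>(U (x - t *\<^sub>R e) - U x) * \<phi> x\<bar>)
    \<le> t * ((LINT x|M. \<bar>\<phi> x\<bar>) + B * t * measure M (space M))"
proof (rule field_le_epsilon)
  fix \<epsilon> :: real assume "\<epsilon> > 0"
  let ?W = "\<lambda>x. U (x - t *\<^sub>R e) - U x"
  note [measurable] = test_function_borel[OF \<phi>] borel_measurable_integrable[OF U]
  have U_shift: "integrable lborel (\<lambda>x. U (x - t *\<^sub>R e))"
    using integrable_lborel_translate[of U "- t *\<^sub>R e"] U by simp
  then have W: "integrable lborel ?W" using U by simp
  obtain \<theta> where \<theta>: "\<And>k. Ck_function k \<theta>" "\<And>x. \<bar>\<theta> x\<bar> \<le> 1"
    and le: "(LINT x|lborel. \<bar>?W x * \<phi> x\<bar>) \<le> (LINT x|lborel. ?W x * (\<theta> x * \<phi> x)) + \<epsilon>"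
    by (rule test_function_almost_attains_L1_norm[OF open_domain W \<phi> \<open>\<epsilon> > 0\<close>]) (rule that)
  let ?\<eta> = "\<lambda>x. \<theta> x * \<phi> x"
  have \<eta>: "?\<eta> \<in> test_functions \<Omega>"
    by (rule test_function_mult[OF \<phi> \<theta>(1)])
  note [measurable] = test_function_borel[OF \<eta>]
  have \<eta>_le: "\<bar>?\<eta> x\<bar> \<le> \<bar>\<phi> x\<bar>" for x
    using mult_right_mono[OF \<theta>(2)[of x], of "\<bar>\<phi> x\<bar>"] by (simp add: abs_mult)
  obtain C where C: "\<And>x. \<bar>?\<eta> x\<bar> \<le> C"
    using test_function_bounded[OF \<eta>] by blast
  let ?F = "\<lambda>s. LINT x|lborel. U x * ?\<eta> (x + s *\<^sub>R e)"
  have int: "integrable lborel (\<lambda>x. U x * ?\<eta> x)" "integrable lborel (\<lambda>x. U (x - t *\<^sub>R e) * ?\<eta> x)"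
    by (rule integrable_mult_bounded[OF U _ C] integrable_mult_bounded[OF U_shift _ C]; simp)+
  have "(LINT x|lborel. ?W x * ?\<eta> x) = (LINT x|lborel. U (x - t *\<^sub>R e) * ?\<eta> x) - (LINT x|lborel. U x * ?\<eta> x)"
    using int by (simp add: left_diff_distrib)
  also have "(LINT x|lborel. U (x - t *\<^sub>R e) * ?\<eta> x) = ?F t"
    using integral_lborel_translate[of "\<lambda>x. U (x - t *\<^sub>R e) * ?\<eta> x" "t *\<^sub>R e"] by simp
  finally have W_eq: "(LINT x|lborel. ?W x * ?\<eta> x) = ?F t - ?F 0" by simp
  obtain \<xi> where \<xi>: "0 < \<xi>" "\<xi> < t"
    and mvt: "?F t - ?F 0 = (t - 0) * (LINT x|lborel. U x * pderiv_at ?\<eta> e (x + \<xi> *\<^sub>R e))"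
    using MVT2[OF \<open>t > 0\<close> has_derivative_integral_translate[OF U \<eta>, of e]] by blast
  let ?\<eta>' = "\<lambda>x. ?\<eta> (x + \<xi> *\<^sub>R e)"
  \<comment> \<open>The intermediate shift lies between 0 and \<open>t\<close>, so the hypothesis on
    \<open>K\<close> keeps the translated support inside \<open>\<Omega>\<close>.\<close>
  have \<eta>': "?\<eta>' \<in> test_functions \<Omega>"
  proof (rule test_functionsI)
    show "Ck_function k ?\<eta>'" for k
      by (rule Ck_function_translate[OF test_function_Ck[OF \<eta>]])
    show "compact ((\<lambda>x. x - \<xi> *\<^sub>R e) ` K)"
      by (intro compact_continuous_image K continuous_intros)
    show "(\<lambda>x. x - \<xi> *\<^sub>R e) ` K \<subseteq> \<Omega>"
      using K(2) \<xi> by auto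
    show "?\<eta>' x = 0" if "x \<notin> (\<lambda>x. x - \<xi> *\<^sub>R e) ` K" for x
    proof -
      have "x + \<xi> *\<^sub>R e \<notin> K"
        using that by (metis add_diff_cancel_right' imageI)
      then show ?thesis using K(3) by simp
    qed
  qed
  have "(LINT x|lborel. U x * pderiv_at ?\<eta> e (x + \<xi> *\<^sub>R e)) = (LINT x|lborel. U x * pderiv_at ?\<eta>' e x)"
    by (simp only: pderiv_test_translate[OF \<eta>])
  also have "\<dots> \<le> (LINT x|M. \<bar>?\<eta>' x\<bar>)"
    using grad_dominatedD[OF dom \<eta>' e] by linarith
  also have "\<dots> \<le> (LINT x|M. \<bar>\<phi> x\<bar> + B * t)"
  proof (intro integral_mono)
    show "integrable M (\<lambda>x. \<bar>?\<eta>' x\<bar>)" "integrable M (\<lambda>x. \<bar>\<phi> x\<bar> + B * t)"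
      using test_function_integrable[OF \<eta>'] test_function_integrable[OF \<phi>] by auto
    fix x
    \<comment> \<open>\<open>\<theta>\<close> is discarded before the shift is undone. Thus
      \<open>B\<close> bounds a derivative of \<open>\<phi>\<close> alone and does not depend on
      \<open>\<epsilon>\<close>.\<close>
    have "\<bar>?\<eta>' x\<bar> \<le> \<bar>\<phi> (x + \<xi> *\<^sub>R e)\<bar>" by (rule \<eta>_le)
    also have "\<dots> \<le> \<bar>\<phi> x\<bar> + B * \<bar>\<xi>\<bar>"
      using test_function_diff_bound[OF \<phi> B, of x \<xi>] by linarith
    also have "B * \<bar>\<xi>\<bar> \<le> B * t"
      using \<xi> B[of x] by (intro mult_left_mono) auto
    finally show "\<bar>?\<eta>' x\<bar> \<le> \<bar>\<phi> x\<bar> + B * t" by simp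
  qed
  also have "\<dots> = (LINT x|M. \<bar>\<phi> x\<bar>) + B * t * measure M (space M)"
    using test_function_integrable[OF \<phi>] by simp
  finally have "?F t - ?F 0 \<le> t * ((LINT x|M. \<bar>\<phi> x\<bar>) + B * t * measure M (space M))"
    unfolding mvt using \<open>t > 0\<close> by simp
  then show "(LINT x|lborel. \<bar>?W x * \<phi> x\<bar>)
      \<le> t * ((LINT x|M. \<bar>\<phi> x\<bar>) + B * t * measure M (space M)) + \<epsilon>"
    using le unfolding W_eq by linarith
qed

text \<open>On the support of \<open>\<phi>\<close> and for small \<open>t\<close>, both
  \<open>x\<close> and \<open>x - t e\<close> lie in \<open>\<Omega>\<close>, where differences of
  \<open>V\<close> are bounded by those of \<open>U\<close>. Dividing the previous estimate by
  \<open>t\<close> and letting \<open>t\<close> decrease to 0 removes the error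
  \<open>B * t * measure M (space M)\<close>.\<close>

lemma (in finite_measure_on) grad_dominated_Lipschitz:
  fixes U V :: "'a \<Rightarrow> real"
  assumes U: "integrable lborel U" and V: "integrable lborel V"
    and lip: "\<And>a b. \<bar>p a - p b\<bar> \<le> \<bar>a - b\<bar>" and V_eq: "\<And>x. x \<in> \<Omega> \<Longrightarrow> V x = p (U x)"
    and dom: "grad_dominated \<Omega> U M"
  shows "grad_dominated \<Omega> V M"
  unfolding grad_dominated_def
proof (intro ballI allI impI)
  fix \<phi> and e :: 'a assume \<phi>: "\<phi> \<in> test_functions \<Omega>" and e: "norm e = 1"
  note [measurable] = test_function_borel[OF \<phi>] borel_measurable_integrable[OF U] borel_measurable_integrable[OF V]
  obtain K where K: "compact K" "K \<subseteq> \<Omega>" "\<And>x. x \<notin> K \<Longrightarrow> \<phi> x = 0"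
    by (rule test_function_support[OF \<phi>]) blast
  obtain \<delta> where "\<delta> > 0" and \<delta>: "(\<Union>x\<in>K. ball x \<delta>) \<subseteq> \<Omega>"
    using compact_subset_open_imp_ball_epsilon_subset[OF K(1) open_domain K(2)] by blast
  have shift: "x - s *\<^sub>R e \<in> \<Omega>" if "x \<in> K" "0 \<le> s" "s < \<delta>" for x s
  proof -
    have "x - s *\<^sub>R e \<in> ball x \<delta>" using that e by (simp add: dist_norm)
    then show ?thesis using \<delta> that(1) by blast
  qed
  obtain B where B: "\<And>x. \<bar>pderiv_at \<phi> e x\<bar> \<le> B"
    using pderiv_test_bounded[OF \<phi>] by blast
  obtain C where C: "\<And>x. \<bar>\<phi> x\<bar> \<le> C"
    using test_function_bounded[OF \<phi>] by blast
  let ?G = "\<lambda>s. LINT x|lborel. V x * \<phi> (x + s *\<^sub>R e)"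
  let ?bound = "\<lambda>t. (LINT x|M. \<bar>\<phi> x\<bar>) + B * t * measure M (space M)"
  have G_diff: "\<bar>(?G (0 + t) - ?G 0) / t\<bar> \<le> ?bound t" if t: "0 < t" "t < \<delta>" for t
  proof -
    have V_shift: "integrable lborel (\<lambda>x. V (x - t *\<^sub>R e))"
      using integrable_lborel_translate[of V "- t *\<^sub>R e"] V by simp
    have U_shift: "integrable lborel (\<lambda>x. U (x - t *\<^sub>R e))"
      using integrable_lborel_translate[of U "- t *\<^sub>R e"] U by simp
    have int: "integrable lborel (\<lambda>x. V x * \<phi> x)" "integrable lborel (\<lambda>x. V (x - t *\<^sub>R e) * \<phi> x)"
      by (rule integrable_mult_bounded[OF V _ C] integrable_mult_bounded[OF V_shift _ C]; simp)+
    have intW: "integrable lborel (\<lambda>x. (U (x - t *\<^sub>R e) - U x) * \<phi> x)"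
      by (rule integrable_mult_bounded[OF _ _ C]) (use U U_shift in simp_all)
    have "?G t = (LINT x|lborel. V (x - t *\<^sub>R e) * \<phi> x)"
      using integral_lborel_translate[of "\<lambda>x. V (x - t *\<^sub>R e) * \<phi> x" "t *\<^sub>R e"] by simp
    then have "?G t - ?G 0 = (LINT x|lborel. (V (x - t *\<^sub>R e) - V x) * \<phi> x)"
      using int by (simp add: left_diff_distrib)
    also have "\<bar>\<dots>\<bar> \<le> (LINT x|lborel. \<bar>(V (x - t *\<^sub>R e) - V x) * \<phi> x\<bar>)"
      by (rule integral_abs_bound)
    also have "\<dots> \<le> (LINT x|lborel. \<bar>(U (x - t *\<^sub>R e) - U x) * \<phi> x\<bar>)"
    proof (intro integral_mono)
      show "integrable lborel (\<lambda>x. \<bar>(V (x - t *\<^sub>R e) - V x) * \<phi> x\<bar>)"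
        using int by (simp add: left_diff_distrib)
      show "integrable lborel (\<lambda>x. \<bar>(U (x - t *\<^sub>R e) - U x) * \<phi> x\<bar>)"
        using intW by simp
      show "\<bar>(V (x - t *\<^sub>R e) - V x) * \<phi> x\<bar> \<le> \<bar>(U (x - t *\<^sub>R e) - U x) * \<phi> x\<bar>" for x
      proof (cases "x \<in> K")
        case True
        then have "x \<in> \<Omega>" "x - t *\<^sub>R e \<in> \<Omega>" using K(2) shift t by auto
        then show ?thesis
          using lip by (simp add: V_eq abs_mult mult_right_mono)
      qed (simp add: K(3))
    qed
    also have "\<dots> \<le> t * ?bound t"
      by (rule integral_translate_diff_le[OF U dom \<phi> e B t(1) K(1) _ K(3)]) (use shift t in auto)
    finally show ?thesis
      using t by (simp add: abs_divide divide_le_eq mult.commute)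
  qed
  have "((\<lambda>t. (?G (0 + t) - ?G 0) / t) \<longlongrightarrow> (LINT x|lborel. V x * pderiv_at \<phi> e (x + 0 *\<^sub>R e))) (at_right 0)"
    using has_derivative_integral_translate[OF V \<phi>, of e 0] unfolding DERIV_def
    by (rule filterlim_at_split[THEN iffD1, THEN conjunct2])
  then have lim: "((\<lambda>t. \<bar>(?G (0 + t) - ?G 0) / t\<bar>) \<longlongrightarrow> \<bar>LINT x|lborel. V x * pderiv_at \<phi> e x\<bar>) (at_right 0)"
    by (intro tendsto_rabs) simp
  have bound_lim: "(?bound \<longlongrightarrow> (LINT x|M. \<bar>\<phi> x\<bar>) + B * 0 * measure M (space M)) (at_right 0)"
    by (intro tendsto_intros)
  have "\<forall>\<^sub>F t in at_right 0. t < \<delta>"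
    using \<open>\<delta> > 0\<close> by (rule order_tendstoD[OF tendsto_ident_at])
  then have "\<forall>\<^sub>F t in at_right 0. \<bar>(?G (0 + t) - ?G 0) / t\<bar> \<le> ?bound t"
    using eventually_at_right_less[of 0] by eventually_elim (rule G_diff)
  from tendsto_le[OF _ bound_lim lim this]
  show "\<bar>LINT x|lborel. V x * pderiv_at \<phi> e x\<bar> \<le> (LINT x|M. \<bar>\<phi> x\<bar>)"
    by simp
qed

subsection \<open>Dominating measures and densities\<close>

text \<open>The index set will be \<open>bool\<close> for two given measures and
  \<open>Basis\<close> for the coordinates of a vector measure.\<close>

lemma sum_measure:
  fixes m :: "'i \<Rightarrow> 'a measure"
  assumes "finite I" "\<And>i. i \<in> I \<Longrightarrow> sets (m i) = sets N"
  obtains M where "sets M = sets N" "\<And>E. E \<in> sets N \<Longrightarrow> emeasure M E = (\<Sum>i\<in>I. emeasure (m i) E)"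
proof -
  let ?S = "\<lambda>E. \<Sum>i\<in>I. emeasure (m i) E"
  have "countably_additive (sets N) ?S"
  proof (rule countably_additiveI)
    fix A :: "nat \<Rightarrow> 'a set"
    assume A: "range A \<subseteq> sets N" "disjoint_family A" "(\<Union>i. A i) \<in> sets N"
    have "(\<Sum>n. ?S (A n)) = (\<Sum>i\<in>I. \<Sum>n. emeasure (m i) (A n))"
      by (rule suminf_sum) auto
    also have "\<dots> = ?S (\<Union>n. A n)"
      using A assms(2) by (intro sum.cong refl suminf_emeasure) auto
    finally show "(\<Sum>n. ?S (A n)) = ?S (\<Union>n. A n)" .
  qed
  moreover have "positive (sets N) ?S" by (simp add: positive_def)
  ultimately show thesis
    by (intro that[of "measure_of (space N) (sets N) ?S"] emeasure_measure_of_sigma)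
       (auto intro: sets.sigma_algebra_axioms)
qed

lemma finite_measure_sum:
  assumes "sets M = sets N" "\<And>E. E \<in> sets N \<Longrightarrow> emeasure M E = (\<Sum>i\<in>I. emeasure (m i) E)"
    and "finite I" "\<And>i. i \<in> I \<Longrightarrow> emeasure (m i) (space N) \<noteq> \<infinity>"
  shows "finite_measure M"
proof (rule finite_measureI)
  show "emeasure M (space M) \<noteq> \<infinity>"
    using assms sets_eq_imp_space_eq[OF assms(1)] by simp
qed

lemma signed_measure_dominated:
  fixes \<nu> :: "'a set \<Rightarrow> real"
  assumes \<nu>: "\<nu> \<in> vector_measures N"
  obtains M where "finite_measure M" "sets M = sets N" "\<And>E. E \<in> sets N \<Longrightarrow> ennreal \<bar>\<nu> E\<bar> \<le> emeasure M E"
proof -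
  let ?m = "\<lambda>b. upper_variation N (if b then \<nu> else (\<lambda>E. - \<nu> E))"
  obtain M where M: "sets M = sets N"
    and eM: "\<And>E. E \<in> sets N \<Longrightarrow> emeasure M E = (\<Sum>b\<in>UNIV. emeasure (?m b) E)"
    by (rule sum_measure[of UNIV ?m N]) (auto simp: that)
  have "finite_measure M"
    by (rule finite_measure_sum[OF M eM])
       (use finite_upper_variation[OF \<nu>] finite_upper_variation[OF vector_measure_uminus[OF \<nu>]] in auto)
  moreover have "ennreal \<bar>\<nu> E\<bar> \<le> emeasure M E" if E: "E \<in> sets N" for E
  proof -
    have "ennreal (\<nu> E) \<le> emeasure (?m True) E" "ennreal (- \<nu> E) \<le> emeasure (?m False) E"
      using E by (auto simp: emeasure_upper_variation[OF \<nu>] emeasure_upper_variation[OF vector_measure_uminus[OF \<nu>]]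
          intro!: SUP_upper2[of E])
    then have "ennreal (\<nu> E) + ennreal (- \<nu> E) \<le> emeasure M E"
      unfolding eM[OF E] UNIV_bool by (simp add: add_mono add.commute)
    moreover have "ennreal \<bar>\<nu> E\<bar> \<le> ennreal (\<nu> E) + ennreal (- \<nu> E)"
      by (cases "\<nu> E \<ge> 0") (auto simp: ennreal_neg)
    ultimately show ?thesis by (rule order_trans[rotated])
  qed
  ultimately show thesis using that M by blast
qed

text \<open>The Euclidean norm is at most the sum of the absolute coordinates. The resulting measure
  may be far larger than the variation; only its finiteness matters where it is used.\<close>

lemma vector_measure_dominated:
  fixes \<mu> :: "'a set \<Rightarrow> 'b::euclidean_space"
  assumes \<mu>: "\<mu> \<in> vector_measures N"
  obtains M where "finite_measure M" "sets M = sets N" "\<And>E. E \<in> sets N \<Longrightarrow> ennreal (norm (\<mu> E)) \<le> emeasure M E"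
proof -
  have "\<exists>M. finite_measure M \<and> sets M = sets N \<and> (\<forall>E\<in>sets N. ennreal \<bar>\<mu> E \<bullet> i\<bar> \<le> emeasure M E)" for i
    using signed_measure_dominated[OF vector_measure_inner[OF \<mu>, of i]] by metis
  then obtain m where m: "\<And>i. finite_measure (m i)" "\<And>i. sets (m i) = sets N"
    "\<And>i E. E \<in> sets N \<Longrightarrow> ennreal \<bar>\<mu> E \<bullet> i\<bar> \<le> emeasure (m i) E"
    by metis
  obtain M where M: "sets M = sets N"
    and eM: "\<And>E. E \<in> sets N \<Longrightarrow> emeasure M E = (\<Sum>i\<in>Basis. emeasure (m i) E)"
    by (rule sum_measure[of Basis m N]) (auto simp: m(2) that)
  have "finite_measure M"
    by (rule finite_measure_sum[OF M eM])
       (use finite_measure.emeasure_finite[OF m(1)] in auto)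
  moreover have "ennreal (norm (\<mu> E)) \<le> emeasure M E" if E: "E \<in> sets N" for E
  proof -
    have "ennreal (norm (\<mu> E)) \<le> ennreal (\<Sum>i\<in>Basis. \<bar>\<mu> E \<bullet> i\<bar>)"
      by (intro ennreal_leI norm_le_l1)
    also have "\<dots> = (\<Sum>i\<in>Basis. ennreal \<bar>\<mu> E \<bullet> i\<bar>)"
      by (rule sum_ennreal[symmetric]) simp
    also have "\<dots> \<le> emeasure M E"
      unfolding eM[OF E] by (intro sum_mono m(3) E)
    finally show ?thesis .
  qed
  ultimately show thesis using that M by blast
qed

section \<open>Radon-Nikodym densities and the set functions they weight\<close>

lemma (in finite_measure) exists_density_le_1:
  assumes N: "sets N = sets M" and le: "\<And>E. E \<in> sets M \<Longrightarrow> emeasure N E \<le> emeasure M E"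
  obtains r :: "'a \<Rightarrow> real" where "integrable M r" "AE x in M. 0 \<le> r x \<and> r x \<le> 1"
    "\<And>E. E \<in> sets M \<Longrightarrow> (LINT x|M. r x * indicator E x) = measure N E"
proof -
  have sp: "space N = space M" by (rule sets_eq_imp_space_eq[OF N])
  interpret N: finite_measure N
  proof (rule finite_measureI)
    have "emeasure N (space N) \<le> emeasure M (space M)" using le[of "space M"] sp by simp
    then show "emeasure N (space N) \<noteq> \<infinity>"
      using emeasure_finite[of "space M"] by (metis infinity_ennreal_def top_unique)
  qed
  have "absolutely_continuous M N"
    unfolding absolutely_continuous_def using le N by (auto simp: null_sets_def) (metis le_zero_eq)
  then obtain f where f[measurable]: "f \<in> borel_measurable M" and d: "density M f = N"
    using Radon_Nikodym_finite_measure[OF N.finite_measure_axioms N] by auto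
  define r where "r x = enn2real (f x)" for x
  have [measurable]: "r \<in> borel_measurable M" unfolding r_def by measurable
  have eN: "emeasure N E = (\<integral>\<^sup>+x. f x * indicator E x \<partial>M)" if "E \<in> sets M" for E
    using emeasure_density[OF f that] d by simp
  have "(\<integral>\<^sup>+x. f x \<partial>M) \<noteq> \<infinity>"
    using eN[OF sets.top] N.emeasure_finite[of "space M"] by (simp cong: nn_integral_cong)
  then have "AE x in M. f x \<noteq> \<infinity>" by (rule nn_integral_PInf_AE[OF f])
  then have fr: "AE x in M. f x = ennreal (r x)"
    by (auto simp: r_def less_top elim!: eventually_mono)
  have nn: "(\<integral>\<^sup>+x. ennreal (r x * indicator E x) \<partial>M) = emeasure N E" if "E \<in> sets M" for E
    unfolding eN[OF that] using fr
    by (intro nn_integral_cong_AE) (auto simp: indicator_def elim!: eventually_mono)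
  have r0: "0 \<le> r x" for x by (simp add: r_def)
  have int: "integrable M (\<lambda>x. r x * indicator E x)" if "E \<in> sets M" for E
    using nn[OF that] N.emeasure_finite[of E] r0 that
    by (intro integrableI_nonneg) (auto simp: less_top[symmetric])
  have I: "(LINT x|M. r x * indicator E x) = measure N E" if "E \<in> sets M" for E
    using nn[OF that] r0 that by (subst integral_eq_nn_integral) (auto simp: measure_def)
  have intr: "integrable M r"
    using int[OF sets.top] by (subst Bochner_Integration.integrable_cong[OF refl, of _ _ "\<lambda>x. r x * indicator (space M) x"]) auto
  \<comment> \<open>On \<open>E\<close> the function \<open>r - 1\<close> is positive, yet its
    integral is \<open>measure N E - measure M E\<close>, which is at most 0. Hence \<open>E\<close>
    is a null set.\<close>
  define E where "E = {x \<in> space M. r x > 1}"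
  have E[measurable]: "E \<in> sets M" unfolding E_def by measurable
  let ?h = "\<lambda>x. r x * indicator E x - indicator E x"
  have h: "integrable M ?h" "AE x in M. 0 \<le> ?h x"
    using int[OF E] integrable_indicator_finite[OF E]
    by (rule Bochner_Integration.integrable_diff) (simp add: E_def indicator_def)
  have "(LINT x|M. ?h x) = measure N E - measure M E"
    using int[OF E] integrable_indicator_finite[OF E] I[OF E] sets.sets_into_space[OF E]
    by (simp add: Int_absorb2)
  also have "\<dots> \<le> 0"
    using le[OF E] by (simp add: emeasure_eq_measure N.emeasure_eq_measure)
  finally have "(LINT x|M. ?h x) = 0"
    using integral_nonneg_AE[OF h(2)] by linarith
  then have "AE x in M. ?h x = 0"
    using integral_nonneg_eq_0_iff_AE[OF h] by simp
  then have "AE x in M. 0 \<le> r x \<and> r x \<le> 1"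
    using AE_space by eventually_elim (auto simp: E_def indicator_def r0 split: if_splits)
  then show thesis
    using that intr I by blast
qed

text \<open>Dominated convergence with majorant \<open>\<bar>r\<bar>\<close> makes the weighted
  indicators of partial unions converge in L1. The constant weight 1 yields the gradient, the
  density of \<gamma> the competitor.\<close>

lemma L1_bounded_vector_measure:
  assumes T: "L1_bounded M T" and r: "integrable M r"
  shows "(\<lambda>E. T (\<lambda>x. r x * indicator E x)) \<in> vector_measures M"
  unfolding vector_measures_def
proof (intro CollectI allI impI)
  fix A :: "nat \<Rightarrow> 'a set" assume A: "range A \<subseteq> sets M" "disjoint_family A"
  let ?f = "\<lambda>E x. r x * indicator E x"
  have int: "integrable M (?f E)" if "E \<in> sets M" for E
    using integrable_real_mult_indicator[OF that r] by (simp add: mult.commute)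
  let ?U = "\<Union>n. A n" and ?V = "\<lambda>n. \<Union>i<n. A i"
  have [measurable]: "?U \<in> sets M" "?V n \<in> sets M" for n using A by auto
  have [measurable]: "r \<in> borel_measurable M" using r by auto
  have partial: "(\<Sum>i<n. T (?f (A i))) = T (?f (?V n))" for n
  proof -
    have "(\<Sum>i<n. T (?f (A i))) = T (\<lambda>x. \<Sum>i<n. ?f (A i) x)"
      using A int by (intro L1_bounded_sum[OF T, symmetric]) auto
    also have "(\<lambda>x. \<Sum>i<n. ?f (A i) x) = ?f (?V n)"
    proof
      have "disjoint_family_on A {..<n}"
        using A(2) by (rule disjoint_family_on_mono[rotated]) simp
      then show "(\<Sum>i<n. ?f (A i) x) = ?f (?V n) x" for x
        by (simp add: sum_distrib_left[symmetric] indicator_UN_disjoint)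
    qed
    finally show ?thesis .
  qed
  have "(\<lambda>n. LINT x|M. \<bar>?f (?V n) x - ?f ?U x\<bar>) \<longlonglongrightarrow> (LINT x|M. 0)"
  proof (rule integral_dominated_convergence[where w = "\<lambda>x. \<bar>r x\<bar>"])
    show "AE x in M. norm \<bar>?f (?V n) x - ?f ?U x\<bar> \<le> \<bar>r x\<bar>" for n
      by (auto simp: indicator_def)
    have "(\<lambda>n. ?f (?V n) x) \<longlonglongrightarrow> ?f ?U x" for x
      by (intro tendsto_mult tendsto_const LIMSEQ_indicator_UN)
    then show "AE x in M. (\<lambda>n. \<bar>?f (?V n) x - ?f ?U x\<bar>) \<longlonglongrightarrow> 0"
      by (auto intro!: tendsto_rabs_zero LIM_zero)
  qed (use r in auto)
  then have lim: "(\<lambda>n. LINT x|M. \<bar>?f (?V n) x - ?f ?U x\<bar>) \<longlonglongrightarrow> 0" by simp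
  obtain C where C: "\<And>f. integrable M f \<Longrightarrow> norm (T f) \<le> C * (LINT x|M. \<bar>f x\<bar>)"
    using L1_bounded_bound[OF T] by blast
  have "(\<lambda>n. T (?f (?V n)) - T (?f ?U)) \<longlonglongrightarrow> 0"
  proof (rule Lim_null_comparison)
    have "norm (T (?f (?V n)) - T (?f ?U)) \<le> C * (LINT x|M. \<bar>?f (?V n) x - ?f ?U x\<bar>)" for n
      using C[of "\<lambda>x. ?f (?V n) x - ?f ?U x"] L1_bounded_diff[OF T int[of "?V n"] int[of ?U]]
        int[of "?V n"] int[of ?U] by simp
    then show "\<forall>\<^sub>F n in sequentially. norm (T (?f (?V n)) - T (?f ?U))
        \<le> C * (LINT x|M. \<bar>?f (?V n) x - ?f ?U x\<bar>)"
      by (intro always_eventually allI)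
    show "(\<lambda>n. C * (LINT x|M. \<bar>?f (?V n) x - ?f ?U x\<bar>)) \<longlonglongrightarrow> 0"
      using tendsto_mult_left[OF lim, of C] by simp
  qed
  then show "(\<lambda>n. T (?f (A n))) sums T (?f ?U)"
    unfolding sums_def partial by (simp add: LIM_zero_iff)
qed

lemma (in finite_measure_on) L1_bounded_eqI_test_functions:
  assumes T: "L1_bounded M T" and S: "L1_bounded M S"
    and eq: "\<And>\<phi>. \<phi> \<in> test_functions \<Omega> \<Longrightarrow> T \<phi> = S \<phi>" and f: "integrable M f"
  shows "T f = S f"
proof -
  obtain C D where "C \<ge> 0" and C: "\<And>f. integrable M f \<Longrightarrow> norm (T f) \<le> C * (LINT x|M. \<bar>f x\<bar>)"
    and "D \<ge> 0" and D: "\<And>f. integrable M f \<Longrightarrow> norm (S f) \<le> D * (LINT x|M. \<bar>f x\<bar>)"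
    using L1_bounded_bound[OF T] L1_bounded_bound[OF S] by metis
  have "norm (T f - S f) \<le> 0"
  proof (rule field_le_epsilon)
    fix e :: real assume "e > 0"
    \<comment> \<open>The added 1 covers the case where both constants are 0.\<close>
    then have "e / (C + D + 1) > 0" using \<open>C \<ge> 0\<close> \<open>D \<ge> 0\<close> by simp
    then obtain \<phi> where \<phi>: "\<phi> \<in> test_functions \<Omega>" "(LINT x|M. \<bar>\<phi> x - f x\<bar>) < e / (C + D + 1)"
      using test_function_approx[OF f] by blast
    note int = test_function_integrable[OF \<phi>(1)]
    let ?d = "LINT x|M. \<bar>\<phi> x - f x\<bar>"
    have "T f - S f = S (\<lambda>x. \<phi> x - f x) - T (\<lambda>x. \<phi> x - f x)"
      using L1_bounded_diff[OF T int f] L1_bounded_diff[OF S int f] eq[OF \<phi>(1)] by simp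
    also have "norm \<dots> \<le> norm (S (\<lambda>x. \<phi> x - f x)) + norm (T (\<lambda>x. \<phi> x - f x))"
      by (rule norm_triangle_ineq4)
    also have "\<dots> \<le> D * ?d + C * ?d"
      using int f by (intro add_mono C D) auto
    also have "\<dots> \<le> (C + D + 1) * ?d"
      by (simp add: algebra_simps)
    also have "\<dots> \<le> e"
      using \<phi>(2) \<open>C \<ge> 0\<close> \<open>D \<ge> 0\<close> by (simp add: less_divide_eq mult.commute)
    finally show "norm (T f - S f) \<le> 0 + e" by simp
  qed
  then show ?thesis by simp
qed

subsection \<open>Borel representatives\<close>

text \<open>Functions on \<open>\<Omega>\<close> are only Lebesgue measurable, while the translation
  argument works with integrable functions over \<open>lborel\<close>; a Borel representative
  bridges the two.\<close>

lemma lebesgue_on_borel_representative: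
  fixes u :: "'a::euclidean_space \<Rightarrow> real"
  assumes \<Omega>: "open \<Omega>" and u: "u \<in> borel_measurable (lebesgue_on \<Omega>)"
  obtains U where "U \<in> borel_measurable borel" "AE x in lebesgue_on \<Omega>. u x = U x"
proof -
  have "(\<lambda>x. if x \<in> \<Omega> then u x else 0) \<in> borel_measurable lebesgue"
    using u \<Omega> by (subst borel_measurable_if) auto
  then obtain U where U: "U \<in> borel_measurable lborel" "AE x in lborel. (if x \<in> \<Omega> then u x else 0) = U x"
    using completion_ex_borel_measurable_real by blast
  then have "AE x in lebesgue. (if x \<in> \<Omega> then u x else 0) = U x"
    by (simp add: AE_completion)
  then have "AE x in lebesgue. x \<in> \<Omega> \<longrightarrow> u x = U x"
    by eventually_elim auto
  then show thesis
    using that U(1) \<Omega> by (subst (asm) AE_restrict_space_iff[symmetric]) auto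
qed

text \<open>The factor \<open>indicator \<Omega> x\<close> extends the representative by zero, which
  turns integrals over \<open>\<Omega>\<close> into integrals over the whole space.\<close>

lemma lebesgue_on_borel_representative_integral:
  fixes u U \<psi> :: "'a::euclidean_space \<Rightarrow> real"
  assumes \<Omega>: "open \<Omega>" and u: "u \<in> borel_measurable (lebesgue_on \<Omega>)"
    and U: "U \<in> borel_measurable borel" "AE x in lebesgue_on \<Omega>. u x = U x"
    and \<psi>: "\<psi> \<in> borel_measurable borel"
  shows "(LINT x|lebesgue_on \<Omega>. u x * \<psi> x) = (LINT x|lborel. (indicator \<Omega> x * U x) * \<psi> x)"
    and "integrable (lebesgue_on \<Omega>) u \<Longrightarrow> integrable lborel (\<lambda>x. indicator \<Omega> x * U x)"
proof -
  have [measurable]: "U \<in> borel_measurable borel" "\<psi> \<in> borel_measurable borel" "\<Omega> \<in> sets borel"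
    using U \<psi> \<Omega> by auto
  have m: "g \<in> borel_measurable (lebesgue_on \<Omega>)" if "g \<in> borel_measurable borel" for g :: "'a \<Rightarrow> real"
    using that by (intro measurable_restrict_space1 measurable_completion) simp
  note [measurable] = u m[OF U(1)] m[OF \<psi>]
  have "(LINT x|lebesgue_on \<Omega>. u x * \<psi> x) = (LINT x|lebesgue_on \<Omega>. U x * \<psi> x)"
    using U(2) by (intro integral_cong_AE) auto
  also have "\<dots> = (LINT x|lebesgue. indicator \<Omega> x *\<^sub>R (U x * \<psi> x))"
    using \<Omega> by (intro integral_restrict_space) auto
  also have "\<dots> = (LINT x|lborel. indicator \<Omega> x *\<^sub>R (U x * \<psi> x))"
    by (rule integral_completion) simp
  finally show "(LINT x|lebesgue_on \<Omega>. u x * \<psi> x) = (LINT x|lborel. (indicator \<Omega> x * U x) * \<psi> x)"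
    by (simp add: mult.assoc)
  assume "integrable (lebesgue_on \<Omega>) u"
  then have "integrable (lebesgue_on \<Omega>) U"
    using U(2) by (subst integrable_cong_AE[of _ _ u]) auto
  then have "integrable lebesgue (\<lambda>x. indicator \<Omega> x *\<^sub>R U x)"
    using \<Omega> by (subst (asm) integrable_restrict_space) auto
  then show "integrable lborel (\<lambda>x. indicator \<Omega> x * U x)"
    by (subst (asm) integrable_completion) auto
qed

subsection \<open>The gradient of a Lipschitz function of \<open>u\<close>\<close>

lemma vector_measures_cong: "sets M = sets N \<Longrightarrow> vector_measures M = vector_measures N"
  by (simp add: vector_measures_def)

context finite_measure_on
begin

text \<open>Weighting the coordinate identities by \<open>e \<bullet> i\<close> gives minus the
  inner product of \<open>e\<close> with the vector integral of \<open>\<phi>\<close>.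
  Cauchy-Schwarz and the dimension-free bound on that integral then give the constant 1.\<close>

lemma grad_dominated_if_distr_gradient:
  assumes \<mu>: "has_distr_gradient \<Omega> u \<mu>"
    and le: "\<And>E. E \<in> sets (borel_on \<Omega>) \<Longrightarrow> ennreal (norm (\<mu> E)) \<le> emeasure M E"
    and U: "integrable lborel U"
    and rep: "\<And>\<psi>. \<psi> \<in> borel_measurable borel \<Longrightarrow> (LINT x|lebesgue_on \<Omega>. u x * \<psi> x) = (LINT x|lborel. U x * \<psi> x)"
  shows "grad_dominated \<Omega> U M"
  unfolding grad_dominated_def
proof (intro ballI allI impI)
  fix \<phi> and e :: 'a assume \<phi>: "\<phi> \<in> test_functions \<Omega>" and e: "norm e = 1"
  let ?J = "vector_integral (borel_on \<Omega>) \<mu>"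
  have vm: "\<mu> \<in> vector_measures (borel_on \<Omega>)" using \<mu> by (simp add: has_distr_gradient_def)
  have int: "integrable lborel (\<lambda>x. U x * pderiv_at \<phi> i x)" for i
  proof -
    obtain B where "\<And>x. \<bar>pderiv_at \<phi> i x\<bar> \<le> B"
      using pderiv_test_bounded[OF \<phi>] by blast
    then show ?thesis
      using pderiv_test_borel[OF \<phi>] by (intro integrable_mult_bounded[OF U]) auto
  qed
  have part: "(LINT x|lborel. U x * pderiv_at \<phi> i x) = - (?J \<phi> \<bullet> i)" if "i \<in> Basis" for i
    using \<mu> \<phi> that rep[OF pderiv_test_borel[OF \<phi>], of i]
    by (simp add: has_distr_gradient_def vector_integral_inner)
  have "(LINT x|lborel. U x * pderiv_at \<phi> e x)
      = (LINT x|lborel. (\<Sum>i\<in>Basis. (e \<bullet> i) * (U x * pderiv_at \<phi> i x)))"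
    by (intro Bochner_Integration.integral_cong refl)
       (simp only: pderiv_test_sum[OF \<phi>, where e = e] sum_distrib_left mult.left_commute)
  also have "\<dots> = (\<Sum>i\<in>Basis. (e \<bullet> i) * (LINT x|lborel. U x * pderiv_at \<phi> i x))"
    using int by (subst Bochner_Integration.integral_sum) auto
  also have "\<dots> = - (\<Sum>i\<in>Basis. (e \<bullet> i) * (?J \<phi> \<bullet> i))"
    by (simp add: part sum_negf)
  also have "(\<Sum>i\<in>Basis. (e \<bullet> i) * (?J \<phi> \<bullet> i)) = e \<bullet> ?J \<phi>"
    by (rule euclidean_inner[symmetric])
  finally have "\<bar>LINT x|lborel. U x * pderiv_at \<phi> e x\<bar> \<le> norm (?J \<phi>)"
    using Cauchy_Schwarz_ineq2[of e "?J \<phi>"] e by simp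
  also have "\<dots> \<le> (LINT x|M. \<bar>\<phi> x\<bar>)"
    by (rule norm_vector_integral_le[OF finite_measure_axioms vm sets_eq le test_function_integrable[OF \<phi>]])
  finally show "\<bar>LINT x|lborel. U x * pderiv_at \<phi> e x\<bar> \<le> (LINT x|M. \<bar>\<phi> x\<bar>)" .
qed

text \<open>A converse that returns the operator \<open>T\<close> along with the gradient, since
  \<open>T\<close> will later be applied to indicators weighted by a density.\<close>

lemma distr_gradient_if_grad_dominated:
  assumes dom: "grad_dominated \<Omega> V M" and V: "integrable lborel V"
    and rep: "\<And>\<psi>. \<psi> \<in> borel_measurable borel \<Longrightarrow> (LINT x|lebesgue_on \<Omega>. v x * \<psi> x) = (LINT x|lborel. V x * \<psi> x)"
  obtains T where "L1_bounded M T" "\<And>f. integrable M f \<Longrightarrow> norm (T f) \<le> (LINT x|M. \<bar>f x\<bar>)"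
    "has_distr_gradient \<Omega> v (\<lambda>E. T (indicator E))"
proof -
  define L where "L \<phi> = - (\<Sum>i\<in>Basis. (LINT x|lborel. V x * pderiv_at \<phi> i x) *\<^sub>R i)" for \<phi> :: "'a \<Rightarrow> real"
  have L_inner: "L \<phi> \<bullet> i = - (LINT x|lborel. V x * pderiv_at \<phi> i x)" if "i \<in> Basis" for \<phi> i
    using that by (simp add: L_def)
  have int: "integrable lborel (\<lambda>x. V x * pderiv_at \<phi> i x)" if \<phi>: "\<phi> \<in> test_functions \<Omega>" for \<phi> i
  proof -
    obtain B where "\<And>x. \<bar>pderiv_at \<phi> i x\<bar> \<le> B"
      using pderiv_test_bounded[OF \<phi>] by blast
    then show ?thesis
      using pderiv_test_borel[OF \<phi>] by (intro integrable_mult_bounded[OF V]) auto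
  qed
  obtain T where T: "L1_bounded M T" "\<And>f. integrable M f \<Longrightarrow> norm (T f) \<le> (LINT x|M. \<bar>f x\<bar>)"
    and TL: "\<And>\<phi>. \<phi> \<in> test_functions \<Omega> \<Longrightarrow> T \<phi> = L \<phi>"
  proof (rule L1_extension[of L])
    fix \<phi> assume \<phi>: "\<phi> \<in> test_functions \<Omega>"
    show "L (\<lambda>x. c * \<phi> x) = c *\<^sub>R L \<phi>" for c
      using int[OF \<phi>]
      by (simp add: L_def pderiv_test_cmult[OF \<phi>] mult.left_commute[of _ c] scaleR_sum_right)
    show "L (\<lambda>x. \<phi> x + \<psi> x) = L \<phi> + L \<psi>" if \<psi>: "\<psi> \<in> test_functions \<Omega>" for \<psi>
      using int[OF \<phi>] int[OF \<psi>]
      by (simp add: L_def pderiv_test_add[OF \<phi> \<psi>] distrib_left scaleR_add_left sum.distrib)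
    show "norm (L \<phi>) \<le> (LINT x|M. \<bar>\<phi> x\<bar>)"
    proof (cases "L \<phi> = 0")
      case False
      \<comment> \<open>In its own direction a vector is measured by its full norm, so the
        directional bounds add up to a bound on the norm without loss.\<close>
      define e where "e = L \<phi> /\<^sub>R norm (L \<phi>)"
      have e: "norm e = 1" using False by (simp add: e_def)
      have "norm (L \<phi>) = L \<phi> \<bullet> e"
        using False by (simp add: e_def power2_norm_eq_inner[symmetric] power2_eq_square)
      also have "\<dots> = (\<Sum>i\<in>Basis. (L \<phi> \<bullet> i) * (e \<bullet> i))"
        by (rule euclidean_inner)
      also have "\<dots> = - (\<Sum>i\<in>Basis. (e \<bullet> i) * (LINT x|lborel. V x * pderiv_at \<phi> i x))"
        by (simp add: L_inner sum_negf mult.commute)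
      also have "(\<Sum>i\<in>Basis. (e \<bullet> i) * (LINT x|lborel. V x * pderiv_at \<phi> i x))
          = (LINT x|lborel. (\<Sum>i\<in>Basis. (e \<bullet> i) * (V x * pderiv_at \<phi> i x)))"
        using int[OF \<phi>] by (subst Bochner_Integration.integral_sum) auto
      also have "\<dots> = (LINT x|lborel. V x * pderiv_at \<phi> e x)"
        by (intro Bochner_Integration.integral_cong refl)
           (simp only: pderiv_test_sum[OF \<phi>, where e = e] sum_distrib_left mult.left_commute)
      finally show ?thesis
        using grad_dominatedD[OF dom \<phi> e] by linarith
    qed simp
  qed (rule that)
  let ?\<nu> = "\<lambda>E. T (indicator E)"
  have vm: "?\<nu> \<in> vector_measures (borel_on \<Omega>)"
    using L1_bounded_vector_measure[OF T(1), of "\<lambda>x. 1"]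
    unfolding vector_measures_cong[OF sets_eq] by simp
  have le: "ennreal (norm (?\<nu> E)) \<le> emeasure M E" if "E \<in> sets (borel_on \<Omega>)" for E
  proof -
    have E: "E \<in> sets M" using that by (simp add: sets_eq)
    have "norm (?\<nu> E) \<le> (LINT x|M. \<bar>indicator E x\<bar>)"
      by (rule T(2)[OF integrable_indicator_finite[OF E]])
    also have "\<dots> = measure M E"
      using sets.sets_into_space[OF E] by (simp add: Int_absorb2)
    finally show ?thesis by (simp add: emeasure_eq_measure)
  qed
  \<comment> \<open>Both sides agree on indicators, hence on all integrable functions. This turns
    the abstract identity for \<open>T\<close> on test functions into the signed integrals of the
    definition.\<close>
  have J: "vector_integral (borel_on \<Omega>) ?\<nu> f = T f" if "integrable M f" for f
    by (rule L1_bounded_eqI[OF L1_bounded_vector_integral[OF vm sets_eq le] T(1) _ that])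
       (simp_all add: vector_integral_indicator[OF vm] sets_eq)
  have "has_distr_gradient \<Omega> v ?\<nu>"
    unfolding has_distr_gradient_def
  proof (intro conjI ballI vm)
    fix \<phi> and i :: 'a assume \<phi>: "\<phi> \<in> test_functions \<Omega>" and i: "i \<in> Basis"
    have "signed_integral (borel_on \<Omega>) (\<lambda>E. ?\<nu> E \<bullet> i) \<phi> = T \<phi> \<bullet> i"
      unfolding vector_integral_inner[OF i, symmetric] J[OF test_function_integrable[OF \<phi>]] ..
    also have "\<dots> = - (LINT x|lebesgue_on \<Omega>. v x * pderiv_at \<phi> i x)"
      by (simp add: TL[OF \<phi>] L_inner[OF i] rep[OF pderiv_test_borel[OF \<phi>]])
    finally show "(LINT x|lebesgue_on \<Omega>. v x * pderiv_at \<phi> i x)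
        = - signed_integral (borel_on \<Omega>) (\<lambda>E. ?\<nu> E \<bullet> i) \<phi>" by simp
  qed
  then show thesis using that T by blast
qed

end

text \<open>Needed because \<open>distr_gradient\<close> is an arbitrary choice, which must be
  identified with the gradient constructed by extension. A single \<open>M\<close> dominating both
  measures makes both integrals continuous on the same L1 space, where test functions are
  dense.\<close>

lemma distr_gradient_unique:
  assumes \<Omega>: "open \<Omega>" and \<mu>: "has_distr_gradient \<Omega> u \<mu>" and \<nu>: "has_distr_gradient \<Omega> u \<nu>"
    and E: "E \<in> sets (borel_on \<Omega>)"
  shows "\<mu> E = \<nu> E"
proof -
  have vm: "\<mu> \<in> vector_measures (borel_on \<Omega>)" "\<nu> \<in> vector_measures (borel_on \<Omega>)"
    using \<mu> \<nu> by (simp_all add: has_distr_gradient_def)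
  obtain m where m: "finite_measure m" "sets m = sets (borel_on \<Omega>)"
    "\<And>E. E \<in> sets (borel_on \<Omega>) \<Longrightarrow> ennreal (norm (\<mu> E)) \<le> emeasure m E"
    by (rule vector_measure_dominated[OF vm(1)]) (rule that)
  obtain n where n: "finite_measure n" "sets n = sets (borel_on \<Omega>)"
    "\<And>E. E \<in> sets (borel_on \<Omega>) \<Longrightarrow> ennreal (norm (\<nu> E)) \<le> emeasure n E"
    by (rule vector_measure_dominated[OF vm(2)]) (rule that)
  let ?mn = "\<lambda>b. if b then m else n"
  obtain M where M: "sets M = sets (borel_on \<Omega>)"
    "\<And>E. E \<in> sets (borel_on \<Omega>) \<Longrightarrow> emeasure M E = (\<Sum>b\<in>UNIV. emeasure (?mn b) E)"
    by (rule sum_measure[of UNIV ?mn "borel_on \<Omega>"]) (auto simp: m n intro: that)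
  have "finite_measure M"
    by (rule finite_measure_sum[OF M])
       (use finite_measure.emeasure_finite[OF m(1)] finite_measure.emeasure_finite[OF n(1)] in auto)
  then interpret finite_measure_on M \<Omega>
    using \<Omega> M(1) by (intro finite_measure_on.intro finite_measure_on_axioms.intro)
  have le: "ennreal (norm (\<mu> E)) \<le> emeasure M E" "ennreal (norm (\<nu> E)) \<le> emeasure M E"
    if "E \<in> sets (borel_on \<Omega>)" for E
    using m(3)[OF that] n(3)[OF that] M(2)[OF that]
    by (auto simp: UNIV_bool intro: add_increasing add_increasing2)
  have "vector_integral (borel_on \<Omega>) \<mu> (indicator E) = vector_integral (borel_on \<Omega>) \<nu> (indicator E)"
  proof (rule L1_bounded_eqI_test_functions)
    fix \<phi> assume "\<phi> \<in> test_functions \<Omega>"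
    then have "signed_integral (borel_on \<Omega>) (\<lambda>E. \<mu> E \<bullet> i) \<phi> = signed_integral (borel_on \<Omega>) (\<lambda>E. \<nu> E \<bullet> i) \<phi>"
      if "i \<in> Basis" for i
      using \<mu> \<nu> that unfolding has_distr_gradient_def by (metis neg_equal_iff_equal)
    then show "vector_integral (borel_on \<Omega>) \<mu> \<phi> = vector_integral (borel_on \<Omega>) \<nu> \<phi>"
      by (simp add: vector_integral_def)
  qed (use E in \<open>auto intro!: L1_bounded_vector_integral vm le integrable_indicator_finite simp: sets_eq\<close>)
  then show ?thesis
    by (simp add: vector_integral_indicator vm E)
qed

lemma has_distr_gradient_distr_gradient:
  assumes "distr_gradient_is_measure \<Omega> u"
  shows "has_distr_gradient \<Omega> u (distr_gradient \<Omega> u)"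
proof -
  obtain \<mu> where "has_distr_gradient \<Omega> u \<mu>"
    using assms by (auto simp: distr_gradient_is_measure_def)
  then show ?thesis
    unfolding distr_gradient_def by (rule someI[of "has_distr_gradient \<Omega> u"])
qed

text \<open>The competitor \<open>g = 0\<close> is admissible. Finiteness will let a strict decrease
  of the quadratic term give a strict decrease of the energy in \<open>ennreal\<close>.\<close>

lemma TV_pwL_finite:
  assumes "distr_gradient_is_measure \<Omega> u"
  shows "TV_pwL \<Omega> \<gamma> u < \<infinity>"
proof -
  let ?\<mu> = "distr_gradient \<Omega> u"
  have vm: "?\<mu> \<in> vector_measures (borel_on \<Omega>)"
    using has_distr_gradient_distr_gradient[OF assms] by (simp add: has_distr_gradient_def)
  obtain m where m: "finite_measure m" "sets m = sets (borel_on \<Omega>)"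
    "\<And>E. E \<in> sets (borel_on \<Omega>) \<Longrightarrow> ennreal (norm (?\<mu> E)) \<le> emeasure m E"
    by (rule vector_measure_dominated[OF vm]) (rule that)
  have zero: "variation (borel_on \<Omega>) (\<lambda>E. 0 :: 'a) E = 0" for E
    by (auto simp: variation_def intro!: antisym SUP_least)
  have "TV_pwL \<Omega> \<gamma> u \<le> total_variation_norm (borel_on \<Omega>) (\<lambda>E. ?\<mu> E - 0)"
    unfolding TV_pwL_def using assms vector_measure_zero[of "borel_on \<Omega>"]
    by (auto simp: zero intro!: INF_lower2[of "\<lambda>E. 0"])
  also have "\<dots> \<le> emeasure m (space (borel_on \<Omega>))"
    unfolding total_variation_norm_def
    by (rule variation_le_emeasure) (use m in auto)
  also have "\<dots> < \<infinity>"
    using finite_measure.emeasure_finite[OF m(1)] by (auto simp: less_top[symmetric])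
  finally show ?thesis .
qed

text \<open>The infima are compared competitor by competitor: each admissible \<open>g\<close> for
  \<open>u\<close> is matched by an admissible one for \<open>p \<circ> u\<close> with no larger
  residual.\<close>

lemma TV_pwL_Lipschitz:
  fixes u :: "'a::euclidean_space \<Rightarrow> real" and p :: "real \<Rightarrow> real"
  assumes \<Omega>: "open \<Omega>" and \<gamma>: "sets \<gamma> = sets (borel_on \<Omega>)" "finite_measure \<gamma>"
    and lip: "\<And>a b. \<bar>p a - p b\<bar> \<le> \<bar>a - b\<bar>"
    and u: "integrable (lebesgue_on \<Omega>) u" "distr_gradient_is_measure \<Omega> u"
    and v: "integrable (lebesgue_on \<Omega>) (\<lambda>x. p (u x))"
  shows "distr_gradient_is_measure \<Omega> (\<lambda>x. p (u x))"
    and "TV_pwL \<Omega> \<gamma> (\<lambda>x. p (u x)) \<le> TV_pwL \<Omega> \<gamma> u"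
proof -
  let ?v = "\<lambda>x. p (u x)" and ?B = "borel_on \<Omega>"
  obtain U where U: "U \<in> borel_measurable borel" "AE x in lebesgue_on \<Omega>. u x = U x"
    using lebesgue_on_borel_representative[OF \<Omega> borel_measurable_integrable[OF u(1)]] by blast
  have "continuous_on UNIV p"
    using lip by (intro lipschitz_on_continuous_on[of 1] lipschitz_onI) (auto simp: dist_real_def)
  then have "p \<in> borel_measurable borel" by (rule borel_measurable_continuous_onI)
  then have pU: "(\<lambda>x. p (U x)) \<in> borel_measurable borel" "AE x in lebesgue_on \<Omega>. p (u x) = p (U x)"
    using U by (auto elim: eventually_mono)
  note repU = lebesgue_on_borel_representative_integral[OF \<Omega> borel_measurable_integrable[OF u(1)] U]
  note repV = lebesgue_on_borel_representative_integral[OF \<Omega> borel_measurable_integrable[OF v] pU]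
  have intU: "integrable lborel (\<lambda>x. indicator \<Omega> x * U x)" and intV: "integrable lborel (\<lambda>x. indicator \<Omega> x * p (U x))"
    using repU(2)[OF borel_measurable_const u(1)] repV(2)[OF borel_measurable_const v] by auto
  let ?Du = "distr_gradient \<Omega> u"
  note Du = has_distr_gradient_distr_gradient[OF u(2)]
  have vmDu: "?Du \<in> vector_measures ?B" using Du by (simp add: has_distr_gradient_def)
  have extension: "\<exists>T. L1_bounded M T \<and> (\<forall>f. integrable M f \<longrightarrow> norm (T f) \<le> (LINT x|M. \<bar>f x\<bar>)) \<and>
      has_distr_gradient \<Omega> ?v (\<lambda>E. T (indicator E))"
    if "finite_measure_on M \<Omega>" and le: "\<And>E. E \<in> sets ?B \<Longrightarrow> ennreal (norm (?Du E)) \<le> emeasure M E" for M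
  proof -
    interpret finite_measure_on M \<Omega> by fact
    have "grad_dominated \<Omega> (\<lambda>x. indicator \<Omega> x * U x) M"
      by (rule grad_dominated_if_distr_gradient[OF Du le intU repU(1)])
    then have "grad_dominated \<Omega> (\<lambda>x. indicator \<Omega> x * p (U x)) M"
      by (rule grad_dominated_Lipschitz[OF intU intV lip, rotated]) auto
    from distr_gradient_if_grad_dominated[OF this intV repV(1)] show ?thesis
      by metis
  qed
  \<comment> \<open>Any finite dominating measure shows that the gradient of
    \<open>p \<circ> u\<close> is a measure; the measure adapted to \<open>g\<close> comes only
    afterwards.\<close>
  obtain m where m: "finite_measure m" "sets m = sets ?B"
    "\<And>E. E \<in> sets ?B \<Longrightarrow> ennreal (norm (?Du E)) \<le> emeasure m E"
    by (rule vector_measure_dominated[OF vmDu]) (rule that)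
  have "finite_measure_on m \<Omega>"
    using m(1,2) \<Omega> by (intro finite_measure_on.intro finite_measure_on_axioms.intro)
  from extension[OF this m(3)] show v_grad: "distr_gradient_is_measure \<Omega> ?v"
    unfolding distr_gradient_is_measure_def by blast
  let ?Dv = "distr_gradient \<Omega> ?v"
  note Dv = has_distr_gradient_distr_gradient[OF v_grad]
  let ?G = "{g \<in> vector_measures ?B. \<forall>E\<in>sets ?B. variation ?B g E \<le> emeasure \<gamma> E}"
  have "\<exists>g'\<in>?G. total_variation_norm ?B (\<lambda>E. ?Dv E - g' E) \<le> total_variation_norm ?B (\<lambda>E. ?Du E - g E)"
    if g: "g \<in> ?G" for g
  \<comment> \<open>With an infinite residual \<open>g\<close> itself will do. Otherwise the
    variation of the residual is a finite measure, as the extension requires.\<close>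
  proof (cases "total_variation_norm ?B (\<lambda>E. ?Du E - g E) = \<infinity>")
    case True
    then show ?thesis using g by auto
  next
    case False
    let ?h = "\<lambda>E. ?Du E - g E"
    have vmh: "?h \<in> vector_measures ?B"
      using vector_measure_diff[OF vmDu] g by simp
    obtain \<beta> where \<beta>: "sets \<beta> = sets ?B" "\<And>E. E \<in> sets ?B \<Longrightarrow> emeasure \<beta> E = variation ?B ?h E"
      by (rule variation_measure[OF vmh]) (rule that)
    have \<beta>_fin: "emeasure \<beta> (space ?B) \<noteq> \<infinity>"
      using False \<beta>(2)[OF sets.top] by (simp add: total_variation_norm_def)
    let ?m = "\<lambda>b. if b then \<gamma> else \<beta>"
    obtain M where M: "sets M = sets ?B"
      "\<And>E. E \<in> sets ?B \<Longrightarrow> emeasure M E = (\<Sum>b\<in>UNIV. emeasure (?m b) E)"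
      by (rule sum_measure[of UNIV ?m ?B]) (auto simp: \<gamma> \<beta> intro: that)
    have M_sum: "emeasure M E = emeasure \<gamma> E + emeasure \<beta> E" if "E \<in> sets ?B" for E
      using M(2)[OF that] by (simp add: UNIV_bool add.commute)
    have "finite_measure M"
      by (rule finite_measure_sum[OF M])
         (use finite_measure.emeasure_finite[OF \<gamma>(2)] \<beta>_fin in auto)
    then have Mon: "finite_measure_on M \<Omega>"
      using \<Omega> M(1) by (intro finite_measure_on.intro finite_measure_on_axioms.intro)
    then interpret finite_measure_on M \<Omega> .
    interpret \<gamma>: finite_measure \<gamma> by fact
    interpret \<beta>: finite_measure \<beta>
      using \<beta>_fin sets_eq_imp_space_eq[OF \<beta>(1)] by (intro finite_measureI) simp
    have "ennreal (norm (?Du E)) \<le> emeasure M E" if E: "E \<in> sets ?B" for E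
    proof -
      have "ennreal (norm (?Du E)) \<le> ennreal (norm (g E)) + ennreal (norm (?h E))"
        using norm_triangle_ineq[of "g E" "?h E"] by (simp add: ennreal_plus[symmetric] ennreal_leI del: ennreal_plus)
      also have "\<dots> \<le> emeasure \<gamma> E + emeasure \<beta> E"
        using norm_le_variation[of g ?B E] norm_le_variation[OF vmh E] g E \<beta>(2)[OF E]
        by (intro add_mono) (auto intro: order_trans)
      finally show ?thesis by (simp add: M_sum[OF E])
    qed
    then obtain T where T: "L1_bounded M T" "\<And>f. integrable M f \<Longrightarrow> norm (T f) \<le> (LINT x|M. \<bar>f x\<bar>)"
      and DT: "has_distr_gradient \<Omega> ?v (\<lambda>E. T (indicator E))"
      using extension[OF Mon] by blast
    obtain r where r: "integrable M r" "AE x in M. 0 \<le> r x \<and> r x \<le> 1"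
      and r_int: "\<And>E. E \<in> sets M \<Longrightarrow> (LINT x|M. r x * indicator E x) = measure \<gamma> E"
      by (rule exists_density_le_1[of \<gamma>]) (use \<gamma>(1) M_sum sets_eq in \<open>auto intro: that\<close>)
    define g' where "g' E = T (\<lambda>x. r x * indicator E x)" for E
    have g'_vm: "g' \<in> vector_measures ?B"
      using L1_bounded_vector_measure[OF T(1) r(1)]
      unfolding vector_measures_cong[OF sets_eq] g'_def[abs_def] .
    have int: "integrable M (\<lambda>x. r x * indicator E x)" if "E \<in> sets M" for E
      using integrable_real_mult_indicator[OF that r(1)] by (simp add: mult.commute)
    have g'_le: "ennreal (norm (g' E)) \<le> emeasure \<gamma> E" if "E \<in> sets ?B" for E
    proof -
      have E: "E \<in> sets M" using that sets_eq by simp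
      have "norm (g' E) \<le> (LINT x|M. \<bar>r x * indicator E x\<bar>)"
        unfolding g'_def by (rule T(2)[OF int[OF E]])
      also have "\<dots> = (LINT x|M. r x * indicator E x)"
        using int[OF E] r(2) by (intro integral_cong_AE) (auto elim: eventually_mono)
      also have "\<dots> = measure \<gamma> E" by (rule r_int[OF E])
      finally show ?thesis by (simp add: \<gamma>.emeasure_eq_measure)
    qed
    have h'_le: "ennreal (norm (?Dv E - g' E)) \<le> emeasure \<beta> E" if EB: "E \<in> sets ?B" for E
    proof -
      have E: "E \<in> sets M" using EB sets_eq by simp
      have "?Dv E - g' E = T (indicator E) - T (\<lambda>x. r x * indicator E x)"
        using distr_gradient_unique[OF \<Omega> Dv DT EB] by (simp add: g'_def)
      also have "\<dots> = T (\<lambda>x. indicator E x - r x * indicator E x)"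
        by (rule L1_bounded_diff[OF T(1) integrable_indicator_finite[OF E] int[OF E], symmetric])
      also have "norm \<dots> \<le> (LINT x|M. \<bar>indicator E x - r x * indicator E x\<bar>)"
        by (intro T(2) Bochner_Integration.integrable_diff integrable_indicator_finite[OF E] int[OF E])
      also have "\<dots> = (LINT x|M. indicator E x - r x * indicator E x)"
      proof (intro integral_cong_AE)
        show "AE x in M. \<bar>indicator E x - r x * indicator E x\<bar> = indicator E x - r x * indicator E x"
          using r(2) by eventually_elim (auto simp: indicator_def)
      qed (use int[OF E] integrable_indicator_finite[OF E] in auto)
      also have "\<dots> = measure M E - measure \<gamma> E"
        using int[OF E] integrable_indicator_finite[OF E] r_int[OF E] sets.sets_into_space[OF E]
        by (simp add: Int_absorb2)
      also have "\<dots> = measure \<beta> E"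
        using M_sum[OF EB] by (simp add: emeasure_eq_measure \<gamma>.emeasure_eq_measure \<beta>.emeasure_eq_measure
            ennreal_plus[symmetric] del: ennreal_plus)
      finally show ?thesis by (simp add: \<beta>.emeasure_eq_measure)
    qed
    have "g' \<in> ?G"
      using g'_vm variation_le_emeasure[OF \<gamma>(1) g'_le] by simp
    moreover have "total_variation_norm ?B (\<lambda>E. ?Dv E - g' E) \<le> emeasure \<beta> (space ?B)"
      unfolding total_variation_norm_def by (rule variation_le_emeasure[OF \<beta>(1) h'_le])
    ultimately show ?thesis
      using \<beta>(2)[OF sets.top] by (intro bexI[of _ g']) (simp_all add: total_variation_norm_def)
  qed
  then show "TV_pwL \<Omega> \<gamma> ?v \<le> TV_pwL \<Omega> \<gamma> u"
    unfolding TV_pwL_def using v_grad u(2) by (simp only: if_True) (intro INF_mono, blast)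
qed

subsection \<open>The maximum principle\<close>

text \<open>Linear growth \<open>\<bar>p a\<bar> \<le> \<bar>a\<bar> + \<bar>p 0\<bar>\<close>; the
  constant is integrable because the measure is finite.\<close>

lemma integrable_Lipschitz_compose:
  assumes M: "finite_measure M" and lip: "\<And>a b. \<bar>p a - p b\<bar> \<le> \<bar>a - b :: real\<bar>" and u: "u \<in> borel_measurable M"
  shows "integrable M u \<Longrightarrow> integrable M (\<lambda>x. p (u x))"
    and "integrable M (\<lambda>x. (u x)\<^sup>2) \<Longrightarrow> integrable M (\<lambda>x. (p (u x))\<^sup>2)"
    and "(\<lambda>x. p (u x)) \<in> borel_measurable M"
proof -
  interpret finite_measure M by fact
  have "continuous_on UNIV p"
    using lip by (intro lipschitz_on_continuous_on[of 1] lipschitz_onI) (auto simp: dist_real_def)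
  then have [measurable]: "p \<in> borel_measurable borel" by (rule borel_measurable_continuous_onI)
  note [measurable] = u
  show "(\<lambda>x. p (u x)) \<in> borel_measurable M" by measurable
  have le: "\<bar>p (u x)\<bar> \<le> \<bar>u x\<bar> + \<bar>p 0\<bar>" for x
    using lip[of "u x" 0] by simp
  show "integrable M (\<lambda>x. p (u x))" if "integrable M u"
    by (rule Bochner_Integration.integrable_bound[of _ "\<lambda>x. \<bar>u x\<bar> + \<bar>p 0\<bar>"]) (use that le in auto)
  show "integrable M (\<lambda>x. (p (u x))\<^sup>2)" if "integrable M (\<lambda>x. (u x)\<^sup>2)"
  proof (rule Bochner_Integration.integrable_bound[of _ "\<lambda>x. 2 * (u x)\<^sup>2 + 2 * (p 0)\<^sup>2"])
    have "(p (u x))\<^sup>2 \<le> 2 * (u x)\<^sup>2 + 2 * (p 0)\<^sup>2" for x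
    proof -
      have "(p (u x))\<^sup>2 \<le> (\<bar>u x\<bar> + \<bar>p 0\<bar>)\<^sup>2"
        using power_mono[OF le[of x], of 2] by simp
      also have "\<dots> \<le> 2 * (u x)\<^sup>2 + 2 * (p 0)\<^sup>2"
        using zero_le_power2[of "\<bar>u x\<bar> - \<bar>p 0\<bar>"] by (simp add: power2_sum power2_diff)
      finally show ?thesis .
    qed
    then show "AE x in M. norm ((p (u x))\<^sup>2) \<le> norm (2 * (u x)\<^sup>2 + 2 * (p 0)\<^sup>2)"
      by simp
  qed (use that in auto)
qed

lemma integrable_power2_diff:
  fixes f g :: "'a \<Rightarrow> real"
  assumes [measurable]: "f \<in> borel_measurable M" "g \<in> borel_measurable M"
    and "integrable M (\<lambda>x. (f x)\<^sup>2)" "integrable M (\<lambda>x. (g x)\<^sup>2)"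
  shows "integrable M (\<lambda>x. (f x - g x)\<^sup>2)"
proof (rule Bochner_Integration.integrable_bound[of _ "\<lambda>x. 2 * (f x)\<^sup>2 + 2 * (g x)\<^sup>2"])
  have "(f x - g x)\<^sup>2 \<le> 2 * (f x)\<^sup>2 + 2 * (g x)\<^sup>2" for x
    using zero_le_power2[of "f x + g x"] by (simp add: power2_sum power2_diff)
  then show "AE x in M. norm ((f x - g x)\<^sup>2) \<le> norm (2 * (f x)\<^sup>2 + 2 * (g x)\<^sup>2)"
    by simp
qed (use assms in auto)

text \<open>The competitor \<open>p \<circ> u\<close> has no larger total variation, so by
  minimality its quadratic term is not smaller. Pointwise it is not larger either, hence the
  integrands agree almost everywhere, and the strict alternative in the last hypothesis is
  excluded.\<close>

lemma minimizer_fixed_by_contraction: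
  fixes \<Omega> :: "'a::euclidean_space set"
  assumes \<Omega>: "open \<Omega>" "bounded \<Omega>" and \<gamma>: "sets \<gamma> = sets (borel_on \<Omega>)" "finite_measure \<gamma>"
    and f: "f \<in> L2 \<Omega>" and min: "is_arg_min (TV_pwL_energy \<Omega> \<gamma> f) (\<lambda>v. v \<in> BV \<Omega> \<inter> L2 \<Omega>) u"
    and lip: "\<And>a b. \<bar>p a - p b\<bar> \<le> \<bar>a - b :: real\<bar>"
    and closer: "AE x in lebesgue_on \<Omega>. p (u x) = u x \<or> \<bar>p (u x) - f x\<bar> < \<bar>u x - f x\<bar>"
  shows "AE x in lebesgue_on \<Omega>. p (u x) = u x"
proof -
  let ?L = "lebesgue_on \<Omega>" and ?v = "\<lambda>x. p (u x)"
  have fin: "finite_measure ?L"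
    using \<Omega> by (intro finite_measure_lebesgue_on bounded_set_imp_lmeasurable) auto
  have u: "integrable ?L u" "distr_gradient_is_measure \<Omega> u" "u \<in> borel_measurable ?L"
    "integrable ?L (\<lambda>x. (u x)\<^sup>2)"
    using min by (auto simp: is_arg_min_def BV_def L2_def)
  have f': "f \<in> borel_measurable ?L" "integrable ?L (\<lambda>x. (f x)\<^sup>2)"
    using f by (auto simp: L2_def)
  note v = integrable_Lipschitz_compose(1)[OF fin lip u(3,1)] integrable_Lipschitz_compose(2)[OF fin lip u(3,4)]
    integrable_Lipschitz_compose(3)[OF fin lip u(3)]
  note TV = TV_pwL_Lipschitz[OF \<Omega>(1) \<gamma> lip u(1,2) v(1)]
  have "?v \<in> BV \<Omega> \<inter> L2 \<Omega>"
    using v TV(1) by (simp add: BV_def L2_def)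
  then have not_less: "\<not> TV_pwL_energy \<Omega> \<gamma> f ?v < TV_pwL_energy \<Omega> \<gamma> f u"
    using min by (auto simp: is_arg_min_def)
  let ?a = "LINT x|?L. (u x - f x)\<^sup>2" and ?b = "LINT x|?L. (?v x - f x)\<^sup>2"
  have int: "integrable ?L (\<lambda>x. (u x - f x)\<^sup>2)" "integrable ?L (\<lambda>x. (?v x - f x)\<^sup>2)"
    by (rule integrable_power2_diff[OF u(3) f'(1) u(4) f'(2)] integrable_power2_diff[OF v(3) f'(1) v(2) f'(2)])+
  have energy: "TV_pwL_energy \<Omega> \<gamma> f w = ennreal ((LINT x|?L. (w x - f x)\<^sup>2) / 2) + TV_pwL \<Omega> \<gamma> w" for w
    by (simp add: TV_pwL_energy_def L2_norm_def)
  have "\<not> ?b < ?a"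
  proof
    assume "?b < ?a"
    obtain r where r: "TV_pwL \<Omega> \<gamma> u = ennreal r" "r \<ge> 0"
      using TV_pwL_finite[OF u(2), of \<gamma>] by (cases "TV_pwL \<Omega> \<gamma> u") auto
    have "TV_pwL_energy \<Omega> \<gamma> f ?v \<le> ennreal (?b / 2) + ennreal r"
      unfolding energy using TV(2) r by (intro add_mono) auto
    also have "\<dots> < ennreal (?a / 2) + ennreal r"
      using \<open>?b < ?a\<close> r(2) by (simp add: ennreal_plus[symmetric] ennreal_less_iff del: ennreal_plus)
    also have "\<dots> = TV_pwL_energy \<Omega> \<gamma> f u"
      unfolding energy r(1) ..
    finally show False using not_less by simp
  qed
  let ?d = "\<lambda>x. (u x - f x)\<^sup>2 - (?v x - f x)\<^sup>2"
  have d0: "AE x in ?L. 0 \<le> ?d x"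
    using closer by eventually_elim (auto simp: abs_le_square_iff[symmetric])
  have "integrable ?L ?d" using int by simp
  moreover have "(LINT x|?L. ?d x) = 0"
    using integral_nonneg_AE[OF d0] int \<open>\<not> ?b < ?a\<close> by simp
  ultimately have "AE x in ?L. ?d x = 0"
    using integral_nonneg_eq_0_iff_AE[OF _ d0] by blast
  with closer show ?thesis
  proof eventually_elim
    case (elim x)
    then have "\<bar>u x - f x\<bar> = \<bar>?v x - f x\<bar>"
      by (simp add: power2_eq_iff abs_eq_iff)
    with elim show ?case by auto
  qed
qed

lemma essinf_eq_uminus_esssup:
  fixes f :: "'a \<Rightarrow> ereal"
  assumes "f \<in> borel_measurable M"
  shows "essinf M f = - esssup M (\<lambda>x. - f x)"
  using assms ereal_Limsup_uminus[of "ae_filter M" f] by (simp add: essinf_def esssup_def)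

theorem theorem8:
  fixes \<Omega> :: "'a::euclidean_space set"
    and \<gamma> :: "'a measure"
    and f u :: "'a \<Rightarrow> real"
  assumes "bounded_lipschitz_domain \<Omega>"
    and "sets \<gamma> = sets (borel_on \<Omega>)" and "finite_measure \<gamma>"
    and "f \<in> L2 \<Omega>"
    and "is_arg_min (TV_pwL_energy \<Omega> \<gamma> f) (\<lambda>v. v \<in> BV \<Omega> \<inter> L2 \<Omega>) u"
  shows "esssup (lebesgue_on \<Omega>) (\<lambda>x. ereal (u x)) \<le> esssup (lebesgue_on \<Omega>) (\<lambda>x. ereal (f x)) \<and>
         essinf (lebesgue_on \<Omega>) (\<lambda>x. ereal (u x)) \<ge> essinf (lebesgue_on \<Omega>) (\<lambda>x. ereal (f x))"
proof -
  let ?L = "lebesgue_on \<Omega>"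
  have \<Omega>: "open \<Omega>" "bounded \<Omega>" "\<Omega> \<noteq> {}"
    using assms(1) by (auto simp: bounded_lipschitz_domain_def)
  have [measurable]: "f \<in> borel_measurable ?L" "u \<in> borel_measurable ?L"
    using assms(4,5) by (auto simp: L2_def is_arg_min_def)
  note fixed = minimizer_fixed_by_contraction[OF \<Omega>(1,2) assms(2-5)]
  \<comment> \<open>A nonempty open set has positive measure. This rules out an essential supremum
    of minus infinity for a real-valued function.\<close>
  have not_null: "\<not> (AE x in ?L. False)"
  proof
    assume "AE x in ?L. False"
    then have "\<Omega> \<in> null_sets lebesgue"
      using \<Omega>(1) by (simp add: AE_restrict_space_iff AE_iff_null_sets)
    then show False
      using \<Omega> negligible_iff_null_sets open_not_negligible by blast
  qed
  have upper: "esssup ?L (\<lambda>x. ereal (u x)) \<le> esssup ?L (\<lambda>x. ereal (f x))"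
  proof (cases "esssup ?L (\<lambda>x. ereal (f x))")
    case (real c)
    have f_le: "AE x in ?L. f x \<le> c"
      using esssup_AE[of "\<lambda>x. ereal (f x)" ?L] unfolding real by simp
    \<comment> \<open>Where \<open>u x > c\<close>, truncation moves strictly towards
      \<open>f x\<close>, because \<open>f x \<le> c\<close>.\<close>
    have "AE x in ?L. min (u x) c = u x"
    proof (rule fixed[of "\<lambda>a. min a c"])
      show "AE x in ?L. min (u x) c = u x \<or> \<bar>min (u x) c - f x\<bar> < \<bar>u x - f x\<bar>"
        using f_le by eventually_elim (auto simp: min_def)
    qed (auto simp: min_def)
    then have "AE x in ?L. ereal (u x) \<le> ereal c"
      by eventually_elim (auto simp: min_def split: if_splits)
    then show ?thesis
      unfolding real by (intro esssup_I) auto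
  next
    case PInf
    then show ?thesis by simp
  next
    case MInf
    have "AE x in ?L. False"
      using esssup_AE[of "\<lambda>x. ereal (f x)" ?L] unfolding MInf by simp
    with not_null show ?thesis by simp
  qed
  \<comment> \<open>The lower bound is the upper one for the negated functions; \<open>c\<close> is
    now minus the essential infimum of \<open>f\<close>, so the truncation is at
    \<open>- c\<close>.\<close>
  have lower: "esssup ?L (\<lambda>x. - ereal (u x)) \<le> esssup ?L (\<lambda>x. - ereal (f x))"
  proof (cases "esssup ?L (\<lambda>x. - ereal (f x))")
    case (real c)
    have f_ge: "AE x in ?L. - c \<le> f x"
      using esssup_AE[of "\<lambda>x. - ereal (f x)" ?L] unfolding real by eventually_elim simp
    have "AE x in ?L. max (u x) (- c) = u x"
    proof (rule fixed[of "\<lambda>a. max a (- c)"])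
      show "AE x in ?L. max (u x) (- c) = u x \<or> \<bar>max (u x) (- c) - f x\<bar> < \<bar>u x - f x\<bar>"
        using f_ge by eventually_elim (auto simp: max_def)
    qed (auto simp: max_def)
    then have "AE x in ?L. - ereal (u x) \<le> ereal c"
      by eventually_elim (auto simp: max_def split: if_splits)
    then show ?thesis
      unfolding real by (intro esssup_I) auto
  next
    case PInf
    then show ?thesis by simp
  next
    case MInf
    have "AE x in ?L. False"
      using esssup_AE[of "\<lambda>x. - ereal (f x)" ?L] unfolding MInf by simp
    with not_null show ?thesis by simp
  qed
  show ?thesis
    using upper lower by (simp add: essinf_eq_uminus_esssup)
qed

end
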